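(* Let $K$ be a field of characteristic zero and let $A=K[H][X,Y;a,\partial=b\frac{d}{dH}\}$ be a generalized Weyl Poisson algebra of rank 1, where $a,b\in K[H]$ and $a\ne0$. Then: (1) The domain $A=K[H,X,Y]/(XY-a)$ is regular iff $(a,a')=K[H]$, where $a'=\frac{da}{dH}$, i.e. the polynomials $a$ and $a'$ are co-prime. (2) Suppose that the algebra $A$ is a regular algebra, i.e. $(a,a')=K[H]$. Then (a) $\mathrm{Der}_K(A)=A\mathcal{H}_A$ iff $b\in K^\times$. (b) $$\mathcal{C}_A=\begin{pmatrix}\{X,X\}&\{X,Y\}&\{X,H\}\\ \{Y,X\}&\{Y,Y\}&\{Y,H\}\\ \{H,X\}&\{H,Y\}&\{H,H\}\end{pmatrix}=\begin{pmatrix}0&-ba'&-bX\\ ba'&0&bY\\ bX&-bY&0\end{pmatrix},$$ and the rank of $\mathcal{C}_A$ is $2$ if $b\ne0$ and $0$ if $b=0$.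
   Context: The generalized Weyl Poisson algebra $K[H][X,Y;a,\partial\}$ of rank 1, where $K[H]$ has the zero Poisson bracket and $\partial$ is a $K$-derivation of $K[H]$, is the commutative algebra $K[H,X,Y]/(XY-a)$ with the Poisson bracket determined by $\{Y,p\}=\partial(p)Y$, $\{X,p\}=-\partial(p)X$ for $p\in K[H]$, and $\{Y,X\}=\partial(a)$. For a Poisson algebra $A$, $\mathcal{H}_A=\{\{u,\cdot\}\mid u\in A\}\subseteq\mathrm{Der}_K(A)$ and $A\mathcal{H}_A$ is the $A$-submodule of $\mathrm{Der}_K(A)$ generated by $\mathcal{H}_A$. $K^\times=K\setminus\{0\}$. The rank of $\mathcal{C}_A$ is over the field of fractions of $A$. *)

theory Defs
  imports
    "HOL-Algebra.Algebra"
    "HOL-Algebra.Algebraic_Closure_Type"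
    "HOL-Computational_Algebra.Polynomial"
    "HOL-Library.Extended_Nat"
    "Jordan_Normal_Form.Matrix"
begin

section \<open>Localization of a commutative ring\<close>

definition loc_rel ::
    "('a, 'm) ring_scheme \<Rightarrow> 'a set \<Rightarrow> (('a \<times> 'a) \<times> ('a \<times> 'a)) set" where
  "loc_rel R S =
     {((r, s), (r', s')). r \<in> carrier R \<and> s \<in> S \<and> r' \<in> carrier R \<and> s' \<in> S \<and>
        (\<exists>t\<in>S. t \<otimes>\<^bsub>R\<^esub> (s' \<otimes>\<^bsub>R\<^esub> r \<ominus>\<^bsub>R\<^esub> s \<otimes>\<^bsub>R\<^esub> r') = \<zero>\<^bsub>R\<^esub>)}"

definition loc_frac :: "('a, 'm) ring_scheme \<Rightarrow> 'a set \<Rightarrow> 'a \<Rightarrow> 'a \<Rightarrow> ('a \<times> 'a) set" where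
  "loc_frac R S r s = loc_rel R S `` {(r, s)}"

text \<open>The ring of fractions of \<open>R\<close> with denominators in the multiplicative set \<open>S\<close>; each union
  below is over representatives and all its members coincide.\<close>

definition localization :: "('a, 'm) ring_scheme \<Rightarrow> 'a set \<Rightarrow> ('a \<times> 'a) set ring" where
  "localization R S =
     \<lparr>carrier = (carrier R \<times> S) // loc_rel R S,
      monoid.mult = (\<lambda>U V. \<Union>(r, s)\<in>U. \<Union>(r', s')\<in>V. loc_frac R S (r \<otimes>\<^bsub>R\<^esub> r') (s \<otimes>\<^bsub>R\<^esub> s')),
      one = loc_frac R S \<one>\<^bsub>R\<^esub> \<one>\<^bsub>R\<^esub>,
      ring.zero = loc_frac R S \<zero>\<^bsub>R\<^esub> \<one>\<^bsub>R\<^esub>,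
      add = (\<lambda>U V. \<Union>(r, s)\<in>U. \<Union>(r', s')\<in>V.
               loc_frac R S (s' \<otimes>\<^bsub>R\<^esub> r \<oplus>\<^bsub>R\<^esub> s \<otimes>\<^bsub>R\<^esub> r') (s \<otimes>\<^bsub>R\<^esub> s'))\<rparr>"

definition fraction_field :: "('a, 'm) ring_scheme \<Rightarrow> ('a \<times> 'a) set ring" where
  "fraction_field R = localization R (carrier R - {\<zero>\<^bsub>R\<^esub>})"

definition to_fraction_field :: "('a, 'm) ring_scheme \<Rightarrow> 'a \<Rightarrow> ('a \<times> 'a) set" where
  "to_fraction_field R r = loc_frac R (carrier R - {\<zero>\<^bsub>R\<^esub>}) r \<one>\<^bsub>R\<^esub>"


section \<open>Regular rings\<close>

definition krull_dim :: "('a, 'm) ring_scheme \<Rightarrow> enat" where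
  "krull_dim R =
     Sup {enat n | n. \<exists>P. (\<forall>i\<le>n. primeideal (P i) R) \<and> (\<forall>i<n. P i \<subset> P (Suc i))}"

text \<open>A regular local ring is a Noetherian local ring of some finite dimension \<open>d\<close> whose maximal
  ideal has the form \<open>(x\<^sub>1, \<dots>, x\<^sub>d)\<close>. Repetitions among the \<open>x\<^sub>i\<close> are allowed; by Krull's height
  theorem fewer than \<open>d\<close> elements never suffice.\<close>

definition regular_local_ring :: "('a, 'm) ring_scheme \<Rightarrow> bool" where
  "regular_local_ring R \<longleftrightarrow>
     cring R \<and> noetherian_ring R \<and> (\<exists>!m. maximalideal m R) \<and>
     (\<forall>m. maximalideal m R \<longrightarrow>
        (\<exists>xs. set xs \<subseteq> carrier R \<and> enat (length xs) = krull_dim R \<and> m = Idl\<^bsub>R\<^esub> (set xs)))"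

definition regular_ring :: "('a, 'm) ring_scheme \<Rightarrow> bool" where
  "regular_ring R \<longleftrightarrow>
     cring R \<and> noetherian_ring R \<and>
     (\<forall>p. primeideal p R \<longrightarrow> regular_local_ring (localization R (carrier R - p)))"


section \<open>Rank of a matrix over a field\<close>

definition cols_lin_indep :: "('a, 'm) ring_scheme \<Rightarrow> 'a mat \<Rightarrow> nat set \<Rightarrow> bool" where
  "cols_lin_indep F M J \<longleftrightarrow>
     (\<forall>c \<in> J \<rightarrow> carrier F.
        (\<forall>i<dim_row M. (\<Oplus>\<^bsub>F\<^esub>j\<in>J. c j \<otimes>\<^bsub>F\<^esub> M $$ (i, j)) = \<zero>\<^bsub>F\<^esub>) \<longrightarrow> (\<forall>j\<in>J. c j = \<zero>\<^bsub>F\<^esub>))"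

definition mat_rank :: "('a, 'm) ring_scheme \<Rightarrow> 'a mat \<Rightarrow> nat" where
  "mat_rank F M = Max {card J | J. J \<subseteq> {..<dim_col M} \<and> cols_lin_indep F M J}"


section \<open>Derivations and Poisson algebras\<close>

definition derivations :: "('k, 'l) ring_scheme \<Rightarrow> ('k, 'a, 'm) module_scheme \<Rightarrow> ('a \<Rightarrow> 'a) set" where
  "derivations K A =
     {D \<in> carrier A \<rightarrow>\<^sub>E carrier A.
        (\<forall>u\<in>carrier A. \<forall>v\<in>carrier A. D (u \<oplus>\<^bsub>A\<^esub> v) = D u \<oplus>\<^bsub>A\<^esub> D v) \<and>
        (\<forall>k\<in>carrier K. \<forall>u\<in>carrier A. D (k \<odot>\<^bsub>A\<^esub> u) = k \<odot>\<^bsub>A\<^esub> D u) \<and>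
        (\<forall>u\<in>carrier A. \<forall>v\<in>carrier A. D (u \<otimes>\<^bsub>A\<^esub> v) = D u \<otimes>\<^bsub>A\<^esub> v \<oplus>\<^bsub>A\<^esub> u \<otimes>\<^bsub>A\<^esub> D v)}"

text \<open>\<open>Der\<^sub>K(A)\<close> as a module over \<open>A\<close>; the ring multiplication and unit of the record are irrelevant.\<close>

definition Der :: "('k, 'l) ring_scheme \<Rightarrow> ('k, 'a, 'm) module_scheme \<Rightarrow> ('a, 'a \<Rightarrow> 'a) module" where
  "Der K A =
     \<lparr>carrier = derivations K A, monoid.mult = undefined, one = undefined,
      ring.zero = (\<lambda>v\<in>carrier A. \<zero>\<^bsub>A\<^esub>),
      add = (\<lambda>D E. \<lambda>v\<in>carrier A. D v \<oplus>\<^bsub>A\<^esub> E v),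
      module.smult = (\<lambda>u D. \<lambda>v\<in>carrier A. u \<otimes>\<^bsub>A\<^esub> D v)\<rparr>"

locale poisson_algebra = algebra K A
  for K :: "('k, 'l) ring_scheme" and A :: "('k, 'a, 'm) module_scheme" +
  fixes br :: "'a \<Rightarrow> 'a \<Rightarrow> 'a"
  assumes br_closed: "\<lbrakk>u \<in> carrier A; v \<in> carrier A\<rbrakk> \<Longrightarrow> br u v \<in> carrier A"
    and br_add: "\<lbrakk>u \<in> carrier A; v \<in> carrier A; w \<in> carrier A\<rbrakk> \<Longrightarrow>
          br u (v \<oplus>\<^bsub>A\<^esub> w) = br u v \<oplus>\<^bsub>A\<^esub> br u w"
    and br_smult: "\<lbrakk>k \<in> carrier K; u \<in> carrier A; v \<in> carrier A\<rbrakk> \<Longrightarrow>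
          br u (k \<odot>\<^bsub>A\<^esub> v) = k \<odot>\<^bsub>A\<^esub> br u v"
    and br_self: "u \<in> carrier A \<Longrightarrow> br u u = \<zero>\<^bsub>A\<^esub>"
    and br_anti: "\<lbrakk>u \<in> carrier A; v \<in> carrier A\<rbrakk> \<Longrightarrow> br u v = \<ominus>\<^bsub>A\<^esub> br v u"
    and br_jacobi: "\<lbrakk>u \<in> carrier A; v \<in> carrier A; w \<in> carrier A\<rbrakk> \<Longrightarrow>
          br u (br v w) \<oplus>\<^bsub>A\<^esub> br v (br w u) \<oplus>\<^bsub>A\<^esub> br w (br u v) = \<zero>\<^bsub>A\<^esub>"
    and br_leibniz: "\<lbrakk>u \<in> carrier A; v \<in> carrier A; w \<in> carrier A\<rbrakk> \<Longrightarrow>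
          br u (v \<otimes>\<^bsub>A\<^esub> w) = br u v \<otimes>\<^bsub>A\<^esub> w \<oplus>\<^bsub>A\<^esub> v \<otimes>\<^bsub>A\<^esub> br u w"

definition hamiltonian_derivations ::
    "('k, 'a, 'm) module_scheme \<Rightarrow> ('a \<Rightarrow> 'a \<Rightarrow> 'a) \<Rightarrow> ('a \<Rightarrow> 'a) set" where
  "hamiltonian_derivations A br = {\<lambda>v\<in>carrier A. br u v | u. u \<in> carrier A}"

text \<open>The submodule of \<open>Der\<^sub>K(A)\<close> generated over \<open>A\<close> by the Hamiltonian derivations.\<close>

definition hamiltonian_span ::
    "('k, 'l) ring_scheme \<Rightarrow> ('k, 'a, 'm) module_scheme \<Rightarrow> ('a \<Rightarrow> 'a \<Rightarrow> 'a) \<Rightarrow> ('a \<Rightarrow> 'a) set" where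
  "hamiltonian_span K A br =
     (\<lambda>N. submodule N A (Der K A)) hull hamiltonian_derivations A br"


section \<open>Generalized Weyl Poisson algebras of rank 1\<close>

text \<open>The ring \<open>K[H,X,Y]\<close> is the iterated polynomial ring \<open>K[H][X][Y]\<close>: the innermost variable is
  \<open>H\<close> and the outermost one is \<open>Y\<close>.\<close>

abbreviation type_ring :: "'a::ring_1 ring" where
  "type_ring \<equiv> ring_of_type_algebra"

definition polyH :: "'k::field_char_0 poly \<Rightarrow> 'k poly poly poly" where
  "polyH p = [:[:p:]:]"

definition gwp_ideal :: "'k::field_char_0 poly \<Rightarrow> 'k poly poly poly set" where
  "gwp_ideal a = PIdl\<^bsub>type_ring\<^esub> ([:[:0, 1:]:] * [:0, 1:] - polyH a)"

definition gwp_class :: "'k::field_char_0 poly \<Rightarrow> 'k poly poly poly \<Rightarrow> 'k poly poly poly set" where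
  "gwp_class a f = gwp_ideal a +>\<^bsub>type_ring\<^esub> f"

definition gwp_algebra :: "'k::field_char_0 poly \<Rightarrow> ('k, 'k poly poly poly set) module" where
  "gwp_algebra a =
     (let Q = type_ring Quot gwp_ideal a in
        \<lparr>carrier = carrier Q, monoid.mult = monoid.mult Q, one = one Q, ring.zero = ring.zero Q, add = add Q,
         module.smult = (\<lambda>k u. gwp_class a (polyH [:k:]) \<otimes>\<^bsub>Q\<^esub> u)\<rparr>)"

definition gwp_of :: "'k::field_char_0 poly \<Rightarrow> 'k poly \<Rightarrow> 'k poly poly poly set" where
  "gwp_of a p = gwp_class a (polyH p)"

definition gwp_H :: "'k::field_char_0 poly \<Rightarrow> 'k poly poly poly set" where
  "gwp_H a = gwp_of a [:0, 1:]"

definition gwp_X :: "'k::field_char_0 poly \<Rightarrow> 'k poly poly poly set" where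
  "gwp_X a = gwp_class a [:[:0, 1:]:]"

definition gwp_Y :: "'k::field_char_0 poly \<Rightarrow> 'k poly poly poly set" where
  "gwp_Y a = gwp_class a [:0, 1:]"

text \<open>The Poisson bracket of the generalized Weyl Poisson algebra \<open>K[H][X, Y; a, \<delta>}\<close>, where
  \<open>K[H]\<close> carries the zero bracket.\<close>

definition gwp_bracket :: "'k::field_char_0 poly \<Rightarrow> ('k poly \<Rightarrow> 'k poly) \<Rightarrow>
    ('k poly poly poly set \<Rightarrow> 'k poly poly poly set \<Rightarrow> 'k poly poly poly set) \<Rightarrow> bool" where
  "gwp_bracket a \<delta> br \<longleftrightarrow> (let A = gwp_algebra a in
     poisson_algebra type_ring A br \<and>
     (\<forall>p q. br (gwp_of a p) (gwp_of a q) = \<zero>\<^bsub>A\<^esub>) \<and>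
     (\<forall>p. br (gwp_Y a) (gwp_of a p) = gwp_of a (\<delta> p) \<otimes>\<^bsub>A\<^esub> gwp_Y a) \<and>
     (\<forall>p. br (gwp_X a) (gwp_of a p) = \<ominus>\<^bsub>A\<^esub> (gwp_of a (\<delta> p) \<otimes>\<^bsub>A\<^esub> gwp_X a)) \<and>
     br (gwp_Y a) (gwp_X a) = gwp_of a (\<delta> a))"

definition gwp_matrix :: "'k::field_char_0 poly \<Rightarrow>
    ('k poly poly poly set \<Rightarrow> 'k poly poly poly set \<Rightarrow> 'k poly poly poly set) \<Rightarrow>
    'k poly poly poly set mat" where
  "gwp_matrix a br = (let x = gwp_X a; y = gwp_Y a; h = gwp_H a in
     mat_of_rows_list 3
       [[br x x, br x y, br x h],
        [br y x, br y y, br y h],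
        [br h x, br h y, br h h]])"

section \<open>Existence of the Poisson bracket\<close>

text \<open>The requirements of \<open>gwp_bracket\<close> are satisfiable when \<open>\<delta> = b d/dH\<close>: the bracket is induced by
  \<open>b\<close> times the Jacobian determinant of \<open>(P, Q, XY - a)\<close> on \<open>K[H,X,Y]\<close>, for which \<open>XY - a\<close> is a
  Casimir element.\<close>

definition is_der :: "('a::comm_ring_1 \<Rightarrow> 'a) \<Rightarrow> bool" where
  "is_der D \<longleftrightarrow> (\<forall>u v. D (u + v) = D u + D v) \<and> (\<forall>u v. D (u * v) = D u * v + u * D v)"

lemma is_derD:
  assumes "is_der D"
  shows "D (u + v) = D u + D v" "D (u * v) = D u * v + u * D v" "D 0 = 0" "D 1 = 0"
    "D (- u) = - D u" "D (u - v) = D u - D v"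
proof -
  show 1: "D (u + v) = D u + D v" and 2: "D (u * v) = D u * v + u * D v" for u v
    using assms by (auto simp: is_der_def)
  show z: "D 0 = 0" using 1[of 0 0] by simp
  show "D 1 = 0" using 2[of 1 1] by simp
  show n: "D (- u) = - D u" for u using 1[of u "- u"] z by (simp add: eq_neg_iff_add_eq_0 add.commute)
  show "D (u - v) = D u - D v" using 1[of u "- v"] n by simp
qed

lemma is_der_pderiv: "is_der (pderiv :: 'a::idom poly \<Rightarrow> _)"
  by (simp add: is_der_def pderiv_add pderiv_mult algebra_simps)

lemma is_der_map_poly:
  assumes "is_der D" shows "is_der (map_poly D)"
proof -
  note D = is_derD[OF assms]
  have s: "D (sum f A) = (\<Sum>i\<in>A. D (f i))" for f and A :: "nat set"
    by (induction A rule: infinite_finite_induct) (simp_all add: D)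
  show ?thesis unfolding is_der_def
    by (auto simp: poly_eq_iff coeff_map_poly D coeff_mult s sum.distrib)
qed

lemma map_poly_pderiv_commute:
  fixes D :: "'a::idom \<Rightarrow> 'a"
  assumes "is_der D" shows "map_poly D (pderiv p) = pderiv (map_poly D p)"
proof -
  note D = is_derD[OF assms]
  have n: "D (of_nat k) = 0" for k by (induction k) (simp_all add: D)
  show ?thesis by (simp add: poly_eq_iff coeff_map_poly D coeff_pderiv n del: of_nat_Suc)
qed

locale jacobian_bracket =
  fixes d1 d2 d3 :: "'a::comm_ring_1 \<Rightarrow> 'a" and f b :: 'a
  assumes d: "is_der d1" "is_der d2" "is_der d3"
    and comm: "d2 (d1 u) = d1 (d2 u)" "d3 (d1 u) = d1 (d3 u)" "d3 (d2 u) = d2 (d3 u)"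
begin
definition J0 where "J0 P Q = d3 f * (d1 P * d2 Q - d2 P * d1 Q) + d1 f * (d2 P * d3 Q - d3 P * d2 Q)
   + d2 f * (d3 P * d1 Q - d1 P * d3 Q)"
definition J where "J P Q = b * J0 P Q"
lemmas D = d[THEN is_derD(1)] d[THEN is_derD(2)] d[THEN is_derD(3)] d[THEN is_derD(4)] d[THEN is_derD(5)] d[THEN is_derD(6)]
lemma J0_leib: "J0 P (Q * R) = J0 P Q * R + Q * J0 P R"
  by (simp add: J0_def D algebra_simps)
lemma J0_anti: "J0 P Q = - J0 Q P" by (simp add: J0_def algebra_simps)
lemma J0_self: "J0 P P = 0" by (simp add: J0_def algebra_simps)
lemma J0_f: "J0 P f = 0" by (simp add: J0_def algebra_simps)
lemma J0_add: "J0 P (Q + R) = J0 P Q + J0 P R" by (simp add: J0_def D algebra_simps)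
lemma plu: "J0 P b * J0 Q R + J0 Q b * J0 R P + J0 R b * J0 P Q = 0"
  by (simp add: J0_def algebra_simps)
lemma jac0: "J0 P (J0 Q R) + J0 Q (J0 R P) + J0 R (J0 P Q) = 0"
  by (simp add: J0_def D comm algebra_simps)
end

lemma type_ring_simps:
  "carrier type_ring = UNIV" "x \<otimes>\<^bsub>type_ring\<^esub> y = x * y" "\<one>\<^bsub>type_ring\<^esub> = 1"
  "\<zero>\<^bsub>type_ring\<^esub> = 0" "x \<oplus>\<^bsub>type_ring\<^esub> y = x + y"
  by (simp_all add: ring_of_type_algebra_def)

context
  fixes a :: "'k::field_char_0 poly"
begin

definition gwp_rel :: "'k poly poly poly" where
  "gwp_rel = [:[:0, 1:]:] * [:0, 1:] - polyH a"

lemma gwp_ideal: "ideal (gwp_ideal a) type_ring"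
  unfolding gwp_ideal_def
  by (intro cring.cgenideal_ideal cring_from_type_algebra) (simp add: type_ring_simps)

lemma gwp_class_set: "gwp_class a f = {h * gwp_rel + f | h. True}"
  unfolding gwp_class_def gwp_ideal_def cgenideal_def a_r_coset_def' type_ring_simps gwp_rel_def
  by auto

lemma gwp_class_eq: "gwp_class a f = gwp_class a g \<longleftrightarrow> (\<exists>h. f = h * gwp_rel + g)"
proof
  assume "gwp_class a f = gwp_class a g"
  moreover have "f \<in> gwp_class a f" unfolding gwp_class_set by (auto intro: exI[of _ 0])
  ultimately show "\<exists>h. f = h * gwp_rel + g" unfolding gwp_class_set by auto
next
  assume "\<exists>h. f = h * gwp_rel + g"
  then obtain h where h: "f = h * gwp_rel + g" by blast
  have "k * gwp_rel + f = (k + h) * gwp_rel + g" "k * gwp_rel + g = (k - h) * gwp_rel + f" for k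
    by (simp_all add: h algebra_simps)
  then show "gwp_class a f = gwp_class a g" unfolding gwp_class_set by blast
qed

lemma gwp_simps:
  "carrier (gwp_algebra a) = range (gwp_class a)"
  "gwp_class a f \<oplus>\<^bsub>gwp_algebra a\<^esub> gwp_class a g = gwp_class a (f + g)"
  "gwp_class a f \<otimes>\<^bsub>gwp_algebra a\<^esub> gwp_class a g = gwp_class a (f * g)"
  "\<zero>\<^bsub>gwp_algebra a\<^esub> = gwp_class a 0"
  "\<one>\<^bsub>gwp_algebra a\<^esub> = gwp_class a 1"
  "k \<odot>\<^bsub>gwp_algebra a\<^esub> gwp_class a f = gwp_class a (polyH [:k:] * f)"
proof -
  interpret ideal "gwp_ideal a" type_ring by (rule gwp_ideal)
  show "carrier (gwp_algebra a) = range (gwp_class a)"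
    by (auto simp: gwp_algebra_def FactRing_def A_RCOSETS_def' gwp_class_def type_ring_simps)
  show "gwp_class a f \<oplus>\<^bsub>gwp_algebra a\<^esub> gwp_class a g = gwp_class a (f + g)"
    using a_rcos_sum[of f g]
    by (simp add: gwp_algebra_def FactRing_def gwp_class_def type_ring_simps)
  show m: "gwp_class a f \<otimes>\<^bsub>gwp_algebra a\<^esub> gwp_class a g = gwp_class a (f * g)" for f g
    using rcoset_mult_add[of f g]
    by (simp add: gwp_algebra_def FactRing_def gwp_class_def type_ring_simps)
  show "\<zero>\<^bsub>gwp_algebra a\<^esub> = gwp_class a 0"
    by (simp add: gwp_algebra_def FactRing_def gwp_class_set Let_def)
      (simp add: gwp_ideal_def cgenideal_def type_ring_simps gwp_rel_def)
  show "\<one>\<^bsub>gwp_algebra a\<^esub> = gwp_class a 1"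
    by (simp add: gwp_algebra_def FactRing_def gwp_class_def type_ring_simps)
  show "k \<odot>\<^bsub>gwp_algebra a\<^esub> gwp_class a f = gwp_class a (polyH [:k:] * f)"
    using m[of "polyH [:k:]" f] by (simp add: gwp_algebra_def Let_def)
qed

lemma polyH_arith:
  "polyH [:k + l:] = polyH [:k:] + polyH [:l:]" "polyH [:k * l:] = polyH [:k:] * polyH [:l:]"
  "polyH [:1:] = 1" for k l :: 'k
  by (simp_all add: polyH_def one_pCons)

lemma gwp_algebra_is_algebra: "algebra type_ring (gwp_algebra a)"
proof -
  have cr: "cring (gwp_algebra a)"
  proof (intro cringI abelian_groupI comm_monoidI)
    fix x assume "x \<in> carrier (gwp_algebra a)"
    then obtain f where f: "x = gwp_class a f" by (auto simp: gwp_simps)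
    show "\<exists>y\<in>carrier (gwp_algebra a). y \<oplus>\<^bsub>gwp_algebra a\<^esub> x = \<zero>\<^bsub>gwp_algebra a\<^esub>"
      by (rule bexI[of _ "gwp_class a (- f)"]) (auto simp: gwp_simps f)
  qed (auto simp: gwp_simps algebra_simps)
  then interpret A: cring "gwp_algebra a" .
  show ?thesis
    by (intro algebra.intro module.intro algebra_axioms.intro module_axioms.intro
        cring_from_type_algebra cr A.abelian_group_axioms)
      (auto simp: gwp_simps type_ring_simps polyH_arith algebra_simps)
qed

lemma gwp_uminus: "\<ominus>\<^bsub>gwp_algebra a\<^esub> gwp_class a f = gwp_class a (- f)"
proof -
  interpret algebra type_ring "gwp_algebra a" by (rule gwp_algebra_is_algebra)
  show ?thesis by (rule M.minus_equality) (auto simp: gwp_simps)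
qed

lemma gwp_bracket_exists: "\<exists>br. gwp_bracket a (\<lambda>p. b * pderiv p) br"
proof -
  define d1 d2 d3 :: "'k poly poly poly \<Rightarrow> _"
    where "d1 = map_poly (map_poly pderiv)" and "d2 = map_poly pderiv" and "d3 = pderiv"
  have pd: "is_der (map_poly pderiv :: 'k poly poly \<Rightarrow> _)"
    by (intro is_der_map_poly is_der_pderiv)
  interpret j: jacobian_bracket d1 d2 d3 gwp_rel "polyH b"
  proof
    show "d2 (d1 u) = d1 (d2 u)" for u
      unfolding d1_def d2_def
      by (simp add: poly_eq_iff[where 'a = "'k poly poly"] coeff_map_poly map_poly_pderiv_commute is_der_pderiv)
    show "d3 (d1 u) = d1 (d3 u)" "d3 (d2 u) = d2 (d3 u)" for u
      unfolding d1_def d2_def d3_def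
      by (simp_all add: map_poly_pderiv_commute is_der_pderiv pd)
  qed (auto simp: d1_def d2_def d3_def intro!: is_der_map_poly is_der_pderiv)
  have const: "d1 (polyH p) = polyH (pderiv p)" "d2 (polyH p) = 0" "d3 (polyH p) = 0"
    "d1 [:[:0, 1:]:] = 0" "d2 [:[:0, 1:]:] = 1" "d3 [:[:0, 1:]:] = 0"
    "d1 [:0, 1:] = 0" "d2 [:0, 1:] = 0" "d3 [:0, 1:] = 1" for p
    by (simp_all add: d1_def d2_def d3_def polyH_def map_poly_pCons pderiv_pCons one_pCons)
  have rel: "d1 gwp_rel = - polyH (pderiv a)" "d2 gwp_rel = [:0, 1:]" "d3 gwp_rel = [:[:0, 1:]:]"
    by (simp_all add: gwp_rel_def j.D const)
      (simp_all add: d1_def d2_def d3_def map_poly_pCons pderiv_pCons one_pCons)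
  note Jadd = j.J0_add and Jleib = j.J0_leib and Janti = j.J0_anti
  have Jrel: "j.J P (h * gwp_rel + Q) = j.J P h * gwp_rel + j.J P Q" for P Q h
    by (simp add: j.J_def Jadd Jleib j.J0_f algebra_simps)
  have JJanti: "j.J P Q = - j.J Q P" for P Q
    using Janti[of P Q] by (simp add: j.J_def)
  define rep where "rep u = (SOME f. gwp_class a f = u)" for u
  define br where "br u v = gwp_class a (j.J (rep u) (rep v))" for u v
  have rep: "\<exists>h. rep (gwp_class a f) = h * gwp_rel + f" for f
    unfolding gwp_class_eq[symmetric] rep_def by (rule someI) simp
  have br: "br (gwp_class a P) (gwp_class a Q) = gwp_class a (j.J P Q)" for P Q
  proof -
    obtain h k where hk: "rep (gwp_class a P) = h * gwp_rel + P"
      "rep (gwp_class a Q) = k * gwp_rel + Q" using rep by metis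
    have "j.J (h * gwp_rel + P) Q = - j.J Q (h * gwp_rel + P)"
      by (rule JJanti)
    also have "\<dots> = j.J P Q - j.J Q h * gwp_rel"
      using JJanti[of P Q] by (simp only: Jrel) simp
    finally have "j.J (h * gwp_rel + P) (k * gwp_rel + Q) =
        (j.J (h * gwp_rel + P) k - j.J Q h) * gwp_rel + j.J P Q"
      by (simp only: Jrel left_diff_distrib) simp
    then show ?thesis unfolding br_def hk gwp_class_eq by blast
  qed
  have jacobi: "j.J P (j.J Q R) + j.J Q (j.J R P) + j.J R (j.J P Q) = 0" for P Q R
  proof -
    have "j.J P (j.J Q R) + j.J Q (j.J R P) + j.J R (j.J P Q) =
        polyH b * (j.J0 P (polyH b) * j.J0 Q R + j.J0 Q (polyH b) * j.J0 R P
          + j.J0 R (polyH b) * j.J0 P Q)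
        + polyH b * polyH b * (j.J0 P (j.J0 Q R) + j.J0 Q (j.J0 R P) + j.J0 R (j.J0 P Q))"
      by (simp add: j.J_def Jleib algebra_simps)
    then show ?thesis by (simp only: j.plu j.jac0) simp
  qed
  have scal: "j.J P (polyH [:k:]) = 0" for P k
    by (simp add: j.J_def j.J0_def const) (simp add: polyH_def)
  have JJ: "j.J P (Q + R) = j.J P Q + j.J P R" "j.J P P = 0"
    "j.J P (Q * R) = j.J P Q * R + Q * j.J P R" for P Q R
    by (simp_all add: j.J_def Jadd Jleib j.J0_self algebra_simps)
  have "poisson_algebra type_ring (gwp_algebra a) br"
  proof (intro poisson_algebra.intro poisson_algebra_axioms.intro gwp_algebra_is_algebra)
    fix u v assume "u \<in> carrier (gwp_algebra a)" "v \<in> carrier (gwp_algebra a)"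
    then obtain P Q where "u = gwp_class a P" "v = gwp_class a Q" by (auto simp: gwp_simps)
    then show "br u v = \<ominus>\<^bsub>gwp_algebra a\<^esub> br v u"
      using JJanti[of P Q] by (simp add: br gwp_uminus)
  qed (auto simp: gwp_simps br JJ(1,2) scal jacobi JJ(3))
  moreover have "j.J (polyH p) (polyH q) = 0"
    "j.J [:0, 1:] (polyH p) = polyH (b * pderiv p) * [:0, 1:]"
    "j.J [:[:0, 1:]:] (polyH p) = - (polyH (b * pderiv p) * [:[:0, 1:]:])"
    "j.J [:0, 1:] [:[:0, 1:]:] = polyH (b * pderiv a)" for p q
    by (simp_all add: j.J_def j.J0_def const rel) (simp_all add: polyH_def)
  ultimately have "gwp_bracket a (\<lambda>p. b * pderiv p) br"
    unfolding gwp_bracket_def Let_def gwp_of_def gwp_X_def gwp_Y_def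
    by (simp add: br gwp_simps gwp_uminus)
  then show ?thesis by blast
qed

end

end

theory Submission
  imports Defs
begin

text \<open>Inverting \<open>X\<close> (or \<open>Y\<close>) turns \<open>A\<close> into \<open>K[H,X,1/X]\<close> (or \<open>K[H,Y,1/Y]\<close>), so primes of \<open>A\<close> that
  miss one of \<open>X\<close>, \<open>Y\<close> can be read off from primes of a polynomial ring in two variables; the
  others are \<open>(X, Y, p)\<close> with \<open>p\<close> a prime divisor of \<open>a\<close>. Hence every nonzero prime of \<open>A\<close> is either
  locally principal, so of height one, or maximal with a prime strictly between it and \<open>0\<close>. This
  bounds the dimension by 2, and every prime is locally generated by as many elements as its height
  except possibly \<open>(X, Y, p)\<close>. If \<open>p\<^sup>2\<close> does not divide \<open>a\<close>, then \<open>p\<close> is locally a multiple of \<open>XY\<close>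
  and the two elements \<open>X, Y\<close> suffice. If \<open>p\<^sup>2\<close> divides \<open>a\<close>, the coefficients of \<open>p\<close>, \<open>X\<close>, \<open>Y\<close> modulo \<open>p\<close>
  show that the cotangent space at \<open>(X, Y, p)\<close> is three-dimensional.

  For \<open>b\<close> a unit, a Bezout relation between \<open>a\<close> and \<open>a'\<close> writes any derivation as a combination of the
  Hamiltonian derivations of \<open>X\<close>, \<open>Y\<close>, \<open>H\<close>. Conversely all Hamiltonian derivations take values in \<open>bA\<close>,
  whereas the derivation \<open>{H, -}\<close> of the bracket with \<open>b = 1\<close> takes \<open>X\<close> to \<open>X\<close>, which lies in \<open>bA\<close> only
  if \<open>b\<close> is a unit.\<close>

section \<open>Localizations of domains\<close>

text \<open>Regularity asks for the exact Krull dimension of each local ring, so every prime needs a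
  chain of primes below it of the right length as well as a bound on all such chains. Both are
  counted in the ring itself: primes of the localization at \<open>P\<close> correspond to primes
  inside \<open>P\<close>, and generators of its maximal ideal may be taken to be numerators. The
  bound for locally principal primes is Krull's principal ideal theorem for a Noetherian domain.
  Refuting regularity takes only the upper bound 2, since a regular local ring at (X, Y, p) would
  then have a maximal ideal with at most two generators. Coprimality of a and a' matters through one
  consequence only: in characteristic zero a prime p divides both exactly when p^2 divides a.
  Elements of \<open>A\<close> are represented by polynomials in K[H,X,Y] throughout, because
  divisibility by XY - a is easier to handle than equality of cosets.\<close>

definition prime_chain :: "('a, 'm) ring_scheme \<Rightarrow> 'a set \<Rightarrow> nat \<Rightarrow> bool" where
  "prime_chain R P n \<longleftrightarrow>
     (\<exists>Q. (\<forall>i\<le>n. primeideal (Q i) R) \<and> (\<forall>i<n. Q i \<subset> Q (Suc i)) \<and> Q n \<subseteq> P)"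

text \<open>Collapses the unions over representatives by which sum and product of a localization are
  defined, once all members are known to coincide.\<close>

lemma UN_pair_const:
  assumes "(p, q) \<in> U" "\<And>p q. (p, q) \<in> U \<Longrightarrow> f p q = c"
  shows "(\<Union>(p, q)\<in>U. f p q) = c"
  using assms by (intro SUP_eq_const) auto

locale domain_localization = domain R for R (structure) +
  fixes S
  assumes S_sub: "S \<subseteq> carrier R" and one_S: "\<one> \<in> S" and zero_S: "\<zero> \<notin> S"
    and mult_S: "\<lbrakk>s \<in> S; t \<in> S\<rbrakk> \<Longrightarrow> s \<otimes> t \<in> S"
begin

abbreviation "L \<equiv> localization R S"
abbreviation "fr \<equiv> loc_frac R S"

lemma S_carr [simp]: "s \<in> S \<Longrightarrow> s \<in> carrier R" using S_sub by blast
lemma S_nz [simp]: "s \<in> S \<Longrightarrow> s \<noteq> \<zero>" using zero_S by blast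
lemmas [simp] = one_S mult_S

text \<open>In a domain the auxiliary factor \<open>t\<close> of \<open>loc_rel\<close> is nonzero
  and cancels, so equality of fractions is cross-multiplication.\<close>

lemma rel_iff: "((r, s), (r', s')) \<in> loc_rel R S \<longleftrightarrow>
    r \<in> carrier R \<and> s \<in> S \<and> r' \<in> carrier R \<and> s' \<in> S \<and> s' \<otimes> r = s \<otimes> r'"
proof -
  have "(\<exists>t\<in>S. t \<otimes> (s' \<otimes> r \<ominus> s \<otimes> r') = \<zero>) \<longleftrightarrow> s' \<otimes> r = s \<otimes> r'"
    if "r \<in> carrier R" "s \<in> S" "r' \<in> carrier R" "s' \<in> S"
  proof -
    have "s' \<otimes> r \<ominus> s \<otimes> r' \<in> carrier R" using that by simp
    then have "(\<exists>t\<in>S. t \<otimes> (s' \<otimes> r \<ominus> s \<otimes> r') = \<zero>) \<longleftrightarrow> s' \<otimes> r \<ominus> s \<otimes> r' = \<zero>"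
      using integral_iff[OF S_carr, of _ "s' \<otimes> r \<ominus> s \<otimes> r'"] S_nz one_S by blast
    then show ?thesis using that by simp
  qed
  then show ?thesis by (auto simp: loc_rel_def)
qed

lemma loc_equiv: "equiv (carrier R \<times> S) (loc_rel R S)"
proof (intro equivI)
  show "refl_on (carrier R \<times> S) (loc_rel R S)" "sym (loc_rel R S)"
    by (auto simp: refl_on_def sym_def rel_iff m_comm)
  show "trans (loc_rel R S)"
  proof (rule transI, clarify)
    fix r s r' s' r'' s''
    assume "((r, s), (r', s')) \<in> loc_rel R S" "((r', s'), (r'', s'')) \<in> loc_rel R S"
    then have c: "r \<in> carrier R" "s \<in> S" "r' \<in> carrier R" "s' \<in> S" "r'' \<in> carrier R" "s'' \<in> S"
      and e: "s' \<otimes> r = s \<otimes> r'" "s'' \<otimes> r' = s' \<otimes> r''" by (auto simp: rel_iff)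
    have "s' \<otimes> (s'' \<otimes> r) = s'' \<otimes> (s' \<otimes> r)" using c by (simp add: m_ac)
    also have "\<dots> = s \<otimes> (s'' \<otimes> r')" unfolding e(1) using c by (simp add: m_ac)
    also have "\<dots> = s' \<otimes> (s \<otimes> r'')" unfolding e(2) using c by (simp add: m_ac)
    finally have "s'' \<otimes> r = s \<otimes> r''" using c m_lcancel[of s'] by simp
    then show "((r, s), (r'', s'')) \<in> loc_rel R S" using c by (simp add: rel_iff)
  qed
qed (auto simp: loc_rel_def)

lemma fr_eq: "\<lbrakk>r \<in> carrier R; s \<in> S; r' \<in> carrier R; s' \<in> S\<rbrakk> \<Longrightarrow>
    fr r s = fr r' s' \<longleftrightarrow> s' \<otimes> r = s \<otimes> r'"
  unfolding loc_frac_def using eq_equiv_class_iff[OF loc_equiv, of "(r, s)" "(r', s')"]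
  by (simp add: rel_iff)

lemma fr_self: "\<lbrakk>r \<in> carrier R; s \<in> S\<rbrakk> \<Longrightarrow> (r, s) \<in> fr r s"
  by (simp add: loc_frac_def rel_iff)

lemma fr_mem: "(r', s') \<in> fr r s \<longleftrightarrow>
    r \<in> carrier R \<and> s \<in> S \<and> r' \<in> carrier R \<and> s' \<in> S \<and> s' \<otimes> r = s \<otimes> r'"
  by (auto simp: loc_frac_def rel_iff)

lemma carrier_L: "carrier L = {fr r s | r s. r \<in> carrier R \<and> s \<in> S}"
  by (auto simp: localization_def quotient_def loc_frac_def)

lemma fr_closed [simp]: "\<lbrakk>r \<in> carrier R; s \<in> S\<rbrakk> \<Longrightarrow> fr r s \<in> carrier L"
  by (auto simp: carrier_L)

lemma L_cases:
  assumes "x \<in> carrier L" obtains r s where "r \<in> carrier R" "s \<in> S" "x = fr r s"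
  using assms by (auto simp: carrier_L)

lemma fr_mult [simp]:
  assumes c: "r \<in> carrier R" "s \<in> S" "r' \<in> carrier R" "s' \<in> S"
  shows "fr r s \<otimes>\<^bsub>L\<^esub> fr r' s' = fr (r \<otimes> r') (s \<otimes> s')"
proof -
  have "fr (p \<otimes> p') (q \<otimes> q') = fr (r \<otimes> r') (s \<otimes> s')"
    if "(p, q) \<in> fr r s" "(p', q') \<in> fr r' s'" for p q p' q'
  proof -
    have m: "p \<in> carrier R" "q \<in> S" "p' \<in> carrier R" "q' \<in> S" "q \<otimes> r = s \<otimes> p" "q' \<otimes> r' = s' \<otimes> p'"
      using that by (auto simp: fr_mem)
    have "s \<otimes> s' \<otimes> (p \<otimes> p') = (s \<otimes> p) \<otimes> (s' \<otimes> p')" using c m(1-4) by (simp add: m_ac)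
    also have "\<dots> = q \<otimes> q' \<otimes> (r \<otimes> r')"
      unfolding m(5,6)[symmetric] using c m(1-4) by (simp add: m_ac)
    finally show ?thesis using c m by (simp add: fr_eq)
  qed
  then have "(\<Union>(p, q)\<in>fr r s. \<Union>(p', q')\<in>fr r' s'. fr (p \<otimes> p') (q \<otimes> q')) = fr (r \<otimes> r') (s \<otimes> s')"
    using c by (intro UN_pair_const[OF fr_self]) auto
  then show ?thesis by (simp add: localization_def)
qed

lemma fr_add [simp]:
  assumes c: "r \<in> carrier R" "s \<in> S" "r' \<in> carrier R" "s' \<in> S"
  shows "fr r s \<oplus>\<^bsub>L\<^esub> fr r' s' = fr (s' \<otimes> r \<oplus> s \<otimes> r') (s \<otimes> s')"
proof -
  have "fr (q' \<otimes> p \<oplus> q \<otimes> p') (q \<otimes> q') = fr (s' \<otimes> r \<oplus> s \<otimes> r') (s \<otimes> s')"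
    if "(p, q) \<in> fr r s" "(p', q') \<in> fr r' s'" for p q p' q'
  proof -
    have m: "p \<in> carrier R" "q \<in> S" "p' \<in> carrier R" "q' \<in> S" "q \<otimes> r = s \<otimes> p" "q' \<otimes> r' = s' \<otimes> p'"
      using that by (auto simp: fr_mem)
    have "s \<otimes> s' \<otimes> (q' \<otimes> p \<oplus> q \<otimes> p') = s' \<otimes> q' \<otimes> (s \<otimes> p) \<oplus> s \<otimes> q \<otimes> (s' \<otimes> p')"
      using c m(1-4) by (simp add: m_ac r_distr)
    also have "\<dots> = q \<otimes> q' \<otimes> (s' \<otimes> r \<oplus> s \<otimes> r')"
      unfolding m(5,6)[symmetric] using c m(1-4) by (simp add: m_ac r_distr)
    finally show ?thesis using c m by (simp add: fr_eq)
  qed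
  then have "(\<Union>(p, q)\<in>fr r s. \<Union>(p', q')\<in>fr r' s'. fr (q' \<otimes> p \<oplus> q \<otimes> p') (q \<otimes> q'))
      = fr (s' \<otimes> r \<oplus> s \<otimes> r') (s \<otimes> s')"
    using c by (intro UN_pair_const[OF fr_self]) auto
  then show ?thesis by (simp add: localization_def)
qed

lemma L_zero: "\<zero>\<^bsub>L\<^esub> = fr \<zero> \<one>" and L_one: "\<one>\<^bsub>L\<^esub> = fr \<one> \<one>"
  by (simp_all add: localization_def)

lemma fr_eq_zero: "\<lbrakk>r \<in> carrier R; s \<in> S\<rbrakk> \<Longrightarrow> fr r s = \<zero>\<^bsub>L\<^esub> \<longleftrightarrow> r = \<zero>"
  by (simp add: L_zero fr_eq)

lemma L_domain: "domain L"
proof -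
  have "cring L"
  proof (intro cringI abelian_groupI comm_monoidI)
    fix x assume "x \<in> carrier L"
    then obtain r s where x: "r \<in> carrier R" "s \<in> S" "x = fr r s" by (rule L_cases)
    have "s \<otimes> (\<ominus> r) \<oplus> s \<otimes> r = \<zero>" using x by (simp add: r_minus l_neg)
    then have "fr (\<ominus> r) s \<oplus>\<^bsub>L\<^esub> x = \<zero>\<^bsub>L\<^esub>"
      using x by (simp add: L_zero fr_eq)
    then show "\<exists>y\<in>carrier L. y \<oplus>\<^bsub>L\<^esub> x = \<zero>\<^bsub>L\<^esub>" using x fr_closed[of "\<ominus> r" s] by blast
  next
    fix x y z assume "x \<in> carrier L" "y \<in> carrier L" "z \<in> carrier L"
    then obtain r s r' s' r'' s'' where c: "r \<in> carrier R" "s \<in> S" "x = fr r s" "r' \<in> carrier R"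
      "s' \<in> S" "y = fr r' s'" "r'' \<in> carrier R" "s'' \<in> S" "z = fr r'' s''"
      by (elim L_cases)
    show "x \<oplus>\<^bsub>L\<^esub> y \<in> carrier L" "x \<otimes>\<^bsub>L\<^esub> y \<in> carrier L" "x \<oplus>\<^bsub>L\<^esub> y = y \<oplus>\<^bsub>L\<^esub> x"
      "x \<otimes>\<^bsub>L\<^esub> y = y \<otimes>\<^bsub>L\<^esub> x" "\<zero>\<^bsub>L\<^esub> \<oplus>\<^bsub>L\<^esub> x = x" "\<one>\<^bsub>L\<^esub> \<otimes>\<^bsub>L\<^esub> x = x"
      "x \<otimes>\<^bsub>L\<^esub> y \<otimes>\<^bsub>L\<^esub> z = x \<otimes>\<^bsub>L\<^esub> (y \<otimes>\<^bsub>L\<^esub> z)"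
      using c by (simp_all add: L_zero L_one a_comm m_ac)
    show "x \<oplus>\<^bsub>L\<^esub> y \<oplus>\<^bsub>L\<^esub> z = x \<oplus>\<^bsub>L\<^esub> (y \<oplus>\<^bsub>L\<^esub> z)"
      using c by (simp add: r_distr m_ac a_ac)
    show "(x \<oplus>\<^bsub>L\<^esub> y) \<otimes>\<^bsub>L\<^esub> z = x \<otimes>\<^bsub>L\<^esub> z \<oplus>\<^bsub>L\<^esub> y \<otimes>\<^bsub>L\<^esub> z"
      using c by (simp add: fr_eq l_distr r_distr m_ac)
  qed (simp_all add: L_zero L_one)
  then show ?thesis
  proof (rule domain.intro, unfold_locales)
    show "\<one>\<^bsub>L\<^esub> \<noteq> \<zero>\<^bsub>L\<^esub>" by (simp add: L_one fr_eq_zero)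
    show "a = \<zero>\<^bsub>L\<^esub> \<or> b = \<zero>\<^bsub>L\<^esub>" if "a \<otimes>\<^bsub>L\<^esub> b = \<zero>\<^bsub>L\<^esub>" "a \<in> carrier L" "b \<in> carrier L" for a b
      using that by (elim L_cases) (simp add: fr_eq_zero integral_iff)
  qed
qed

sublocale L: domain L by (rule L_domain)

lemma fr_split: "\<lbrakk>r \<in> carrier R; s \<in> S\<rbrakk> \<Longrightarrow> fr r s = fr \<one> s \<otimes>\<^bsub>L\<^esub> fr r \<one>"
  and fr_clear: "\<lbrakk>r \<in> carrier R; s \<in> S\<rbrakk> \<Longrightarrow> fr r \<one> = fr s \<one> \<otimes>\<^bsub>L\<^esub> fr r s"
  by (simp_all add: fr_eq m_ac)

text \<open>Contraction and extension of ideals along r -> r/1. Over a common denominator the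
  fractions with numerator in \<open>I\<close> already form an ideal, so no generated ideal is
  needed in \<open>ext\<close>.\<close>

definition "contr I = {r \<in> carrier R. fr r \<one> \<in> I}"
definition "ext I = {fr r s | r s. r \<in> I \<and> s \<in> S}"

text \<open>Denominators are units of \<open>L\<close>, so membership of a fraction in an ideal
  depends on its numerator alone. In particular an ideal of \<open>L\<close> is determined by its
  contraction.\<close>

lemma ideal_fr_iff:
  assumes "ideal I L" "r \<in> carrier R" "s \<in> S"
  shows "fr r s \<in> I \<longleftrightarrow> r \<in> contr I"
proof
  assume "fr r s \<in> I"
  then have "fr s \<one> \<otimes>\<^bsub>L\<^esub> fr r s \<in> I" using assms by (intro ideal.I_l_closed) auto
  then show "r \<in> contr I" 
    using assms by (simp add: contr_def del: fr_mult flip: fr_clear)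
next
  assume "r \<in> contr I"
  then have "fr \<one> s \<otimes>\<^bsub>L\<^esub> fr r \<one> \<in> I"
    using assms unfolding contr_def by (intro ideal.I_l_closed) auto
  then show "fr r s \<in> I" using assms by (simp del: fr_mult flip: fr_split)
qed

end

lemma (in cring) cring_idealI:
  assumes "I \<subseteq> carrier R" "\<zero> \<in> I" "\<And>x y. x \<in> I \<Longrightarrow> y \<in> I \<Longrightarrow> x \<oplus> y \<in> I"
    "\<And>x y. x \<in> carrier R \<Longrightarrow> y \<in> I \<Longrightarrow> x \<otimes> y \<in> I"
  shows "ideal I R"
proof (rule idealI)
  have "\<ominus> x \<in> I" if "x \<in> I" for x
    using assms(4)[of "\<ominus> \<one>" x] that assms(1) by (auto simp: l_minus)
  then show "subgroup I (add_monoid R)"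
    using assms by (intro subgroup.intro) (auto simp flip: a_inv_def)
  show "x \<otimes> a \<in> I" "a \<otimes> x \<in> I" if "a \<in> I" "x \<in> carrier R" for a x
    using assms that m_comm[of a x] by auto
qed (rule ring_axioms)

context domain_localization begin

lemma contr_ideal: assumes "ideal I L" shows "ideal (contr I) R"
proof -
  interpret I: ideal I L by fact
  have s: "fr (x \<oplus> y) \<one> = fr x \<one> \<oplus>\<^bsub>L\<^esub> fr y \<one>" "fr (x \<otimes> y) \<one> = fr x \<one> \<otimes>\<^bsub>L\<^esub> fr y \<one>"
    if "x \<in> carrier R" "y \<in> carrier R" for x y
    using that by simp_all
  show ?thesis
    by (rule cring_idealI) (auto simp: contr_def s simp flip: L_zero simp del: fr_add fr_mult
        intro: I.a_closed I.I_l_closed)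
qed

lemma ext_ideal: assumes "ideal I R" shows "ideal (ext I) L"
proof -
  interpret I: ideal I R by fact
  show ?thesis
  proof (rule L.cring_idealI)
    show "ext I \<subseteq> carrier L" using I.Icarr by (auto simp: ext_def)
    show "\<zero>\<^bsub>L\<^esub> \<in> ext I" unfolding ext_def L_zero using one_S I.zero_closed by blast
    show "x \<oplus>\<^bsub>L\<^esub> y \<in> ext I" if xy: "x \<in> ext I" "y \<in> ext I" for x y
    proof -
      obtain r s r' s' where "r \<in> I" "s \<in> S" "r' \<in> I" "s' \<in> S" "x = fr r s" "y = fr r' s'"
        using xy unfolding ext_def by blast
      then have "x \<oplus>\<^bsub>L\<^esub> y = fr (s' \<otimes> r \<oplus> s \<otimes> r') (s \<otimes> s')" "s' \<otimes> r \<oplus> s \<otimes> r' \<in> I" "s \<otimes> s' \<in> S"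
        using I.Icarr I.I_l_closed I.a_closed by auto
      then show ?thesis unfolding ext_def by blast
    qed
    show "x \<otimes>\<^bsub>L\<^esub> y \<in> ext I" if x: "x \<in> carrier L" and y: "y \<in> ext I" for x y
    proof -
      obtain r s where r: "r \<in> carrier R" "s \<in> S" "x = fr r s" using x by (rule L_cases)
      obtain r' s' where y: "r' \<in> I" "s' \<in> S" "y = fr r' s'" using y by (auto simp: ext_def)
      have "x \<otimes>\<^bsub>L\<^esub> y = fr (r \<otimes> r') (s \<otimes> s')" "r \<otimes> r' \<in> I" "s \<otimes> s' \<in> S"
        using r y I.Icarr I.I_l_closed by auto
      then show ?thesis unfolding ext_def by blast
    qed
  qed
qed

lemma contr_prime: assumes "primeideal I L" shows "primeideal (contr I) R" "contr I \<inter> S = {}"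
proof -
  interpret I: primeideal I L by fact
  have one: "fr \<one> \<one> \<notin> I" using I.I_notcarr I.one_imp_carrier by (auto simp: L_one)
  show "contr I \<inter> S = {}"
  proof (rule ccontr)
    assume "contr I \<inter> S \<noteq> {}"
    then obtain s where s: "s \<in> S" "fr s \<one> \<in> I" by (auto simp: contr_def)
    then have "fr s s \<in> I" using I.I_l_closed[OF s(2), of "fr \<one> s"] by simp
    moreover have "fr s s = fr \<one> \<one>" using s by (simp add: fr_eq)
    ultimately show False using one by simp
  qed
  show "primeideal (contr I) R"
  proof (intro primeidealI contr_ideal I.is_ideal is_cring)
    show "carrier R \<noteq> contr I" using one by (auto simp: contr_def)
    show "x \<in> contr I \<or> y \<in> contr I" if "x \<in> carrier R" "y \<in> carrier R" "x \<otimes> y \<in> contr I" for x y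
      using I.I_prime[of "fr x \<one>" "fr y \<one>"] that by (auto simp: contr_def)
  qed
qed

text \<open>A fraction may have several numerators, but s' r = s r' with r' in \<open>Q\<close> and
  s' outside the prime \<open>Q\<close> forces r into \<open>Q\<close>.\<close>

lemma ext_iff:
  assumes "primeideal Q R" "Q \<inter> S = {}" "r \<in> carrier R" "s \<in> S"
  shows "fr r s \<in> ext Q \<longleftrightarrow> r \<in> Q"
proof
  interpret Q: primeideal Q R by fact
  assume "fr r s \<in> ext Q"
  then obtain r' s' where r: "r' \<in> Q" "s' \<in> S" "fr r s = fr r' s'" by (auto simp: ext_def)
  then have "s' \<otimes> r = s \<otimes> r'" using assms Q.Icarr by (simp add: fr_eq)
  then have "s' \<otimes> r \<in> Q" using Q.I_l_closed r assms by simp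
  then show "r \<in> Q" using Q.I_prime[of s' r] r assms by auto
qed (use assms in \<open>auto simp: ext_def\<close>)

lemma ext_prime:
  assumes "primeideal Q R" "Q \<inter> S = {}"
  shows "primeideal (ext Q) L"
proof -
  interpret Q: primeideal Q R by fact
  have "\<one> \<notin> Q" using assms one_S by blast
  then have "fr \<one> \<one> \<notin> ext Q" using ext_iff[OF assms, of \<one> \<one>] by simp
  moreover have "fr \<one> \<one> \<in> carrier L" by simp
  ultimately have "carrier L \<noteq> ext Q" by blast
  moreover have "x \<in> ext Q \<or> y \<in> ext Q"
    if xy: "x \<in> carrier L" "y \<in> carrier L" "x \<otimes>\<^bsub>L\<^esub> y \<in> ext Q" for x y
  proof -
    obtain r s where r: "r \<in> carrier R" "s \<in> S" "x = fr r s" using xy(1) by (rule L_cases)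
    obtain r' s' where r': "r' \<in> carrier R" "s' \<in> S" "y = fr r' s'" using xy(2) by (rule L_cases)
    have "r \<otimes> r' \<in> Q" using xy(3) r r' ext_iff[OF assms, of "r \<otimes> r'" "s \<otimes> s'"] by simp
    then show ?thesis using Q.I_prime[of r r'] r r' ext_iff[OF assms] by simp
  qed
  ultimately show ?thesis by (intro primeidealI ext_ideal Q.is_ideal L.is_cring)
qed

text \<open>Finitely many generators of the contraction of an ideal map to generators of the ideal,
  because every fraction in it has its numerator in the contraction.\<close>

lemma L_noetherian: assumes "noetherian_ring R" shows "noetherian_ring L"
proof (rule L.noetherian_ringI)
  fix I assume I: "ideal I L"
  interpret I: ideal I L by fact
  obtain G where G: "G \<subseteq> carrier R" "finite G" "contr I = Idl G"
    using noetherian_ring.finetely_gen[OF assms contr_ideal[OF I]] by blast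
  let ?G = "(\<lambda>r. fr r \<one>) ` G"
  have GI: "?G \<subseteq> I" using genideal_self[OF G(1)] by (auto simp: G(3)[symmetric] contr_def)
  have Gc: "?G \<subseteq> carrier L" using GI I.Icarr by blast
  have J: "ideal (Idl\<^bsub>L\<^esub> ?G) L" by (rule L.genideal_ideal[OF Gc])
  have "G \<subseteq> contr (Idl\<^bsub>L\<^esub> ?G)" using L.genideal_self[OF Gc] G(1) by (auto simp: contr_def)
  then have sub: "contr I \<subseteq> contr (Idl\<^bsub>L\<^esub> ?G)"
    unfolding G(3) by (intro genideal_minimal contr_ideal J)
  have "x \<in> Idl\<^bsub>L\<^esub> ?G" if x: "x \<in> I" for x
  proof -
    obtain r s where "r \<in> carrier R" "s \<in> S" "x = fr r s" using I.Icarr[OF x] by (rule L_cases)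
    then show ?thesis using ideal_fr_iff[OF I, of r s] ideal_fr_iff[OF J, of r s] x sub by auto
  qed
  then have "I = Idl\<^bsub>L\<^esub> ?G" using L.genideal_minimal[OF I GI] by blast
  then show "\<exists>A\<subseteq>carrier L. finite A \<and> I = Idl\<^bsub>L\<^esub> A" using Gc G(2) by blast
qed

end

section \<open>The local ring at a prime and its Krull dimension\<close>

locale local_domain = domain_localization R S + P: primeideal P R for R (structure) and S P +
  assumes S_eq: "S = carrier R - P"
begin

lemma PS: "P \<inter> S = {}" and S_I: "\<lbrakk>r \<in> carrier R; r \<notin> P\<rbrakk> \<Longrightarrow> r \<in> S" and
  P_carr [simp]: "r \<in> P \<Longrightarrow> r \<in> carrier R"
  using S_eq P.Icarr by blast+

text \<open>A fraction whose numerator lies outside \<open>P\<close> is a unit, so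
  \<open>ext P\<close> contains every proper ideal.\<close>

lemma ext_P_maximal: "maximalideal m L \<longleftrightarrow> m = ext P"
proof -
  interpret E: primeideal "ext P" L by (rule ext_prime[OF P.primeideal_axioms PS])
  have le: "J \<subseteq> ext P" if J: "ideal J L" "J \<noteq> carrier L" for J
  proof
    interpret J: ideal J L by fact
    fix x assume x: "x \<in> J"
    obtain r s where r: "r \<in> carrier R" "s \<in> S" "x = fr r s"
      using J.Icarr[OF x] by (rule L_cases)
    have "r \<in> P"
    proof (rule ccontr)
      assume "r \<notin> P"
      then have r': "r \<in> S" using r S_I by blast
      then have "fr s r \<otimes>\<^bsub>L\<^esub> x = \<one>\<^bsub>L\<^esub>" using r by (simp add: L_one fr_eq m_ac)
      then have "\<one>\<^bsub>L\<^esub> \<in> J" using J.I_l_closed[OF x, of "fr s r"] r r' by simp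
      then show False using J.one_imp_carrier that by simp
    qed
    then show "x \<in> ext P" using ext_iff[OF P.primeideal_axioms PS] r by simp
  qed
  show ?thesis
  proof
    assume "maximalideal m L"
    then interpret m: maximalideal m L .
    show "m = ext P" using le[OF m.is_ideal] m.I_notcarr m.I_maximal[OF E.is_ideal]
        E.I_notcarr E.Icarr by blast
  next
    assume "m = ext P"
    then show "maximalideal m L" using le E.I_notcarr E.is_ideal by (intro maximalidealI) blast+
  qed
qed

lemma krull_dim_ge:
  assumes "prime_chain R P n" shows "enat n \<le> krull_dim L"
proof -
  obtain Q where Q: "\<forall>i\<le>n. primeideal (Q i) R" "\<forall>i<n. Q i \<subset> Q (Suc i)" "Q n \<subseteq> P"
    using assms by (auto simp: prime_chain_def)
  have "Q i \<subseteq> Q n" if "i \<le> n" for i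
    using that by (induction rule: inc_induct) (use Q in auto)
  then have d: "Q i \<inter> (S) = {}" if "i \<le> n" for i using that Q PS by blast
  have "ext (Q i) \<subset> ext (Q (Suc i))" if i: "i < n" for i
  proof -
    obtain r where r: "r \<in> Q (Suc i)" "r \<notin> Q i" using Q i by blast
    have "r \<in> carrier R" using Q(1) i r(1) by (meson Suc_leI ideal.Icarr primeideal.axioms(1))
    then have "fr r \<one> \<in> ext (Q (Suc i)) - ext (Q i)"
      using ext_iff[of "Q i" r \<one>] ext_iff[of "Q (Suc i)" r \<one>] Q(1) d[of i] d[of "Suc i"] i r one_S
      by simp
    moreover have "Q i \<subseteq> Q (Suc i)" using Q(2) i by blast
    then have "ext (Q i) \<subseteq> ext (Q (Suc i))" unfolding ext_def by blast
    ultimately show ?thesis by blast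
  qed
  then have "\<exists>P. (\<forall>i\<le>n. primeideal (P i) L) \<and> (\<forall>i<n. P i \<subset> P (Suc i))"
    using ext_prime Q(1) d by (intro exI[of _ "\<lambda>i. ext (Q i)"]) auto
  then show ?thesis unfolding krull_dim_def by (intro Sup_upper) blast
qed

text \<open>Contraction preserves strict inclusions, so a chain of primes in \<open>L\<close>
  becomes a chain below \<open>P\<close>. A chain longer than \<open>Suc n\<close> is cut off after
  \<open>Suc n\<close> steps; excluding that single length therefore suffices.\<close>

lemma krull_dim_le:
  assumes "\<not> prime_chain R P (Suc n)" shows "krull_dim L \<le> enat n"
  unfolding krull_dim_def
proof (rule Sup_least, clarsimp)
  fix m Q assume Q: "\<forall>i\<le>m. primeideal (Q i) L" "\<forall>i<m. Q i \<subset> Q (Suc i)"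
  show "m \<le> n"
  proof (rule ccontr)
    assume "\<not> m \<le> n"
    then have m: "Suc n \<le> m" by simp
    have "contr (Q i) \<subset> contr (Q (Suc i))" if i: "i < Suc n" for i
    proof -
      obtain x where x: "x \<in> Q (Suc i)" "x \<notin> Q i" using Q i m by (meson less_le_trans psubsetE subsetI)
      have id: "ideal (Q i) L" "ideal (Q (Suc i)) L"
        using Q i m by (simp_all add: primeideal.axioms(1))
      obtain r s where r: "r \<in> carrier R" "s \<in> S" "x = fr r s"
        using ideal.Icarr[OF id(2) x(1)] by (rule L_cases)
      have "r \<in> contr (Q (Suc i)) - contr (Q i)"
        using ideal_fr_iff[OF id(1) r(1,2)] ideal_fr_iff[OF id(2) r(1,2)] x r by simp
      moreover have "Q i \<subseteq> Q (Suc i)" using Q(2) i m by (meson less_le_trans psubsetE)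
      then have "contr (Q i) \<subseteq> contr (Q (Suc i))" by (auto simp: contr_def)
      ultimately show ?thesis by blast
    qed
    moreover have "contr (Q (Suc n)) \<subseteq> P" using contr_prime(2)[of "Q (Suc n)"] Q m
      S_I by (auto simp: contr_def)
    ultimately have "prime_chain R P (Suc n)" using contr_prime Q m unfolding prime_chain_def
      by (intro exI[of _ "\<lambda>i. contr (Q i)"]) auto
    then show False using assms by simp
  qed
qed

text \<open>The hypothesis \<open>gen\<close> is generation of the maximal ideal of \<open>L\<close>
  with denominators cleared, and the two chain hypotheses pin the dimension to the number of
  generators.\<close>

lemma regular_localI:
  assumes "noetherian_ring R" "set xs \<subseteq> P"
    and gen: "\<And>u. u \<in> P \<Longrightarrow> \<exists>s\<in>S. s \<otimes> u \<in> Idl (set xs)"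
    and "prime_chain R P (length xs)" "\<not> prime_chain R P (Suc (length xs))"
  shows "regular_local_ring L"
proof -
  interpret E: primeideal "ext P" L by (rule ext_prime[OF P.primeideal_axioms PS])
  let ?ys = "map (\<lambda>r. fr r \<one>) xs"
  have c: "set ?ys \<subseteq> ext P" using assms(2) one_S by (auto simp: ext_def simp del: one_S)
  then have c': "set ?ys \<subseteq> carrier L" using E.Icarr by blast
  have J: "ideal (Idl\<^bsub>L\<^esub> (set ?ys)) L" by (rule L.genideal_ideal[OF c'])
  have "set xs \<subseteq> contr (Idl\<^bsub>L\<^esub> (set ?ys))"
    using L.genideal_self[OF c'] assms(2) P.Icarr by (auto simp: contr_def)
  then have sub: "Idl (set xs) \<subseteq> contr (Idl\<^bsub>L\<^esub> (set ?ys))" by (intro genideal_minimal contr_ideal J)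
  have "x \<in> Idl\<^bsub>L\<^esub> (set ?ys)" if "x \<in> ext P" for x
  proof -
    obtain u t where u: "u \<in> P" "t \<in> S" "x = fr u t" using \<open>x \<in> ext P\<close> by (auto simp: ext_def)
    obtain s where s: "s \<in> S" "s \<otimes> u \<in> Idl (set xs)" using gen u by blast
    have "x = fr (s \<otimes> u) (s \<otimes> t)" using u s P.Icarr by (simp add: fr_eq m_ac)
    then show ?thesis using ideal_fr_iff[OF J, of "s \<otimes> u" "s \<otimes> t"] sub s u P.Icarr mult_S by auto
  qed
  then have "ext P = Idl\<^bsub>L\<^esub> (set ?ys)" using L.genideal_minimal[OF E.is_ideal c] by blast
  moreover have "krull_dim L = enat (length ?ys)"
    using krull_dim_ge[OF assms(4)] krull_dim_le[OF assms(5)] by simp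
  ultimately have "\<exists>xs. set xs \<subseteq> carrier L \<and> enat (length xs) = krull_dim L \<and> ext P = Idl\<^bsub>L\<^esub> (set xs)"
    using c' by metis
  then show ?thesis unfolding regular_local_ring_def ext_P_maximal
    using L.is_cring L_noetherian[OF assms(1)] by simp
qed

text \<open>Each generator of the maximal ideal of \<open>L\<close> is replaced by a numerator,
  which differs from it by a unit. Their number is the dimension, for which an upper bound is
  available.\<close>

lemma regular_localD:
  assumes "regular_local_ring L" "\<not> prime_chain R P (Suc n)"
  obtains xs where "set xs \<subseteq> P" "length xs \<le> n"
    "\<And>u. u \<in> P \<Longrightarrow> \<exists>s\<in>S. s \<otimes> u \<in> Idl (set xs)"
proof -
  obtain ys where ys: "set ys \<subseteq> carrier L" "enat (length ys) = krull_dim L" "ext P = Idl\<^bsub>L\<^esub> (set ys)"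
  proof -
    have "maximalideal (ext P) L" by (simp add: ext_P_maximal)
    then have "\<exists>xs. set xs \<subseteq> carrier L \<and> enat (length xs) = krull_dim L \<and> ext P = Idl\<^bsub>L\<^esub> (set xs)"
      using assms(1) unfolding regular_local_ring_def by simp
    then show ?thesis using that by blast
  qed
  have sub: "y \<in> ext P" if "y \<in> set ys" for y
    using L.genideal_self[OF ys(1)] that unfolding ys(3) by blast
  have "\<forall>y\<in>set ys. \<exists>r. r \<in> P \<and> (\<exists>s\<in>S. y = fr r s)"
    using sub unfolding ext_def by blast
  then have "\<exists>num. \<forall>y\<in>set ys. num y \<in> P \<and> (\<exists>s\<in>S. y = fr (num y) s)" by (rule bchoice)
  then obtain num where num: "\<forall>y\<in>set ys. num y \<in> P \<and> (\<exists>s\<in>S. y = fr (num y) s)" ..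
  let ?xs = "map num ys"
  have sub: "set ?xs \<subseteq> P" using num by auto
  then have c: "set ?xs \<subseteq> carrier R" using P.Icarr by blast
  have "set ys \<subseteq> ext (Idl (set ?xs))"
  proof
    fix y assume y: "y \<in> set ys"
    then obtain s where s: "s \<in> S" "y = fr (num y) s" using num by blast
    moreover have "num y \<in> Idl (set ?xs)" using genideal_self[OF c] y by auto
    ultimately show "y \<in> ext (Idl (set ?xs))" unfolding ext_def by blast
  qed
  then have E: "ext P \<subseteq> ext (Idl (set ?xs))"
    unfolding ys(3) by (rule L.genideal_minimal[OF ext_ideal[OF genideal_ideal[OF c]]])
  show ?thesis
  proof (rule that[of ?xs])
    show "length ?xs \<le> n" using krull_dim_le[OF assms(2)] by (simp flip: ys(2))
    fix u assume u: "u \<in> P"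
    then have "fr u \<one> \<in> ext P" using one_S by (auto simp: ext_def simp del: one_S)
    then have "fr u \<one> \<in> ext (Idl (set ?xs))" using E by blast
    then obtain w s where w: "w \<in> Idl (set ?xs)" "s \<in> S" "fr u \<one> = fr w s"
      unfolding ext_def by blast
    have "w \<in> carrier R" using ideal.Icarr[OF genideal_ideal[OF c] w(1)] .
    then have "s \<otimes> u = w" using w(2,3) u fr_eq[of u \<one> w s] by simp
    then show "\<exists>s\<in>S. s \<otimes> u \<in> Idl (set ?xs)" using w by blast
  qed (use sub in simp)
qed

end

section \<open>Hilbert's basis theorem\<close>

text \<open>Finite generation is phrased through all ideals \<open>J\<close> containing the
  generators, which is how it is used below: one only has to exhibit a suitable
  \<open>J\<close>.\<close>

lemma (in ring) noetherianD:
  assumes "noetherian_ring R" "ideal I R"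
  shows "\<exists>G. G \<subseteq> I \<and> finite G \<and> (\<forall>J. ideal J R \<and> G \<subseteq> J \<longrightarrow> I \<subseteq> J)"
proof -
  obtain G where G: "G \<subseteq> carrier R" "finite G" "I = Idl G"
    using noetherian_ring.finetely_gen[OF assms] by auto
  show ?thesis
    by (rule exI[of _ G]) (simp add: G genideal_self genideal_minimal)
qed

lemma (in ring) noetherianI:
  assumes "\<And>I. ideal I R \<Longrightarrow> \<exists>G. G \<subseteq> I \<and> finite G \<and> (\<forall>J. ideal J R \<and> G \<subseteq> J \<longrightarrow> I \<subseteq> J)"
  shows "noetherian_ring R"
proof (rule noetherian_ringI)
  fix I assume I: "ideal I R"
  obtain G where G: "G \<subseteq> I" "finite G" "\<forall>J. ideal J R \<and> G \<subseteq> J \<longrightarrow> I \<subseteq> J"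
    using assms[OF I] by auto
  have c: "G \<subseteq> carrier R" using G(1) ideal.Icarr[OF I] by auto
  have "I \<subseteq> Idl G" using G(3) genideal_ideal[OF c] genideal_self[OF c] by simp
  then have "I = Idl G" using genideal_minimal[OF I G(1)] by (rule equalityI)
  then show "\<exists>A\<subseteq>carrier R. finite A \<and> I = Idl A" using c G(2) by auto
qed

text \<open>The preimage of an ideal is finitely generated, and by surjectivity the images of its
  generators generate the ideal.\<close>

lemma noetherian_image:
  assumes N: "noetherian_ring R" and "cring R" and "cring A" and surj: "h ` carrier R = carrier A"
    and h: "h \<zero>\<^bsub>R\<^esub> = \<zero>\<^bsub>A\<^esub>"
      "\<And>x y. \<lbrakk>x \<in> carrier R; y \<in> carrier R\<rbrakk> \<Longrightarrow> h (x \<oplus>\<^bsub>R\<^esub> y) = h x \<oplus>\<^bsub>A\<^esub> h y"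
      "\<And>x y. \<lbrakk>x \<in> carrier R; y \<in> carrier R\<rbrakk> \<Longrightarrow> h (x \<otimes>\<^bsub>R\<^esub> y) = h x \<otimes>\<^bsub>A\<^esub> h y"
  shows "noetherian_ring A"
proof -
  interpret R: cring R by fact
  interpret A: cring A by fact
  show ?thesis
  proof (rule A.noetherianI)
    fix I assume I: "ideal I A"
    have pre: "ideal {r \<in> carrier R. h r \<in> J} R" if "ideal J A" for J
    proof -
      interpret J: ideal J A by fact
      show ?thesis using surj
        by (intro R.cring_idealI) (auto simp: h intro: J.a_closed J.I_l_closed)
    qed
    obtain G where G: "G \<subseteq> {r \<in> carrier R. h r \<in> I}" "finite G"
      "\<forall>J. ideal J R \<and> G \<subseteq> J \<longrightarrow> {r \<in> carrier R. h r \<in> I} \<subseteq> J"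
      using R.noetherianD[OF N pre[OF I]] by auto
    have "I \<subseteq> J" if J: "ideal J A" "h ` G \<subseteq> J" for J
    proof
      fix x assume x: "x \<in> I"
      then obtain r where r: "r \<in> carrier R" "x = h r" using surj ideal.Icarr[OF I x] by blast
      have "{r \<in> carrier R. h r \<in> I} \<subseteq> {r \<in> carrier R. h r \<in> J}"
        using J(2) G(1) pre[OF J(1)] by (intro G(3)[rule_format]) auto
      then show "x \<in> J" using x r by blast
    qed
    moreover have "h ` G \<subseteq> I" using G(1) by blast
    ultimately show "\<exists>G. G \<subseteq> I \<and> finite G \<and> (\<forall>J. ideal J A \<and> G \<subseteq> J \<longrightarrow> I \<subseteq> J)"
      using G(2) by (intro exI[of _ "h ` G"]) simp
  qed
qed

lemma type_cring: "cring (type_ring :: 'a::comm_ring_1 ring)"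
  by (rule cring_from_type_algebra)

lemma type_ideal_iff:
  fixes I :: "'a::comm_ring_1 set"
  shows "ideal I type_ring \<longleftrightarrow> 0 \<in> I \<and> (\<forall>x\<in>I. \<forall>y\<in>I. x + y \<in> I) \<and> (\<forall>c. \<forall>x\<in>I. c * x \<in> I)"
proof -
  interpret cring "type_ring :: 'a ring" by (rule type_cring)
  show ?thesis
  proof
    assume "ideal I type_ring"
    then interpret ideal I type_ring .
    show "0 \<in> I \<and> (\<forall>x\<in>I. \<forall>y\<in>I. x + y \<in> I) \<and> (\<forall>c. \<forall>x\<in>I. c * x \<in> I)"
      using zero_closed a_closed I_l_closed by (auto simp: type_ring_simps)
  next
    assume "0 \<in> I \<and> (\<forall>x\<in>I. \<forall>y\<in>I. x + y \<in> I) \<and> (\<forall>c. \<forall>x\<in>I. c * x \<in> I)"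
    then show "ideal I type_ring" by (intro cring_idealI) (auto simp: type_ring_simps)
  qed
qed

lemma type_idealD:
  fixes I :: "'a::comm_ring_1 set"
  assumes "ideal I type_ring"
  shows "0 \<in> I" "\<And>x y. x \<in> I \<Longrightarrow> y \<in> I \<Longrightarrow> x + y \<in> I" "\<And>c x. x \<in> I \<Longrightarrow> c * x \<in> I"
    "\<And>c x. x \<in> I \<Longrightarrow> x * c \<in> I" "\<And>x. x \<in> I \<Longrightarrow> - x \<in> I" "\<And>x y. x \<in> I \<Longrightarrow> y \<in> I \<Longrightarrow> x - y \<in> I"
proof -
  show 1: "0 \<in> I" "\<And>x y. x \<in> I \<Longrightarrow> y \<in> I \<Longrightarrow> x + y \<in> I" "\<And>c x. x \<in> I \<Longrightarrow> c * x \<in> I"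
    using assms unfolding type_ideal_iff by simp_all
  show "\<And>c x. x \<in> I \<Longrightarrow> x * c \<in> I" using 1(3) by (metis mult.commute)
  show 2: "\<And>x. x \<in> I \<Longrightarrow> - x \<in> I" using 1(3)[of _ "- 1"] by simp
  show "\<And>x y. x \<in> I \<Longrightarrow> y \<in> I \<Longrightarrow> x - y \<in> I" using 1(2)[OF _ 2] by fastforce
qed

text \<open>Degree at most \<open>n\<close>, rather than exactly \<open>n\<close>, admits 0 and sums
  with cancelling leading terms, so that the set is an ideal.\<close>

definition lead_ideal :: "'a::comm_ring_1 poly set \<Rightarrow> nat \<Rightarrow> 'a set" where
  "lead_ideal I n = {Polynomial.coeff f n | f. f \<in> I \<and> Polynomial.degree f \<le> n}"

lemma lead_idealI: "\<lbrakk>f \<in> I; Polynomial.degree f \<le> n; Polynomial.coeff f n = c\<rbrakk> \<Longrightarrow> c \<in> lead_ideal I n"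
  unfolding lead_ideal_def by blast

lemma lead_idealE:
  assumes "c \<in> lead_ideal I n"
  obtains f where "f \<in> I" "Polynomial.degree f \<le> n" "Polynomial.coeff f n = c"
  using assms unfolding lead_ideal_def by blast

lemma ideal_lead_ideal:
  assumes I: "ideal I type_ring" shows "ideal (lead_ideal I n) type_ring"
  unfolding type_ideal_iff
proof (intro conjI ballI allI)
  note I = type_idealD[OF I]
  show "0 \<in> lead_ideal I n" by (rule lead_idealI[of 0]) (simp_all add: I)
  show "x + y \<in> lead_ideal I n" if xy: "x \<in> lead_ideal I n" "y \<in> lead_ideal I n" for x y
  proof -
    obtain f where f: "f \<in> I" "Polynomial.degree f \<le> n" "Polynomial.coeff f n = x"
      using xy(1) by (rule lead_idealE)
    obtain g where g: "g \<in> I" "Polynomial.degree g \<le> n" "Polynomial.coeff g n = y"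
      using xy(2) by (rule lead_idealE)
    show ?thesis using f g I(2) degree_add_le by (intro lead_idealI[of "f + g"]) auto
  qed
  show "c * x \<in> lead_ideal I n" if x: "x \<in> lead_ideal I n" for c x
  proof -
    obtain f where f: "f \<in> I" "Polynomial.degree f \<le> n" "Polynomial.coeff f n = x"
      using x by (rule lead_idealE)
    show ?thesis using I(3)[OF f(1), of "[:c:]"] f(2,3) degree_smult_le[of c f]
      by (intro lead_idealI[of "Polynomial.smult c f"]) auto
  qed
qed

lemma lead_ideal_shift:
  assumes I: "ideal I type_ring" and "n \<le> m" "c \<in> lead_ideal I n"
  shows "c \<in> lead_ideal I m"
proof -
  obtain f where f: "f \<in> I" "Polynomial.degree f \<le> n" "Polynomial.coeff f n = c"
    using assms(3) by (rule lead_idealE)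
  have "Polynomial.degree (Polynomial.monom 1 (m - n) * f) \<le> m"
    using degree_mult_le[of "Polynomial.monom 1 (m - n)" f] degree_monom_le[of "1::'a" "m - n"] f(2) assms(2)
    by linarith
  moreover have "Polynomial.coeff (Polynomial.monom 1 (m - n) * f) m = c"
    using f(3) assms(2) by (simp add: coeff_monom_mult)
  ultimately show ?thesis
    using type_idealD(3)[OF I f(1)] lead_idealI[of "Polynomial.monom 1 (m - n) * f"] by blast
qed

text \<open>The ideals \<open>lead_ideal I n\<close> increase with \<open>n\<close>, and their
  union, being finitely generated, equals \<open>lead_ideal I N0\<close> for some \<open>N0\<close>.
  Finitely many elements of \<open>I\<close> realize generators of these ideals up to
  \<open>N0\<close>. Any \<open>f\<close> in \<open>I\<close> then shares its leading coefficient
  with an element, of no larger degree, of the ideal they generate; subtracting it lowers the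
  degree.\<close>

theorem hilbert_basis:
  assumes N: "noetherian_ring (type_ring :: 'a::comm_ring_1 ring)"
  shows "noetherian_ring (type_ring :: 'a poly ring)"
proof -
  interpret R: cring "type_ring :: 'a ring" by (rule type_cring)
  interpret P: cring "type_ring :: 'a poly ring" by (rule type_cring)
  show ?thesis
  proof (rule P.noetherianI)
    fix I :: "'a poly set" assume I: "ideal I type_ring"
    note Id = type_idealD[OF I]
    define U where "U = (\<Union>n. lead_ideal I n)"
    have U0: "ideal U type_ring" unfolding type_ideal_iff
    proof (intro conjI ballI allI)
      show "0 \<in> U" using type_idealD(1)[OF ideal_lead_ideal[OF I]] by (auto simp: U_def)
      show "c * x \<in> U" if "x \<in> U" for c x
        using that type_idealD(3)[OF ideal_lead_ideal[OF I]] by (auto simp: U_def)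
      show "x + y \<in> U" if xy: "x \<in> U" "y \<in> U" for x y
      proof -
        obtain m n where "x \<in> lead_ideal I m" "y \<in> lead_ideal I n" using xy by (auto simp: U_def)
        then have "x \<in> lead_ideal I (max m n)" "y \<in> lead_ideal I (max m n)"
          using lead_ideal_shift[OF I] by (meson max.cobounded1 max.cobounded2)+
        then show ?thesis unfolding U_def using type_idealD(2)[OF ideal_lead_ideal[OF I]] by blast
      qed
    qed
    obtain G0 where G0: "G0 \<subseteq> U" "finite G0" "\<forall>J. ideal J type_ring \<and> G0 \<subseteq> J \<longrightarrow> U \<subseteq> J"
      using R.noetherianD[OF N U0] by auto
    have "\<exists>N. G0 \<subseteq> lead_ideal I N" using G0(2,1)
    proof (induction G0 rule: finite_induct)
      case (insert x F)
      then obtain N n where "F \<subseteq> lead_ideal I N" "x \<in> lead_ideal I n" by (auto simp: U_def)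
      then have "F \<subseteq> lead_ideal I (max N n)" "x \<in> lead_ideal I (max N n)"
        using lead_ideal_shift[OF I] by (meson max.cobounded1 max.cobounded2 subset_iff)+
      then show ?case by blast
    qed simp
    then obtain N0 where "G0 \<subseteq> lead_ideal I N0" by blast
    then have U: "U \<subseteq> lead_ideal I N0" using G0(3) ideal_lead_ideal[OF I] by simp
    \<comment> \<open>Intersecting with \<open>I\<close> keeps the polynomial that will be
      subtracted inside \<open>I\<close>, so that the induction on the degree applies to the
      difference.\<close>
    have "\<forall>n. \<exists>F. F \<subseteq> I \<and> finite F \<and>
        (\<forall>J. ideal J type_ring \<longrightarrow> F \<subseteq> J \<longrightarrow> lead_ideal I n \<subseteq> lead_ideal (I \<inter> J) n)"
    proof
      fix n
      obtain G where G: "G \<subseteq> lead_ideal I n" "finite G"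
        "\<forall>J. ideal J type_ring \<and> G \<subseteq> J \<longrightarrow> lead_ideal I n \<subseteq> J"
        using R.noetherianD[OF N ideal_lead_ideal[OF I, of n]] by auto
      have "G \<subseteq> (\<lambda>f. Polynomial.coeff f n) ` {f \<in> I. Polynomial.degree f \<le> n}"
        using G(1) by (auto simp: lead_ideal_def)
      from finite_subset_image[OF G(2) this] obtain F where F: "F \<subseteq> {f \<in> I. Polynomial.degree f \<le> n}" "finite F"
        "G = (\<lambda>f. Polynomial.coeff f n) ` F" by (elim exE conjE)
      have "lead_ideal I n \<subseteq> lead_ideal (I \<inter> J) n" if J: "ideal J type_ring" "F \<subseteq> J" for J
      proof (rule G(3)[rule_format], rule conjI)
        show "ideal (lead_ideal (I \<inter> J) n) type_ring"
          by (intro ideal_lead_ideal P.i_intersect I J(1))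
        show "G \<subseteq> lead_ideal (I \<inter> J) n" unfolding F(3) using F(1) J(2) by (auto simp: lead_ideal_def)
      qed
      then show "\<exists>F. F \<subseteq> I \<and> finite F \<and>
        (\<forall>J. ideal J type_ring \<longrightarrow> F \<subseteq> J \<longrightarrow> lead_ideal I n \<subseteq> lead_ideal (I \<inter> J) n)"
        using F(1,2) by (intro exI[of _ F] conjI allI impI) auto
    qed
    from choice[OF this] obtain F where F': "\<forall>n. F n \<subseteq> I \<and> finite (F n) \<and>
        (\<forall>J. ideal J type_ring \<longrightarrow> F n \<subseteq> J \<longrightarrow> lead_ideal I n \<subseteq> lead_ideal (I \<inter> J) n)" ..
    then have F: "F n \<subseteq> I" "finite (F n)"
        "ideal J type_ring \<Longrightarrow> F n \<subseteq> J \<Longrightarrow> lead_ideal I n \<subseteq> lead_ideal (I \<inter> J) n" for n J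
      by simp_all
    let ?G = "\<Union>n\<le>N0. F n"
    have "f \<in> J" if J: "ideal J type_ring" "?G \<subseteq> J" and f: "f \<in> I" for f J
      using f
    proof (induction "Polynomial.degree f" arbitrary: f rule: less_induct)
      case (less f)
      let ?n = "Polynomial.degree f"
      have IJ: "ideal (I \<inter> J) type_ring" by (intro P.i_intersect I J(1))
      have lc: "Polynomial.coeff f ?n \<in> lead_ideal I ?n" using less.prems by (auto intro: lead_idealI)
      have "Polynomial.coeff f ?n \<in> lead_ideal (I \<inter> J) ?n"
      proof (cases "?n \<le> N0")
        case True
        then show ?thesis using F(3)[OF J(1), of ?n] J(2) lc by blast
      next
        \<comment> \<open>Above \<open>N0\<close> the leading coefficient already occurs at level
          \<open>N0\<close>; a power of the variable lifts the element found there to the degree of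
          \<open>f\<close>.\<close>
        case False
        have "Polynomial.coeff f ?n \<in> lead_ideal I N0" using U lc by (auto simp: U_def)
        then have "Polynomial.coeff f ?n \<in> lead_ideal (I \<inter> J) N0" using F(3)[OF J(1), of N0] J(2) by blast
        then show ?thesis using lead_ideal_shift[OF IJ] False by (meson nat_le_linear)
      qed
      then obtain h where h: "h \<in> I" "h \<in> J" "Polynomial.degree h \<le> ?n"
          "Polynomial.coeff h ?n = Polynomial.coeff f ?n"
        by (auto elim: lead_idealE)
      have "f - h \<in> J"
      proof (cases "f - h = 0")
        case False
        have "Polynomial.degree (f - h) \<le> ?n" using h(3) by (simp add: degree_diff_le)
        moreover have "Polynomial.degree (f - h) \<noteq> ?n"
        proof
          assume "Polynomial.degree (f - h) = ?n"
          moreover have "Polynomial.coeff (f - h) ?n = 0" using h(4) by simp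
          ultimately have "Polynomial.lead_coeff (f - h) = 0" by metis
          then show False using False by (simp only: leading_coeff_0_iff)
        qed
        ultimately show ?thesis using less.hyps[of "f - h"] Id(6)[OF less.prems h(1)] by simp
      qed (simp add: type_idealD[OF J(1)])
      then have "f - h + h \<in> J" using h(2) type_idealD(2)[OF J(1)] by blast
      then show ?case by simp
    qed
    then have "\<forall>J. ideal J type_ring \<and> ?G \<subseteq> J \<longrightarrow> I \<subseteq> J" by auto
    moreover have "?G \<subseteq> I" "finite ?G" using F(1,2) by auto
    ultimately show "\<exists>G. G \<subseteq> I \<and> finite G \<and> (\<forall>J. ideal J type_ring \<and> G \<subseteq> J \<longrightarrow> I \<subseteq> J)"
      by (intro exI[of _ ?G] conjI)
  qed
qed

lemma noetherian_field: "noetherian_ring (type_ring :: 'a::field ring)"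
proof -
  interpret R: cring "type_ring :: 'a ring" by (rule type_cring)
  show ?thesis
  proof (rule R.noetherianI)
    fix I :: "'a set" assume I: "ideal I type_ring"
    show "\<exists>G. G \<subseteq> I \<and> finite G \<and> (\<forall>J. ideal J type_ring \<and> G \<subseteq> J \<longrightarrow> I \<subseteq> J)"
    proof (cases "I \<subseteq> {0}")
      case True
      then show ?thesis by (intro exI[of _ "{}"]) (auto simp: type_ideal_iff)
    next
      case False
      then obtain x where x: "x \<in> I" "x \<noteq> 0" by blast
      have "y \<in> J" if "ideal J type_ring" "x \<in> J" for y J
        using type_idealD(3)[OF that, of "y / x"] x by simp
      then show ?thesis using x(1) by (intro exI[of _ "{x}"]) auto
    qed
  qed
qed

section \<open>Prime ideals of polynomial rings\<close>

lemma type_primeideal_iff: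
  fixes I :: "'a::comm_ring_1 set"
  shows "primeideal I type_ring \<longleftrightarrow>
    ideal I type_ring \<and> 1 \<notin> I \<and> (\<forall>x y. x * y \<in> I \<longrightarrow> x \<in> I \<or> y \<in> I)"
proof
  assume "primeideal I type_ring"
  then interpret primeideal I type_ring .
  show "ideal I type_ring \<and> 1 \<notin> I \<and> (\<forall>x y. x * y \<in> I \<longrightarrow> x \<in> I \<or> y \<in> I)"
    using is_ideal I_notcarr one_imp_carrier I_prime by (auto simp: type_ring_simps)
next
  assume "ideal I type_ring \<and> 1 \<notin> I \<and> (\<forall>x y. x * y \<in> I \<longrightarrow> x \<in> I \<or> y \<in> I)"
  then show "primeideal I type_ring"
    by (intro primeidealI type_cring) (auto simp: type_ring_simps)
qed

lemma type_primeidealD: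
  fixes I :: "'a::comm_ring_1 set"
  assumes "primeideal I type_ring"
  shows "ideal I type_ring" "1 \<notin> I" "\<And>x y. x * y \<in> I \<Longrightarrow> x \<in> I \<or> y \<in> I"
    "\<And>x n. x ^ n \<in> I \<Longrightarrow> x \<in> I"
proof -
  show 1: "ideal I type_ring" "1 \<notin> I" "\<And>x y. x * y \<in> I \<Longrightarrow> x \<in> I \<or> y \<in> I"
    using assms by (simp_all add: type_primeideal_iff)
  show "x ^ n \<in> I \<Longrightarrow> x \<in> I" for x n
    by (induction n) (use 1(2,3) in auto)
qed

section \<open>Ideals, Bezout relations and prime divisors in polynomials over a field\<close>

lemma poly_ideal_principal:
  fixes I :: "'a::field poly set"
  assumes I: "ideal I type_ring"
  obtains p where "p \<in> I" "\<And>q. q \<in> I \<longleftrightarrow> p dvd q"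
proof (cases "I \<subseteq> {0}")
  case True
  then show ?thesis using type_idealD(1)[OF I] by (intro that[of 0]) auto
next
  case False
  note I = type_idealD[OF I]
  have "\<exists>p. p \<in> I \<and> p \<noteq> 0" using False by auto
  then obtain p where p: "p \<in> I" "p \<noteq> 0"
    and min: "\<And>q. q \<in> I \<Longrightarrow> q \<noteq> 0 \<Longrightarrow> Polynomial.degree p \<le> Polynomial.degree q"
    using ex_has_least_nat[of "\<lambda>p. p \<in> I \<and> p \<noteq> 0" _ Polynomial.degree] by metis
  show ?thesis
  proof (rule that[OF p(1)])
    fix q
    show "q \<in> I \<longleftrightarrow> p dvd q"
    proof
      assume q: "q \<in> I"
      have "q mod p \<in> I" using I(6)[OF q I(3)[OF p(1), of "q div p"]] by (simp add: minus_div_mult_eq_mod)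
      then have "q mod p = 0" using min[of "q mod p"] degree_mod_less'[OF p(2), of q] by force
      then show "p dvd q" by (simp add: mod_eq_0_iff_dvd)
    next
      assume "p dvd q" then show "q \<in> I" using I(4)[OF p(1)] by (auto elim: dvdE)
    qed
  qed
qed

lemma poly_bezout:
  fixes p q :: "'a::field poly"
  obtains g c d where "g dvd p" "g dvd q" "g = c * p + d * q"
proof -
  define I where "I = {c * p + d * q | c d. True}"
  have I: "x \<in> I \<longleftrightarrow> (\<exists>c d. x = c * p + d * q)" for x by (simp add: I_def)
  have "ideal I type_ring" unfolding type_ideal_iff
  proof (intro conjI ballI allI)
    show "0 \<in> I" unfolding I by (rule exI[of _ 0], rule exI[of _ 0]) simp
    show "x + y \<in> I" if xy: "x \<in> I" "y \<in> I" for x y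
    proof -
      obtain c d c' d' where "x = c * p + d * q" "y = c' * p + d' * q" using xy I by metis
      then have "x + y = (c + c') * p + (d + d') * q" by (simp add: algebra_simps)
      then show ?thesis unfolding I by (intro exI)
    qed
    show "e * x \<in> I" if x: "x \<in> I" for e x
    proof -
      obtain c d where "x = c * p + d * q" using x I by metis
      then have "e * x = (e * c) * p + (e * d) * q" by (simp add: algebra_simps)
      then show ?thesis unfolding I by (intro exI)
    qed
  qed
  from poly_ideal_principal[OF this] obtain g where g: "g \<in> I" "\<forall>x. x \<in> I \<longleftrightarrow> g dvd x"
    by metis
  have "p \<in> I" unfolding I by (rule exI[of _ 1], rule exI[of _ 0]) simp
  moreover have "q \<in> I" unfolding I by (rule exI[of _ 0], rule exI[of _ 1]) simp
  moreover obtain c d where "g = c * p + d * q" using g(1) I by metis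
  ultimately show ?thesis using g(2) that by metis
qed

lemma coprime_poly_iff:
  fixes p q :: "'a::field poly"
  shows "coprime p q \<longleftrightarrow> (\<exists>c d. c * p + d * q = 1)"
proof
  assume c: "coprime p q"
  obtain g c d where g: "g dvd p" "g dvd q" "g = c * p + d * q" by (rule poly_bezout)
  have "g dvd 1" using c g(1,2) by (rule coprime_common_divisor)
  then obtain e where "1 = g * e" by (elim dvdE)
  then have "(e * c) * p + (e * d) * q = 1" by (simp add: g(3) algebra_simps)
  then show "\<exists>c d. c * p + d * q = 1" by auto
next
  assume "\<exists>c d. c * p + d * q = 1"
  then obtain c d where e: "c * p + d * q = 1" by auto
  show "coprime p q"
  proof (rule coprimeI)
    fix x assume "x dvd p" "x dvd q"
    then have "x dvd c * p + d * q" by simp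
    then show "is_unit x" by (simp add: e)
  qed
qed

text \<open>With g a common divisor that is a combination of p and q, write p = g e. As p does not
  divide g, it divides e, and cancelling p makes g a unit.\<close>

lemma prime_elem_bezout:
  fixes p q :: "'a::field poly"
  assumes "prime_elem p" "\<not> p dvd q"
  obtains c d where "c * q + d * p = 1"
proof -
  obtain g c d where g: "g dvd p" "g dvd q" "g = c * p + d * q" by (rule poly_bezout)
  obtain e where e: "p = g * e" using g(1) by (elim dvdE)
  have "\<not> p dvd g" using g(2) assms(2) dvd_trans by auto
  then have "p dvd e" using assms(1) e prime_elem_dvd_multD[of p g e] by auto
  then obtain f where "e = p * f" by (elim dvdE)
  then have "p * (g * f) = p * 1" using e by (metis mult.left_commute mult_1_right)
  then have "g * f = 1" using assms(1) by (metis mult_cancel_left prime_elem_def)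
  then have "(f * d) * q + (f * c) * p = 1" by (simp add: g(3) algebra_simps)
  then show ?thesis by (rule that)
qed

text \<open>A nonunit divisor of least degree is prime: its greatest common divisor with any f is a
  unit or, by minimality, divisible by it.\<close>

lemma prime_divisor_exists_poly:
  fixes d :: "'a::field poly"
  assumes "d \<noteq> 0" "\<not> is_unit d"
  obtains p where "prime_elem p" "p dvd d"
proof -
  have "\<exists>p. p dvd d \<and> \<not> is_unit p" using assms(2) by (intro exI[of _ d]) simp
  then obtain p where p: "p dvd d" "\<not> is_unit p"
    and min: "\<And>q. q dvd d \<Longrightarrow> \<not> is_unit q \<Longrightarrow> Polynomial.degree p \<le> Polynomial.degree q"
    using ex_has_least_nat[of "\<lambda>p. p dvd d \<and> \<not> is_unit p" _ Polynomial.degree] by metis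
  have p0: "p \<noteq> 0" using p(1) assms(1) by auto
  have "prime_elem p" unfolding prime_elem_def
  proof (intro conjI allI impI p0 p(2))
    fix f h assume fh: "p dvd f * h"
    obtain g c e where g: "g dvd p" "g dvd f" "g = c * p + e * f" by (rule poly_bezout)
    show "p dvd f \<or> p dvd h"
    proof (cases "is_unit g")
      case True
      then obtain g' where "1 = g * g'" by (elim dvdE)
      then have "h = h * (g * g')" by simp
      also have "\<dots> = p * (c * g' * h) + (f * h) * (e * g')"
        unfolding g(3) by (simp add: algebra_simps)
      finally have "h = p * (c * g' * h) + (f * h) * (e * g')" .
      moreover have "p dvd p * (c * g' * h) + (f * h) * (e * g')" using fh by simp
      ultimately have "p dvd h" by metis
      then show ?thesis ..
    next
      case False
      obtain k where k: "p = g * k" using g(1) by (elim dvdE)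
      have "k \<noteq> 0" "g \<noteq> 0" using p0 k by auto
      moreover have "Polynomial.degree p \<le> Polynomial.degree g"
        using min[of g] False g(1) p(1) dvd_trans by auto
      ultimately have "Polynomial.degree k = 0" using k by (simp add: degree_mult_eq)
      then have "is_unit k" using \<open>k \<noteq> 0\<close> by (simp add: is_unit_iff_degree)
      then have "p dvd g" using k by simp
      then show ?thesis using g(2) dvd_trans by auto
    qed
  qed
  then show ?thesis using p(1) that by auto
qed

lemma poly_prime_ideal:
  fixes I :: "'a::field poly set"
  assumes I: "primeideal I type_ring" and "x \<in> I" "x \<noteq> 0"
  obtains p where "prime_elem p" "\<And>q. q \<in> I \<longleftrightarrow> p dvd q"
proof -
  obtain p where p: "p \<in> I" "\<And>q. q \<in> I \<longleftrightarrow> p dvd q"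
    using poly_ideal_principal[OF type_primeidealD(1)[OF I]] by auto
  have "p \<noteq> 0" using p(2)[of x] assms by auto
  then have "prime_elem p" using type_primeidealD(2,3)[OF I] p(2) by (auto simp: prime_elem_def)
  then show ?thesis using p(2) that by auto
qed

text \<open>Leading terms divisible by \<open>p\<close> are moved into the multiple of
  \<open>p\<close>. The rest \<open>f1\<close> is a representative modulo \<open>p\<close> whose
  degree is not lost on reduction, which lets divisions over K[H]/p be carried out over
  K[H].\<close>

lemma poly_strip:
  fixes f :: "'a::comm_ring_1 poly"
  shows "\<exists>f1 f2. f = f1 + [:p:] * f2 \<and> Polynomial.degree f1 \<le> Polynomial.degree f \<and>
    (f1 = 0 \<or> \<not> p dvd Polynomial.lead_coeff f1)"
proof (induction "Polynomial.degree f" arbitrary: f rule: less_induct)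
  case less
  show ?case
  proof (cases "p dvd Polynomial.lead_coeff f")
    case False
    then show ?thesis by (intro exI[of _ f] exI[of _ 0]) auto
  next
    case True
    then obtain e where e: "Polynomial.lead_coeff f = p * e" by (elim dvdE)
    let ?m = "[:p:] * Polynomial.monom e (Polynomial.degree f)"
    let ?g = "f - ?m"
    have m: "?m = Polynomial.monom (Polynomial.lead_coeff f) (Polynomial.degree f)"
      by (simp add: e smult_monom)
    show ?thesis
    proof (cases "Polynomial.degree f = 0")
      case True
      then obtain k where "f = [:k:]" by (rule degree_eq_zeroE)
      then have "f = [:p:] * [:e:]" using e by simp
      then show ?thesis by (intro exI[of _ 0] exI[of _ "[:e:]"]) auto
    next
      case False
      have c: "Polynomial.coeff ?g (Polynomial.degree f) = 0" unfolding m by simp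
      have "Polynomial.degree ?g \<le> Polynomial.degree f" unfolding m
        by (intro degree_diff_le degree_monom_le) simp
      moreover have "Polynomial.degree ?g \<noteq> Polynomial.degree f"
        using c False by (metis degree_0 leading_coeff_0_iff)
      ultimately have "Polynomial.degree ?g < Polynomial.degree f" by simp
      from less[OF this] obtain f1 f2 where f: "?g = f1 + [:p:] * f2"
        "Polynomial.degree f1 \<le> Polynomial.degree ?g" "f1 = 0 \<or> \<not> p dvd Polynomial.lead_coeff f1"
        by (elim exE conjE)
      have "f = f1 + [:p:] * (f2 + Polynomial.monom e (Polynomial.degree f))"
        using f(1) by (simp add: algebra_simps)
      moreover have "Polynomial.degree f1 \<le> Polynomial.degree f"
        using f(2) \<open>Polynomial.degree ?g < _\<close> by linarith
      ultimately show ?thesis using f(3) by (intro exI conjI)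
    qed
  qed
qed

text \<open>Over the field \<open>K[H]/p\<close> the ideals of \<open>K[H][X]\<close> become principal.\<close>

lemma ideal_poly2_containing_const:
  fixes J :: "'a::field poly poly set"
  assumes J: "ideal J type_ring" and p: "prime_elem p" "[:p:] \<in> J"
  obtains g where "g \<in> J" "\<And>h. h \<in> J \<Longrightarrow> \<exists>c d. h = c * [:p:] + d * g"
proof (cases "\<exists>g. g \<in> J \<and> \<not> p dvd Polynomial.lead_coeff g")
  note Jd = type_idealD[OF J]
  case True
  then obtain g where g: "g \<in> J" "\<not> p dvd Polynomial.lead_coeff g"
    and min: "\<And>h. h \<in> J \<Longrightarrow> \<not> p dvd Polynomial.lead_coeff h \<Longrightarrow> Polynomial.degree g \<le> Polynomial.degree h"
    using ex_has_least_nat[of "\<lambda>h. h \<in> J \<and> \<not> p dvd Polynomial.lead_coeff h" _ Polynomial.degree] by metis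
  have g0: "g \<noteq> 0" using g(2) by auto
  show ?thesis
  proof (rule that[OF g(1)])
    fix h assume h: "h \<in> J"
    obtain q r where qr: "pseudo_divmod h g = (q, r)" by (cases "pseudo_divmod h g")
    define l where "l = Polynomial.lead_coeff g ^ (Suc (Polynomial.degree h) - Polynomial.degree g)"
    have l: "Polynomial.smult l h = g * q + r" unfolding l_def using pseudo_divmod(1)[OF g0 qr] .
    have "r = [:l:] * h - q * g" using l by (simp add: algebra_simps)
    then have rJ: "r \<in> J" using Jd(3)[OF h, of "[:l:]"] Jd(3)[OF g(1), of q] Jd(6) by simp
    obtain r1 r2 where r: "r = r1 + [:p:] * r2" "Polynomial.degree r1 \<le> Polynomial.degree r"
        "r1 = 0 \<or> \<not> p dvd Polynomial.lead_coeff r1" using poly_strip[of r p] by (elim exE conjE)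
    \<comment> \<open>For r nonzero, its stripped part lies in \<open>J\<close> and has degree below
      that of \<open>g\<close>, so by the choice of \<open>g\<close> it is 0.\<close>
    have "\<exists>r2. r = [:p:] * r2"
    proof (cases "r = 0")
      case False
      have "r - r2 * [:p:] \<in> J" using Jd(6)[OF rJ Jd(3)[OF p(2), of r2]] .
      then have "r1 \<in> J" using r(1) by (simp add: algebra_simps)
      then have "r1 = 0" using min[of r1] r(2,3) pseudo_divmod(2)[OF g0 qr] False by auto
      then show ?thesis using r(1) by auto
    qed (intro exI[of _ 0], simp)
    then obtain r2 where r2: "r = [:p:] * r2" by auto
    \<comment> \<open>The multiplier of the pseudo-division is a power of a leading coefficient
      prime to \<open>p\<close>, hence invertible modulo \<open>p\<close>; this turns
      pseudo-division into division.\<close>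
    have "\<not> p dvd l" unfolding l_def using g(2) p(1) prime_elem_dvd_power by auto
    then obtain c d where cd: "c * l + d * p = 1" by (rule prime_elem_bezout[OF p(1)])
    have "h = [:c * l + d * p:] * h" by (simp add: cd)
    also have "\<dots> = [:c:] * Polynomial.smult l h + [:d:] * [:p:] * h"
      by (simp add: algebra_simps smult_add_left)
    also have "\<dots> = ([:c:] * r2 + [:d:] * h) * [:p:] + ([:c:] * q) * g"
      unfolding l r2 by (simp only: algebra_simps)
    finally show "\<exists>c d. h = c * [:p:] + d * g" by (intro exI)
  qed
next
  case False
  \<comment> \<open>Here every element of \<open>J\<close> vanishes modulo \<open>p\<close>, and 0
    serves as the second generator.\<close>
  have "\<exists>c d. h = c * [:p:] + d * 0" if h: "h \<in> J" for h
  proof -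
    obtain h1 h2 where s: "h = h1 + [:p:] * h2" "h1 = 0 \<or> \<not> p dvd Polynomial.lead_coeff h1"
      using poly_strip[of h p] by (elim exE conjE)
    have "h1 = h - h2 * [:p:]" using s(1) by (simp add: algebra_simps)
    then have "h1 \<in> J" using type_idealD(6)[OF J h type_idealD(3)[OF J p(2), of h2]] by simp
    then have "h1 = 0" using s(2) False by auto
    then have "h = h2 * [:p:] + 0 * 0" using s(1) by (simp add: algebra_simps)
    then show ?thesis by auto
  qed
  then show ?thesis using that[of 0] type_idealD(1)[OF J] by auto
qed

text \<open>The division is by the contraction of \<open>Q\<close> to the coefficient ring. If it is
  zero, a nonzero element of least degree generates \<open>Q\<close> after inverting nonzero
  constants. If it is (p), then Q = (p, g): either p divides g and Q = (p) is principal, or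
  \<open>Q\<close> is maximal. Thus the case \<open>principal\<close> collects primes of both
  origins.\<close>

lemma prime_ideal_poly2_cases:
  fixes Q :: "'a::field poly poly set"
  assumes Q: "primeideal Q type_ring"
  obtains (zero) "Q = {0}"
  | (principal) f where "f \<in> Q" "f \<noteq> 0" "\<And>u. u \<in> Q \<Longrightarrow> \<exists>s c. s \<notin> Q \<and> s * u = c * f"
  | (maximal) p g where "prime_elem p" "[:p:] \<in> Q" "g \<in> Q" "\<not> [:p:] dvd g"
      "\<And>h. h \<in> Q \<Longrightarrow> \<exists>c d. h = c * [:p:] + d * g" "\<And>u. u \<notin> Q \<Longrightarrow> \<exists>v. u * v - 1 \<in> Q"
proof (cases "\<exists>x. [:x:] \<in> Q \<and> x \<noteq> 0")
  note Qi = type_primeidealD(1)[OF Q] and Qp = type_primeidealD(2-)[OF Q]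
  note Qd = type_idealD[OF Qi]
  case True
  then obtain x where x: "[:x:] \<in> Q" "x \<noteq> 0" by auto
  have "primeideal {c. [:c:] \<in> Q} type_ring" unfolding type_primeideal_iff type_ideal_iff
  proof (intro conjI ballI allI impI)
    show "0 \<in> {c. [:c:] \<in> Q}" "1 \<notin> {c. [:c:] \<in> Q}" using Qd(1) Qp(1) by (auto simp: one_pCons)
    show "c + d \<in> {c. [:c:] \<in> Q}" if "c \<in> {c. [:c:] \<in> Q}" "d \<in> {c. [:c:] \<in> Q}" for c d
      using that Qd(2)[of "[:c:]" "[:d:]"] by simp
    show "c * d \<in> {c. [:c:] \<in> Q}" if "d \<in> {c. [:c:] \<in> Q}" for c d
      using that Qd(3)[of "[:d:]" "[:c:]"] by (simp add: mult.commute)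
    show "c \<in> {c. [:c:] \<in> Q} \<or> d \<in> {c. [:c:] \<in> Q}" if "c * d \<in> {c. [:c:] \<in> Q}" for c d
      using that Qp(2)[of "[:c:]" "[:d:]"] by (simp add: mult.commute)
  qed
  then obtain p where p: "prime_elem p" "\<And>q. q \<in> {c. [:c:] \<in> Q} \<longleftrightarrow> p dvd q"
    using poly_prime_ideal[of "{c. [:c:] \<in> Q}" x] x by auto
  have pQ: "[:p:] \<in> Q" using p(2)[of p] by simp
  obtain g where g: "g \<in> Q" "\<And>h. h \<in> Q \<Longrightarrow> \<exists>c d. h = c * [:p:] + d * g"
    using ideal_poly2_containing_const[OF Qi p(1) pQ] by auto
  show ?thesis
  proof (cases "[:p:] dvd g")
    case True
    then obtain k where k: "g = [:p:] * k" by (elim dvdE)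
    have "\<exists>s c. s \<notin> Q \<and> s * u = c * [:p:]" if u: "u \<in> Q" for u
    proof -
      obtain c d where "u = c * [:p:] + d * g" using g(2)[OF u] by (elim exE)
      then have "1 * u = (c + d * k) * [:p:]" by (simp only: k algebra_simps mult_1)
      then show ?thesis using Qp(1) by metis
    qed
    then show ?thesis using principal[of "[:p:]"] pQ p(1) by (auto simp: prime_elem_def)
  next
    case False
    have "\<exists>v. u * v - 1 \<in> Q" if u: "u \<notin> Q" for u
    proof -
      \<comment> \<open>J = Q + (u) is again of the form (p, g'), with g' outside \<open>Q\<close>
        because u is. From g = c p + d g' it follows that d g', hence d, lies in \<open>Q\<close>;
        inserting d = e p + f g shows that p divides g (1 - f g'). Since p does not divide g, it
        divides 1 - f g', which puts 1 into \<open>J\<close>.\<close>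
      define J where "J = {q + u * v | q v. q \<in> Q}"
      have J: "ideal J type_ring" unfolding type_ideal_iff
      proof (intro conjI ballI allI)
        show "0 \<in> J" unfolding J_def using Qd(1) by (intro CollectI exI[of _ 0]) simp
        show "y + z \<in> J" if "y \<in> J" "z \<in> J" for y z
        proof -
          obtain q v q' v' where "y = q + u * v" "z = q' + u * v'" "q \<in> Q" "q' \<in> Q"
            using \<open>y \<in> J\<close> \<open>z \<in> J\<close> by (auto simp: J_def)
          then have "y + z = (q + q') + u * (v + v')" "q + q' \<in> Q" using Qd(2) by (simp_all add: algebra_simps)
          then show ?thesis unfolding J_def by auto
        qed
        show "c * y \<in> J" if "y \<in> J" for c y
        proof -
          obtain q v where "y = q + u * v" "q \<in> Q" using \<open>y \<in> J\<close> by (auto simp: J_def)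
          then have "c * y = c * q + u * (c * v)" "c * q \<in> Q" using Qd(3)[of q c] by (simp_all add: distrib_left)
          then show ?thesis unfolding J_def by auto
        qed
      qed
      have QJ: "q \<in> J" if "q \<in> Q" for q
        unfolding J_def using that by (intro CollectI exI[of _ q] exI[of _ 0]) simp
      have uJ: "u \<in> J" unfolding J_def using Qd(1) by (intro CollectI exI[of _ 0] exI[of _ 1]) simp
      obtain g' where g': "g' \<in> J" "\<And>h. h \<in> J \<Longrightarrow> \<exists>c d. h = c * [:p:] + d * g'"
        using ideal_poly2_containing_const[OF J p(1) QJ[OF pQ]] by auto
      have "g' \<notin> Q"
      proof
        assume "g' \<in> Q"
        moreover obtain c d where "u = c * [:p:] + d * g'" using g'(2)[OF uJ] by (elim exE)
        ultimately have "u \<in> Q" using Qd(2)[OF Qd(3)[OF pQ] Qd(3)] by simp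
        then show False using u by simp
      qed
      obtain c d where cd: "g = c * [:p:] + d * g'" using g'(2)[OF QJ[OF g(1)]] by (elim exE)
      then have "d * g' = g - c * [:p:]" by simp
      then have "d * g' \<in> Q" using Qd(6)[OF g(1) Qd(3)[OF pQ, of c]] by simp
      then have "d \<in> Q" using Qp(2) \<open>g' \<notin> Q\<close> by auto
      then obtain e f where ef: "d = e * [:p:] + f * g" using g(2)[OF \<open>d \<in> Q\<close>] by (elim exE)
      have "g * (1 - f * g') = [:p:] * (c + e * g')" using cd unfolding ef by (simp only: algebra_simps) simp
      then have "[:p:] dvd g * (1 - f * g')" by (rule dvdI)
      moreover have "prime_elem [:p:]" using p(1) by (simp only: prime_elem_const_poly_iff)
      ultimately have "[:p:] dvd g \<or> [:p:] dvd 1 - f * g'" by (intro prime_elem_dvd_multD)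
      then have "[:p:] dvd 1 - f * g'" using False by meson
      then obtain k where "1 - f * g' = [:p:] * k" by (elim dvdE)
      then have "1 = f * g' + k * [:p:]" by (simp add: algebra_simps)
      moreover have "f * g' + k * [:p:] \<in> J"
        using type_idealD(2)[OF J type_idealD(3)[OF J g'(1)] type_idealD(3)[OF J QJ[OF pQ]]] .
      ultimately have "1 \<in> J" by metis
      then obtain q v where "1 = q + u * v" "q \<in> Q" unfolding J_def by auto
      then have "u * v - 1 = - q" by (simp add: algebra_simps)
      then show ?thesis using Qd(5)[OF \<open>q \<in> Q\<close>] by metis
    qed
    then show ?thesis using maximal[of p g] p(1) pQ g False by auto
  qed
next
  note Qi = type_primeidealD(1)[OF Q] and Qp = type_primeidealD(2-)[OF Q]
  note Qd = type_idealD[OF Qi]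
  case False
  show ?thesis
  proof (cases "Q \<subseteq> {0}")
    case True
    then show ?thesis using zero Qd(1) by auto
  next
    case nz: False
    then have "\<exists>f. f \<in> Q \<and> f \<noteq> 0" by auto
    then obtain f where f: "f \<in> Q" "f \<noteq> 0"
      and min: "\<And>h. h \<in> Q \<Longrightarrow> h \<noteq> 0 \<Longrightarrow> Polynomial.degree f \<le> Polynomial.degree h"
      using ex_has_least_nat[of "\<lambda>h. h \<in> Q \<and> h \<noteq> 0" _ Polynomial.degree] by metis
    \<comment> \<open>The remainder of the pseudo-division by \<open>f\<close> lies in
      \<open>Q\<close> and has smaller degree or is 0, so it is 0. The multiplier is a nonzero
      constant, and \<open>Q\<close> contains no nonzero constant.\<close>
    have "\<exists>s c. s \<notin> Q \<and> s * u = c * f" if u: "u \<in> Q" for u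
    proof -
      obtain q r where qr: "pseudo_divmod u f = (q, r)" by (cases "pseudo_divmod u f")
      define l where "l = Polynomial.lead_coeff f ^ (Suc (Polynomial.degree u) - Polynomial.degree f)"
      have l: "Polynomial.smult l u = f * q + r" unfolding l_def using pseudo_divmod(1)[OF f(2) qr] .
      have "r = [:l:] * u - q * f" using l by (simp add: algebra_simps)
      then have "r \<in> Q" using Qd(3)[OF u, of "[:l:]"] Qd(3)[OF f(1), of q] Qd(6) by simp
      then have "r = 0" using min[of r] pseudo_divmod(2)[OF f(2) qr] by (metis leD)
      then have "[:l:] * u = q * f" using l by (simp add: algebra_simps)
      moreover have "l \<noteq> 0" unfolding l_def using f(2) by simp
      ultimately show ?thesis using False by metis
    qed
    then show ?thesis using principal f by auto
  qed
qed

section \<open>Primes of \<open>K[H,X,Y]\<close> containing \<open>XY - a\<close>\<close>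

abbreviation varX :: "'k::field_char_0 poly poly poly" where "varX \<equiv> [:[:0, 1:]:]"
abbreviation varY :: "'k::field_char_0 poly poly poly" where "varY \<equiv> [:0, 1:]"

lemma poly3_induct [case_names const X Y add mult]:
  assumes "\<And>p. P (polyH p)" "P varX" "P varY" "\<And>f g. P f \<Longrightarrow> P g \<Longrightarrow> P (f + g)"
    "\<And>f g. P f \<Longrightarrow> P g \<Longrightarrow> P (f * g)"
  shows "P (f :: 'k::field_char_0 poly poly poly)"
proof (induction f)
  case 0
  show ?case using assms(1)[of 0] by (simp add: polyH_def)
next
  case (pCons q f)
  have "P [:q:]"
  proof (induction q)
    case 0
    show ?case using assms(1)[of 0] by (simp add: polyH_def)
  next
    case (pCons c q)
    have "[:pCons c q:] = polyH c + varX * [:q:]" by (simp add: polyH_def)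
    then show ?case using assms(1)[of c] assms(2,4,5) pCons by metis
  qed
  moreover have "pCons q f = [:q:] + varY * f" by simp
  ultimately show ?case using assms(3,4,5) pCons by metis
qed

lemma poly3_decomp:
  fixes f :: "'k::field_char_0 poly poly poly"
  obtains \<alpha> \<beta> where "f - polyH (Polynomial.coeff (Polynomial.coeff f 0) 0) = varX * \<alpha> + varY * \<beta>"
proof -
  obtain q f' where f: "f = pCons q f'" by (cases f)
  obtain c q' where q: "q = pCons c q'" by (cases q)
  have "f - polyH (Polynomial.coeff (Polynomial.coeff f 0) 0) = varX * [:q':] + varY * f'"
    unfolding f q by (simp add: polyH_def)
  then show ?thesis by (rule that)
qed

lemma polyH_ring:
  "polyH (p + q) = polyH p + polyH q" "polyH (p * q) = polyH p * polyH q"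
  "polyH (p - q) = polyH p - polyH q" "polyH (- p) = - polyH p" "polyH 0 = 0" "polyH 1 = 1"
  by (simp_all add: polyH_def one_pCons)

lemma gwp_rel_pCons: "gwp_rel a = [:- [:a:], [:0, 1:]:]"
  by (simp add: gwp_rel_def polyH_def)

text \<open>XY - a has degree one in Y, so it divides no nonzero polynomial free of Y. This is the
  injectivity of K[H][X] into \<open>A\<close>.\<close>

lemma gwp_rel_dvd_const: "gwp_rel a dvd [:q:] \<longleftrightarrow> q = 0"
proof
  assume d: "gwp_rel a dvd [:q:]"
  show "q = 0"
  proof (rule ccontr)
    assume "q \<noteq> 0"
    then have "Polynomial.degree (gwp_rel a) \<le> Polynomial.degree [:q:]"
      using d by (intro dvd_imp_degree_le) auto
    then show False by (simp add: gwp_rel_pCons)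
  qed
qed simp

lemma prime_elem_X: "prime_elem ([:0, 1:] :: 'a::idom poly)"
proof -
  have "[:0, 1:] dvd q \<longleftrightarrow> poly q 0 = 0" for q :: "'a poly"
    using poly_eq_0_iff_dvd[of q 0] by simp
  then show ?thesis by (simp add: prime_elem_def)
qed

text \<open>X is prime and does not divide XY - a, whose value at X = 0 is -a; hence it divides the
  cofactor instead.\<close>

lemma gwp_rel_cancel_X:
  assumes "a \<noteq> 0" "gwp_rel a dvd varX * f" shows "gwp_rel a dvd f"
proof -
  obtain h where h: "varX * f = gwp_rel a * h" using assms(2) by (elim dvdE)
  have pX: "prime_elem varX" using prime_elem_X by (simp only: prime_elem_const_poly_iff)
  have "\<not> varX dvd gwp_rel a"
  proof
    assume "varX dvd gwp_rel a"
    then have "[:0, 1:] dvd Polynomial.coeff (gwp_rel a) 0" unfolding const_poly_dvd_iff by blast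
    then have "poly (- [:a:]) 0 = 0" using poly_eq_0_iff_dvd[of "- [:a:]" 0] by (simp add: gwp_rel_pCons)
    then show False using assms(1) by simp
  qed
  moreover have "varX dvd gwp_rel a * h" unfolding h[symmetric] by (rule dvd_triv_left)
  ultimately have "varX dvd h" using prime_elem_dvd_multD[OF pX] by meson
  then obtain k where "h = varX * k" by (elim dvdE)
  then have "varX * f = varX * (gwp_rel a * k)" using h by (simp only: mult.left_commute)
  then have "f = gwp_rel a * k" by (simp only: mult_cancel_left) simp
  then show ?thesis by (rule dvdI)
qed

text \<open>A chart \<open>A[1/z] = K[H,z,1/z]\<close>: \<open>E\<close> embeds \<open>K[H][z]\<close>. Elements of \<open>A\<close> are handled through
  representatives, and equality in \<open>A\<close> is divisibility of the difference by \<open>XY - a\<close>.\<close>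

locale gwp_embed =
  fixes a :: "'k::field_char_0 poly" and z z' :: "'k poly poly poly"
    and E :: "'k poly poly \<Rightarrow> 'k poly poly poly"
  assumes a0: "a \<noteq> 0" and zz: "(z = varX \<and> z' = varY) \<or> (z = varY \<and> z' = varX)"
    and E_add: "E (p + q) = E p + E q" and E_mult: "E (p * q) = E p * E q" and E_1: "E 1 = 1"
    and E_const: "E [:c:] = polyH c" and E_X: "E [:0, 1:] = z"
    and E_inj: "gwp_rel a dvd E q \<Longrightarrow> q = 0"
begin

lemma E_0: "E 0 = 0" and E_minus: "E (- p) = - E p" and E_diff: "E (p - q) = E p - E q"
  and E_power: "E (p ^ n) = E p ^ n"
proof -
  show 0: "E 0 = 0" using E_add[of 0 0] by simp
  show m: "E (- p) = - E p" for p using E_add[of p "- p"] 0 by (simp add: eq_neg_iff_add_eq_0 add.commute)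
  show "E (p - q) = E p - E q" using E_add[of p "- q"] m by simp
  show "E (p ^ n) = E p ^ n" by (induction n) (simp_all add: E_1 E_mult)
qed

lemma zz_rel: "z * z' = polyH a + gwp_rel a"
  using zz by (auto simp: gwp_rel_def)

text \<open>In \<open>A\<close> the other variable is a/z, so one factor z clears it; sums and
  products of elements with cleared denominators follow by a common power of z.\<close>

lemma clear_denominators: "\<exists>n q. gwp_rel a dvd z ^ n * f - E q"
proof -
  have z: "\<exists>n q. gwp_rel a dvd z ^ n * z - E q"
    by (rule exI[of _ 0], rule exI[of _ "[:0, 1:]"]) (simp add: E_X)
  have "z ^ 1 * z' - E [:a:] = gwp_rel a" by (simp add: E_const zz_rel)
  then have z': "\<exists>n q. gwp_rel a dvd z ^ n * z' - E q" by (metis dvd_refl)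
  show ?thesis
  proof (induction f rule: poly3_induct)
    case (const p)
    show ?case by (rule exI[of _ 0], rule exI[of _ "[:p:]"]) (simp add: E_const)
  next
    case X show ?case using z z' zz by metis
  next
    case Y show ?case using z z' zz by metis
  next
    case (add f g)
    then obtain m n p q where d: "gwp_rel a dvd z ^ m * f - E p" "gwp_rel a dvd z ^ n * g - E q" by metis
    have "z ^ (m + n) * (f + g) - E ([:0, 1:] ^ n * p + [:0, 1:] ^ m * q) =
        z ^ n * (z ^ m * f - E p) + z ^ m * (z ^ n * g - E q)"
      by (simp add: E_add E_mult E_power E_X power_add algebra_simps)
    then show ?case using d by (metis dvd_add dvd_mult)
  next
    case (mult f g)
    then obtain m n p q where d: "gwp_rel a dvd z ^ m * f - E p" "gwp_rel a dvd z ^ n * g - E q" by metis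
    have "z ^ (m + n) * (f * g) - E (p * q) =
        (z ^ n * g) * (z ^ m * f - E p) + E p * (z ^ n * g - E q)"
      by (simp add: E_mult power_add algebra_simps)
    then show ?case using d by (metis dvd_add dvd_mult)
  qed
qed

end

lemma gwp_embed_X: "a \<noteq> 0 \<Longrightarrow> gwp_embed a varX varY (\<lambda>q. [:q:])"
  by unfold_locales (auto simp: gwp_rel_dvd_const polyH_def one_pCons)

text \<open>After multiplication by powers of X the two factors become polynomials in K[H][X], on
  which reduction modulo XY - a is injective. Their product is 0 there, so one of them is 0, and the
  power of X can be cancelled again.\<close>

lemma gwp_rel_prime:
  assumes "a \<noteq> 0" shows "prime_elem (gwp_rel a)"
  unfolding prime_elem_def
proof (intro conjI allI impI)
  interpret e: gwp_embed a varX varY "\<lambda>q. [:q:]" by (rule gwp_embed_X[OF assms])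
  show "gwp_rel a \<noteq> 0" by (simp add: gwp_rel_pCons)
  show "\<not> is_unit (gwp_rel a)" using e.E_inj[of 1] by (auto simp: one_pCons)
  have cancel: "gwp_rel a dvd f" if "gwp_rel a dvd varX ^ n * f" for n f
    using that
  proof (induction n)
    case (Suc n)
    then show ?case using gwp_rel_cancel_X[OF assms, of "varX ^ n * f"] by (simp only: power_Suc mult.assoc)
  qed simp
  fix f g assume fg: "gwp_rel a dvd f * g"
  obtain m p where p: "gwp_rel a dvd varX ^ m * f - [:p:]" using e.clear_denominators[of f] by auto
  obtain n q where q: "gwp_rel a dvd varX ^ n * g - [:q:]" using e.clear_denominators[of g] by auto
  have "[:p * q:] = varX ^ m * varX ^ n * (f * g) - (varX ^ n * g) * (varX ^ m * f - [:p:])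
      - [:p:] * (varX ^ n * g - [:q:])"
    unfolding e.E_mult by (simp only: algebra_simps)
  moreover have "gwp_rel a dvd varX ^ m * varX ^ n * (f * g) - (varX ^ n * g) * (varX ^ m * f - [:p:])
      - [:p:] * (varX ^ n * g - [:q:])"
    using fg p q by (simp only: dvd_diff dvd_mult)
  ultimately have "p * q = 0" using e.E_inj[of "p * q"] by (simp only:)
  then have "p = 0 \<or> q = 0" by (simp only: mult_eq_0_iff)
  then show "gwp_rel a dvd f \<or> gwp_rel a dvd g"
  proof
    assume "p = 0"
    then have "gwp_rel a dvd varX ^ m * f" using p by (simp only: e.E_0 diff_zero)
    then have "gwp_rel a dvd f" by (rule cancel)
    then show ?thesis ..
  next
    assume "q = 0"
    then have "gwp_rel a dvd varX ^ n * g" using q by (simp only: e.E_0 diff_zero)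
    then have "gwp_rel a dvd g" by (rule cancel)
    then show ?thesis ..
  qed
qed

text \<open>Substituting \<open>Y = c\<close>, \<open>X = a/c\<close> for the infinitely many nonzero constants \<open>c\<close> kills \<open>XY - a\<close>.\<close>

lemma gwp_embed_Y:
  fixes a :: "'k::field_char_0 poly"
  assumes "a \<noteq> 0"
  shows "gwp_embed a varY varX (map_poly (\<lambda>c. [:c:]))"
proof
  let ?E = "map_poly (\<lambda>c. [:c:]) :: 'k poly poly \<Rightarrow> 'k poly poly poly"
  show "?E (p + q) = ?E p + ?E q" for p q
    by (simp add: poly_eq_iff coeff_map_poly)
  have s: "sum (\<lambda>i. [:f i:]) A = [:sum f A:]" for f :: "nat \<Rightarrow> 'k poly" and A
    by (induction A rule: infinite_finite_induct) simp_all
  show "?E (p * q) = ?E p * ?E q" for p q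
    by (simp add: poly_eq_iff[where 'a = "'k poly poly"] coeff_map_poly coeff_mult s mult.commute)
  show "?E 1 = 1" "?E [:c:] = polyH c" "?E [:0, 1:] = varY" for c
    by (simp_all add: map_poly_pCons one_pCons polyH_def)
  fix q :: "'k poly poly" assume d: "gwp_rel a dvd ?E q"
  have ev: "poly (?E q) [:d:] = [:poly q d:]" for d
    by (induction q) (simp_all add: map_poly_pCons)
  have root: "poly q [:c:] = 0" if "c \<noteq> 0" for c
  proof -
    obtain h where h: "?E q = gwp_rel a * h" using d by (elim dvdE)
    have "poly (poly (gwp_rel a) [:[:c:]:]) (Polynomial.smult (inverse c) a) = 0"
      using that by (simp add: gwp_rel_pCons)
    then have "poly (poly (?E q) [:[:c:]:]) (Polynomial.smult (inverse c) a) = 0"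
      by (simp add: h)
    then show ?thesis by (simp add: ev)
  qed
  have "infinite ((\<lambda>c. [:c:]) ` (UNIV - {0 :: 'k}))"
    by (subst finite_image_iff) (auto simp: inj_on_def infinite_UNIV_char_0)
  moreover have "(\<lambda>c. [:c:]) ` (UNIV - {0 :: 'k}) \<subseteq> {x. poly q x = 0}" using root by auto
  ultimately have "infinite {x. poly q x = 0}" using finite_subset by auto
  then show "q = 0" using poly_roots_finite by auto
qed (use assms in auto)

text \<open>Principality after localizing at \<open>P\<close>, on representatives modulo XY - a. The
  condition \<open>\<not> gwp_rel a dvd f\<close> says that f is nonzero in \<open>A\<close>, which
  gives \<open>P\<close> positive height.\<close>

definition locally_principal :: "'k::field_char_0 poly \<Rightarrow> 'k poly poly poly set \<Rightarrow> bool" where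
  "locally_principal a P \<longleftrightarrow> (\<exists>f. f \<in> P \<and> \<not> gwp_rel a dvd f \<and>
     (\<forall>u\<in>P. \<exists>s c. s \<notin> P \<and> gwp_rel a dvd s * u - c * f))"

definition locally_two_generated :: "'k::field_char_0 poly \<Rightarrow> 'k poly poly poly set \<Rightarrow> bool" where
  "locally_two_generated a P \<longleftrightarrow> (\<exists>f g. f \<in> P \<and> g \<in> P \<and>
     (\<forall>u\<in>P. \<exists>s c d. s \<notin> P \<and> gwp_rel a dvd s * u - (c * f + d * g)))"

text \<open>The first clause is maximality of \<open>P\<close>; the second provides a prime strictly
  between 0 and \<open>P\<close> in \<open>A\<close>, with \<open>w\<close> witnessing that it is
  not 0.\<close>

definition height_two_max :: "'k::field_char_0 poly \<Rightarrow> 'k poly poly poly set \<Rightarrow> bool" where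
  "height_two_max a P \<longleftrightarrow> (\<forall>u. u \<notin> P \<longrightarrow> (\<exists>v. u * v - 1 \<in> P)) \<and>
     (\<exists>Q w. primeideal Q type_ring \<and> gwp_rel a \<in> Q \<and> w \<in> Q \<and> \<not> gwp_rel a dvd w \<and> Q \<subset> P)"

context gwp_embed begin

lemma rel_cancel: "gwp_rel a dvd z ^ n * f \<Longrightarrow> gwp_rel a dvd f"
proof -
  assume "gwp_rel a dvd z ^ n * f"
  then have "gwp_rel a dvd z ^ n \<or> gwp_rel a dvd f"
    by (rule prime_elem_dvd_multD[OF gwp_rel_prime[OF a0]])
  moreover have "\<not> gwp_rel a dvd z ^ n"
    using E_inj[of "[:0, 1:] ^ n"] by (auto simp: E_power E_X)
  ultimately show ?thesis by auto
qed

text \<open>As z is outside \<open>P\<close>, clearing denominators does not affect membership in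
  \<open>P\<close>. Hence \<open>P\<close> is determined by its preimage in K[H][z], and the three
  kinds of primes there carry over.\<close>

lemma prime_cases:
  assumes P: "primeideal P type_ring" and rP: "gwp_rel a \<in> P" and zP: "z \<notin> P"
  shows "P = {u. gwp_rel a dvd u} \<or> locally_principal a P \<or>
    (height_two_max a P \<and> locally_two_generated a P)"
proof -
  note Pi = type_primeidealD(1)[OF P] and Pp = type_primeidealD(2-)[OF P]
  note Pd = type_idealD[OF Pi]
  have dvdP: "u \<in> P" if "gwp_rel a dvd u" for u using that Pd(4)[OF rP] by (auto elim: dvdE)
  have congP: "u \<in> P \<longleftrightarrow> v \<in> P" if "gwp_rel a dvd u - v" for u v
    using dvdP[OF that] Pd(2)[of "u - v" v] Pd(6)[of u "u - v"] by auto
  have znP: "z ^ n \<notin> P" for n using Pp(3) zP by auto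
  define Q where "Q = {q. E q \<in> P}"
  have QE: "q \<in> Q \<longleftrightarrow> E q \<in> P" for q by (simp add: Q_def)
  have Q: "primeideal Q type_ring"
    unfolding type_primeideal_iff type_ideal_iff QE E_add E_mult E_1 E_0 Ball_def
    using Pd(1-3) Pp(1,2) by auto
  have lift: "\<exists>n q. gwp_rel a dvd z ^ n * u - E q \<and> (u \<in> P \<longleftrightarrow> q \<in> Q)" for u
  proof -
    obtain n q where q: "gwp_rel a dvd z ^ n * u - E q" using clear_denominators[of u] by auto
    have "u \<in> P \<longleftrightarrow> z ^ n * u \<in> P" using Pd(3)[of u "z ^ n"] Pp(2)[of "z ^ n" u] znP by auto
    then show ?thesis using q congP[OF q] QE by auto
  qed
  from Q show ?thesis
  proof (cases rule: prime_ideal_poly2_cases)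
    case zero
    have "gwp_rel a dvd u" if u: "u \<in> P" for u
    proof -
      obtain n q where "gwp_rel a dvd z ^ n * u - E q" "q \<in> Q" using lift[of u] u by auto
      then have "gwp_rel a dvd z ^ n * u" using zero by (simp add: E_0)
      then show ?thesis by (rule rel_cancel)
    qed
    then show ?thesis using dvdP by auto
  next
    case (principal f)
    have "\<exists>s c. s \<notin> P \<and> gwp_rel a dvd s * u - c * E f" if u: "u \<in> P" for u
    proof -
      obtain n q where q: "gwp_rel a dvd z ^ n * u - E q" "q \<in> Q" using lift[of u] u by auto
      obtain s c where s: "s \<notin> Q" "s * q = c * f" using principal(3)[OF q(2)] by auto
      have "E s * z ^ n * u - E c * E f = E s * (z ^ n * u - E q)"
        using s(2) by (simp only: E_mult[symmetric] right_diff_distrib mult.assoc)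
      then have "gwp_rel a dvd E s * z ^ n * u - E c * E f" using q(1) by simp
      moreover have "E s * z ^ n \<notin> P" using Pp(2) znP s(1) QE by auto
      ultimately show ?thesis by auto
    qed
    moreover have "\<not> gwp_rel a dvd E f" using E_inj principal(2) by auto
    ultimately show ?thesis unfolding locally_principal_def using principal(1) QE by auto
  next
    case (maximal p g)
    have max: "\<exists>v. u * v - 1 \<in> P" if u: "u \<notin> P" for u
    proof -
      obtain n q where q: "gwp_rel a dvd z ^ n * u - E q" "q \<notin> Q" using lift[of u] u by auto
      obtain v where v: "q * v - 1 \<in> Q" using maximal(6)[OF q(2)] by auto
      have "u * (z ^ n * E v) - 1 = E v * (z ^ n * u - E q) + E (q * v - 1)"
        by (simp add: E_diff E_mult E_1 algebra_simps)
      moreover have "E v * (z ^ n * u - E q) + E (q * v - 1) \<in> P"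
        using Pd(2)[OF Pd(3)[OF dvdP[OF q(1)]]] v QE by auto
      ultimately show ?thesis by metis
    qed
    have ex: "\<exists>Q' w. primeideal Q' type_ring \<and> gwp_rel a \<in> Q' \<and> w \<in> Q' \<and> \<not> gwp_rel a dvd w \<and> Q' \<subset> P"
    proof -
      \<comment> \<open>The intermediate prime consists of the elements of \<open>A\<close> that lie
        in p K[H,z,1/z].\<close>
      define Q' where "Q' = {u. \<exists>n q. gwp_rel a dvd z ^ n * u - E ([:p:] * q)}"
      have Q'I: "u \<in> Q'" if "gwp_rel a dvd z ^ n * u - E ([:p:] * q)" for u n q
        unfolding Q'_def using that by auto
      have Q'D: "\<exists>n q. gwp_rel a dvd z ^ n * u - E ([:p:] * q)" if "u \<in> Q'" for u
        using that unfolding Q'_def by auto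
      have pp: "prime_elem [:p:]" using maximal(1) by (simp only: prime_elem_const_poly_iff)
      \<comment> \<open>p is prime in K[H][z] and does not divide z, so divisibility by p does not
        depend on the power of z that cleared the denominators.\<close>
      have key: "[:p:] dvd q" if u: "u \<in> Q'" and d: "gwp_rel a dvd z ^ n * u - E q" for u n q
      proof -
        obtain m q' where q': "gwp_rel a dvd z ^ m * u - E ([:p:] * q')" using Q'D[OF u] by auto
        have "E ([:0, 1:] ^ m * q - [:0, 1:] ^ n * ([:p:] * q')) =
            z ^ n * (z ^ m * u - E ([:p:] * q')) - z ^ m * (z ^ n * u - E q)"
          unfolding E_diff E_mult E_power E_X by (simp only: algebra_simps)
        moreover have "gwp_rel a dvd z ^ n * (z ^ m * u - E ([:p:] * q')) - z ^ m * (z ^ n * u - E q)"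
          using q' d by (simp only: dvd_diff dvd_mult)
        ultimately have "[:0, 1:] ^ m * q - [:0, 1:] ^ n * ([:p:] * q') = 0" using E_inj by metis
        then have "[:0, 1:] ^ m * q = [:p:] * ([:0, 1:] ^ n * q')" by (simp only: algebra_simps) simp
        then have "[:p:] dvd [:0, 1:] ^ m * q" by (rule dvdI)
        then have "[:p:] dvd [:0, 1:] ^ m \<or> [:p:] dvd q" by (rule prime_elem_dvd_multD[OF pp])
        moreover have "\<not> [:p:] dvd [:0, 1:] ^ m"
        proof
          assume "[:p:] dvd [:0, 1:] ^ m"
          then have "[:p:] dvd [:0, 1:]" by (rule prime_elem_dvd_power[OF pp])
          then have "p dvd Polynomial.coeff [:0, 1:] 1" unfolding const_poly_dvd_iff by (rule allE)
          then have "p dvd 1" by simp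
          then show False using maximal(1) by (simp add: prime_elem_def)
        qed
        ultimately show ?thesis by meson
      qed
      have "primeideal Q' type_ring" unfolding type_primeideal_iff type_ideal_iff
      proof (intro conjI ballI allI impI)
        show "0 \<in> Q'" by (rule Q'I[of 0 _ 0]) (simp add: E_0)
        show "u + v \<in> Q'" if uv: "u \<in> Q'" "v \<in> Q'" for u v
        proof -
          obtain m q where q: "gwp_rel a dvd z ^ m * u - E ([:p:] * q)" using Q'D[OF uv(1)] by auto
          obtain n q' where q': "gwp_rel a dvd z ^ n * v - E ([:p:] * q')" using Q'D[OF uv(2)] by auto
          have "z ^ (m + n) * (u + v) - E ([:p:] * ([:0, 1:] ^ n * q + [:0, 1:] ^ m * q')) =
              z ^ n * (z ^ m * u - E ([:p:] * q)) + z ^ m * (z ^ n * v - E ([:p:] * q'))"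
            unfolding E_mult E_add E_power E_X power_add by (simp only: algebra_simps)
          moreover have "gwp_rel a dvd
              z ^ n * (z ^ m * u - E ([:p:] * q)) + z ^ m * (z ^ n * v - E ([:p:] * q'))"
            using q q' by (simp only: dvd_add dvd_mult)
          ultimately show ?thesis using Q'I by metis
        qed
        show "c * u \<in> Q'" if u: "u \<in> Q'" for c u
        proof -
          obtain m q where q: "gwp_rel a dvd z ^ m * u - E ([:p:] * q)" using Q'D[OF u] by auto
          obtain n q' where q': "gwp_rel a dvd z ^ n * c - E q'" using clear_denominators[of c] by auto
          have "z ^ (m + n) * (c * u) - E ([:p:] * (q * q')) =
              (z ^ n * c) * (z ^ m * u - E ([:p:] * q)) + E ([:p:] * q) * (z ^ n * c - E q')"
            unfolding E_mult power_add by (simp only: algebra_simps)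
          moreover have "gwp_rel a dvd
              (z ^ n * c) * (z ^ m * u - E ([:p:] * q)) + E ([:p:] * q) * (z ^ n * c - E q')"
            using q q' by (simp only: dvd_add dvd_mult)
          ultimately show ?thesis using Q'I by metis
        qed
        show "1 \<notin> Q'"
        proof
          assume "1 \<in> Q'"
          then have "[:p:] dvd 1" by (rule key[of _ 0]) (simp add: E_1)
          then show False using pp by (simp only: prime_elem_def) simp
        qed
        show "u \<in> Q' \<or> v \<in> Q'" if uv: "u * v \<in> Q'" for u v
        proof -
          obtain m q where q: "gwp_rel a dvd z ^ m * u - E q" using clear_denominators[of u] by auto
          obtain n q' where q': "gwp_rel a dvd z ^ n * v - E q'" using clear_denominators[of v] by auto
          have "z ^ (m + n) * (u * v) - E (q * q') =
              (z ^ n * v) * (z ^ m * u - E q) + E q * (z ^ n * v - E q')"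
            unfolding E_mult power_add by (simp only: algebra_simps)
          moreover have "gwp_rel a dvd (z ^ n * v) * (z ^ m * u - E q) + E q * (z ^ n * v - E q')"
            using q q' by (simp only: dvd_add dvd_mult)
          ultimately have "gwp_rel a dvd z ^ (m + n) * (u * v) - E (q * q')" by metis
          then have "[:p:] dvd q * q'" by (rule key[OF uv])
          then have "[:p:] dvd q \<or> [:p:] dvd q'" by (rule prime_elem_dvd_multD[OF pp])
          then show ?thesis using Q'I q q' by (metis dvdE)
        qed
      qed
      moreover have "gwp_rel a \<in> Q'" by (rule Q'I[of 0 _ 0]) (simp add: E_0)
      moreover have "E [:p:] \<in> Q'" by (rule Q'I[of 0 _ 1]) simp
      moreover have "\<not> gwp_rel a dvd E [:p:]" using E_inj[of "[:p:]"] maximal(1) by auto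
      moreover have "u \<in> P" if u: "u \<in> Q'" for u
      proof -
        obtain m q where q: "gwp_rel a dvd z ^ m * u - E ([:p:] * q)" using Q'D[OF u] by auto
        have "E ([:p:] * q) \<in> P" using Pd(4)[of "E [:p:]" "E q"] maximal(2) QE by (simp only: E_mult)
        then have "z ^ m * u \<in> P" using congP[OF q] by auto
        then show ?thesis using Pp(2) znP by auto
      qed
      \<comment> \<open>The second generator of the maximal ideal, not being divisible by p, makes
        the inclusion of \<open>Q'\<close> in \<open>P\<close> strict.\<close>
      moreover have "E g \<notin> Q'"
      proof
        assume "E g \<in> Q'"
        then have "[:p:] dvd g" by (rule key[of _ 0]) simp
        then show False using maximal(4) by meson
      qed
      moreover have "E g \<in> P" using maximal(3) QE by simp
      ultimately show ?thesis by (intro exI[of _ Q'] exI[of _ "E [:p:]"] conjI psubsetI) auto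
    qed
    have gen: "\<exists>s c d. s \<notin> P \<and> gwp_rel a dvd s * u - (c * E [:p:] + d * E g)" if u: "u \<in> P" for u
    proof -
      obtain n q where q: "gwp_rel a dvd z ^ n * u - E q" "q \<in> Q" using lift[of u] u by auto
      obtain c d where "q = c * [:p:] + d * g" using maximal(5)[OF q(2)] by (elim exE)
      then have "gwp_rel a dvd z ^ n * u - (E c * E [:p:] + E d * E g)"
        using q(1) by (simp only: E_add E_mult)
      then show ?thesis using znP by (intro exI conjI)
    qed
    have "E [:p:] \<in> P" "E g \<in> P" using maximal(2,3) QE by simp_all
    with gen have "locally_two_generated a P"
      unfolding locally_two_generated_def
      by (rule_tac exI[of _ "E [:p:]"], rule_tac exI[of _ "E g"], intro conjI ballI)
    moreover have "height_two_max a P"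
      unfolding height_two_max_def using max ex by (intro conjI allI impI)
    ultimately show ?thesis by simp
  qed
qed

end

section \<open>Primes containing both X and Y\<close>

definition const_coeff :: "'k::field_char_0 poly poly poly \<Rightarrow> 'k poly" where
  "const_coeff f = Polynomial.coeff (Polynomial.coeff f 0) 0"

lemma const_coeff_simps:
  "const_coeff (f + g) = const_coeff f + const_coeff g"
  "const_coeff (f - g) = const_coeff f - const_coeff g"
  "const_coeff (f * g) = const_coeff f * const_coeff g"
  "const_coeff (polyH p) = p" "const_coeff 1 = 1" "const_coeff 0 = 0"
  "const_coeff varX = 0" "const_coeff varY = 0"
  by (simp_all add: const_coeff_def polyH_def one_pCons coeff_mult_0)

text \<open>\<open>const_coeff\<close> evaluates at X = Y = 0, so a prime containing X and Y is
  determined by its intersection with K[H]. That intersection contains a, because a and XY differ by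
  the relation, and is therefore generated by a prime divisor p of a.\<close>

lemma prime_cases_origin:
  fixes a :: "'k::field_char_0 poly"
  assumes a0: "a \<noteq> 0" and P: "primeideal P type_ring" and rP: "gwp_rel a \<in> P"
    and XP: "varX \<in> P" and YP: "varY \<in> P"
  shows "height_two_max a P \<and> (coprime a (pderiv a) \<longrightarrow> locally_two_generated a P)"
proof -
  note Pi = type_primeidealD(1)[OF P] and Pp = type_primeidealD(2-)[OF P]
  note Pd = type_idealD[OF Pi]
  define I where "I = {q. polyH q \<in> P}"
  have IE: "q \<in> I \<longleftrightarrow> polyH q \<in> P" for q by (simp add: I_def)
  have I: "primeideal I type_ring"
    unfolding type_primeideal_iff type_ideal_iff IE polyH_ring Ball_def
    using Pd(1-3) Pp(1,2) by auto
  have "polyH a = varX * varY - gwp_rel a" by (simp add: gwp_rel_def)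
  then have aI: "a \<in> I" unfolding IE using Pd(6)[OF Pd(3)[OF YP] rP] by metis
  obtain p where p: "prime_elem p" and pI: "\<And>q. q \<in> I \<longleftrightarrow> p dvd q"
    using poly_prime_ideal[OF I aI a0] by auto
  have mem: "f \<in> P \<longleftrightarrow> p dvd const_coeff f" for f
  proof -
    obtain \<alpha> \<beta> where f: "f - polyH (const_coeff f) = varX * \<alpha> + varY * \<beta>"
      unfolding const_coeff_def by (rule poly3_decomp)
    have XY: "f - polyH (const_coeff f) \<in> P"
      unfolding f using Pd(2)[OF Pd(4)[OF XP] Pd(4)[OF YP]] .
    have "f \<in> P \<longleftrightarrow> polyH (const_coeff f) \<in> P"
    proof
      show "f \<in> P" if "polyH (const_coeff f) \<in> P" using Pd(2)[OF that XY] by simp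
      show "polyH (const_coeff f) \<in> P" if "f \<in> P" using Pd(6)[OF that XY] by simp
    qed
    then show ?thesis using IE pI by simp
  qed
  have max: "\<exists>v. u * v - 1 \<in> P" if u: "u \<notin> P" for u
  proof -
    have "\<not> p dvd const_coeff u" using mem u by simp
    then obtain c d where cd: "c * const_coeff u + d * p = 1" by (rule prime_elem_bezout[OF p])
    have "const_coeff (u * polyH c - 1) = const_coeff u * c - (c * const_coeff u + d * p)"
      by (simp add: const_coeff_simps cd)
    also have "\<dots> = p * (- d)" by (simp add: algebra_simps)
    finally show ?thesis using mem by (metis dvd_triv_left)
  qed
  have "\<exists>Q w. primeideal Q type_ring \<and> gwp_rel a \<in> Q \<and> w \<in> Q \<and> \<not> gwp_rel a dvd w \<and> Q \<subset> P"
  proof -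
    \<comment> \<open>\<kappa> sets X = 0. The preimage of p K[H][Y] under it is the prime (X, p);
      it contains the relation because \<kappa> sends XY - a to -a. It is nonzero in
      \<open>A\<close> by p and differs from \<open>P\<close> by Y.\<close>
    define \<kappa> :: "'k poly poly poly \<Rightarrow> 'k poly poly" where "\<kappa> = map_poly (\<lambda>q. Polynomial.coeff q 0)"
    have c: "Polynomial.coeff (\<kappa> f) j = Polynomial.coeff (Polynomial.coeff f j) 0" for f j
      by (simp add: \<kappa>_def coeff_map_poly)
    have s: "Polynomial.coeff (sum f A) 0 = sum (\<lambda>i. Polynomial.coeff (f i) 0) A"
      for f :: "nat \<Rightarrow> 'k poly poly" and A by (simp add: coeff_sum)
    have hom: "\<kappa> (f + g) = \<kappa> f + \<kappa> g" "\<kappa> (f * g) = \<kappa> f * \<kappa> g" "\<kappa> 0 = 0" "\<kappa> 1 = 1" for f g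
      by (simp_all add: poly_eq_iff[where 'a = "'k poly"] c coeff_mult s coeff_mult_0)
    define Q where "Q = {f. [:p:] dvd \<kappa> f}"
    have QE: "f \<in> Q \<longleftrightarrow> [:p:] dvd \<kappa> f" for f by (simp only: Q_def mem_Collect_eq)
    have QC: "f \<in> Q \<longleftrightarrow> (\<forall>j. p dvd Polynomial.coeff (Polynomial.coeff f j) 0)" for f
      unfolding QE const_poly_dvd_iff c ..
    have pp: "prime_elem [:p:]" using p by (simp only: prime_elem_const_poly_iff)
    have "primeideal Q type_ring" unfolding type_primeideal_iff type_ideal_iff QE hom
    proof (intro conjI ballI allI impI)
      show "\<not> [:p:] dvd 1" using pp unfolding prime_elem_def by meson
    qed (use prime_elem_dvd_multD[OF pp] in \<open>simp_all only: QE dvd_0_right dvd_add dvd_mult\<close>)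
    moreover have "gwp_rel a \<in> Q" unfolding QC
      using aI pI by (auto simp: gwp_rel_pCons coeff_pCons split: nat.split)
    moreover have "polyH p \<in> Q" unfolding QC by (auto simp: polyH_def coeff_pCons split: nat.split)
    moreover have "\<not> gwp_rel a dvd polyH p"
      using p unfolding polyH_def gwp_rel_dvd_const by (auto simp: prime_elem_def)
    moreover have "f \<in> P" if "f \<in> Q" for f using that unfolding QC mem const_coeff_def by auto
    moreover have "varY \<notin> Q"
    proof
      assume "varY \<in> Q"
      then have "p dvd Polynomial.coeff (Polynomial.coeff varY 1) 0" unfolding QC by (rule allE)
      then show False using p by (simp add: prime_elem_def)
    qed
    ultimately show ?thesis using YP by (intro exI[of _ Q] exI[of _ "polyH p"] conjI psubsetI) auto
  qed
  then have "height_two_max a P" unfolding height_two_max_def using max by (intro conjI allI impI)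
  moreover have "locally_two_generated a P" if cop: "coprime a (pderiv a)"
  proof -
    \<comment> \<open>The cofactor c serves as local multiplier: it is prime to p, hence outside
      \<open>P\<close>, and c p = a equals XY modulo the relation, so that c moves every element of
      \<open>P\<close> into (X, Y).\<close>
    obtain c where c: "a = p * c" using aI pI by (auto elim: dvdE)
    have pc: "\<not> p dvd c"
    proof
      assume "p dvd c"
      then obtain e where "c = p * e" by (elim dvdE)
      then have "pderiv a = p * (2 * pderiv p * e + p * pderiv e)"
        unfolding c by (simp add: pderiv_mult algebra_simps)
      then have "p dvd pderiv a" by (rule dvdI)
      moreover have "p dvd a" unfolding c by (rule dvd_triv_left)
      ultimately have "is_unit p" using cop by (intro coprime_common_divisor)
      then show False using p by (simp add: prime_elem_def)
    qed
    have "\<exists>s \<gamma> \<delta>. s \<notin> P \<and> gwp_rel a dvd s * u - (\<gamma> * varX + \<delta> * varY)" if u: "u \<in> P" for u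
    proof -
      obtain \<alpha> \<beta> where f: "u - polyH (const_coeff u) = varX * \<alpha> + varY * \<beta>"
        unfolding const_coeff_def by (rule poly3_decomp)
      obtain d where d: "const_coeff u = p * d" using u mem by (auto elim: dvdE)
      have ac: "polyH c * polyH (p * d) = polyH a * polyH d"
        unfolding c polyH_ring by (simp only: ac_simps)
      have "polyH c * u = polyH c * polyH (const_coeff u) + polyH c * (u - polyH (const_coeff u))"
        by (simp add: right_diff_distrib)
      also have "\<dots> = polyH a * polyH d + polyH c * (varX * \<alpha> + varY * \<beta>)"
        unfolding f unfolding d ac ..
      also have "\<dots> = ((polyH c * \<alpha> + varY * polyH d) * varX + (polyH c * \<beta>) * varY)
          - gwp_rel a * polyH d"
        unfolding gwp_rel_def by (simp only: algebra_simps)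
      finally have "polyH c * u - ((polyH c * \<alpha> + varY * polyH d) * varX + (polyH c * \<beta>) * varY)
          = gwp_rel a * (- polyH d)" by simp
      then have "gwp_rel a dvd polyH c * u - ((polyH c * \<alpha> + varY * polyH d) * varX + (polyH c * \<beta>) * varY)"
        by (rule dvdI)
      moreover have "polyH c \<notin> P" using pc mem by (simp add: const_coeff_simps)
      ultimately show ?thesis by (intro exI conjI)
    qed
    then show ?thesis unfolding locally_two_generated_def using XP YP
      by (rule_tac exI[of _ varX], rule_tac exI[of _ varY], intro conjI ballI)
  qed
  ultimately show ?thesis by simp
qed

lemma prime_classification:
  assumes "a \<noteq> 0" "primeideal P type_ring" "gwp_rel a \<in> P"
  shows "P = {u. gwp_rel a dvd u} \<or> locally_principal a P \<or>
    (height_two_max a P \<and> (coprime a (pderiv a) \<longrightarrow> locally_two_generated a P))"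
proof -
  consider "varX \<notin> P" | "varY \<notin> P" | "varX \<in> P" "varY \<in> P" by blast
  then show ?thesis
  proof cases
    case 1
    show ?thesis using gwp_embed.prime_cases[OF gwp_embed_X[OF assms(1)] assms(2,3) 1] by auto
  next
    case 2
    show ?thesis using gwp_embed.prime_cases[OF gwp_embed_Y[OF assms(1)] assms(2,3) 2] by auto
  next
    case 3
    show ?thesis using prime_cases_origin[OF assms 3] by simp
  qed
qed

section \<open>Regularity\<close>

lemma primeideal_zero_add:
  assumes "primeideal P R"
  shows "\<zero>\<^bsub>R\<^esub> \<in> P" "\<lbrakk>x \<in> P; y \<in> P\<rbrakk> \<Longrightarrow> x \<oplus>\<^bsub>R\<^esub> y \<in> P"
  using additive_subgroup.zero_closed additive_subgroup.a_closed
    ideal.axioms(1)[OF primeideal.axioms(1)[OF assms]] by metis+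

lemma (in domain) local_domainI:
  assumes "primeideal P R" shows "local_domain R (carrier R - P) P"
proof -
  interpret P: primeideal P R by fact
  have "\<one> \<notin> P" using P.I_notcarr P.one_imp_carrier by auto
  then show ?thesis
    using P.I_prime P.primeideal_axioms by unfold_locales auto
qed

text \<open>A prime \<open>0 \<noteq> Q \<subset> P\<close> would contain, for \<open>0 \<noteq> q \<in> Q\<close>, elements \<open>x\<^sub>n\<close> with \<open>s q = f\<^sup>n x\<^sub>n\<close> and \<open>s \<notin> P\<close> for
  all \<open>n\<close>. The ideal of all \<open>r\<close> with \<open>f\<^sup>n s r \<in> (q)\<close> for some \<open>n\<close> and \<open>s \<notin> P\<close> is finitely generated, so a
  single pair \<open>N, s\<close> serves all its elements; taking \<open>r = x\<^sub>n\<close> with \<open>n = N + 1\<close> puts a product of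
  elements outside \<open>P\<close> into \<open>(f)\<close>.\<close>

lemma (in domain) no_chain_below_locally_principal:
  assumes N: "noetherian_ring R" and P: "primeideal P R" and f: "f \<in> P"
    and gen: "\<And>u. u \<in> P \<Longrightarrow> \<exists>s c. s \<in> carrier R \<and> s \<notin> P \<and> c \<in> carrier R \<and> s \<otimes> u = c \<otimes> f"
  shows "\<not> prime_chain R P 2"
proof
  assume "prime_chain R P 2"
  then obtain Q where Q: "\<forall>i\<le>2. primeideal (Q i) R" "\<forall>i<2. Q i \<subset> Q (Suc i)" "Q 2 \<subseteq> P"
    by (auto simp: prime_chain_def)
  interpret P: primeideal P R by fact
  interpret Q: primeideal "Q 1" R using Q(1) by simp
  have "\<zero> \<in> Q 0" using Q(1) by (intro primeideal_zero_add(1)) simp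
  have "Q 0 \<subset> Q 1" "Q 1 \<subset> Q 2" using Q(2)[rule_format, of 0] Q(2)[rule_format, of 1]
    by (simp_all add: numeral_2_eq_2)
  then obtain q where q: "q \<in> Q 1" "q \<noteq> \<zero>" using \<open>\<zero> \<in> Q 0\<close> by auto
  have QP: "x \<in> P" if "x \<in> Q 1" for x using that \<open>Q 1 \<subset> Q 2\<close> Q(3) by auto
  have fc: "f \<in> carrier R" using f P.Icarr by simp
  have qc: "q \<in> carrier R" using q Q.Icarr by simp
  \<comment> \<open>If f were in \<open>Q 1\<close>, then s u = c f with s outside \<open>P\<close>
    would put every u of \<open>P\<close> into \<open>Q 1\<close>.\<close>
  have fQ: "f \<notin> Q 1"
  proof
    assume fQ: "f \<in> Q 1"
    have "u \<in> Q 1" if u: "u \<in> P" for u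
    proof -
      obtain s c where s: "s \<in> carrier R" "s \<notin> P" "c \<in> carrier R" "s \<otimes> u = c \<otimes> f"
        using gen[OF u] by auto
      have "s \<otimes> u \<in> Q 1" unfolding s(4) using fQ s(3) by (rule Q.I_l_closed)
      then show ?thesis using Q.I_prime[of s u] s P.Icarr[OF u] QP by auto
    qed
    then show False using \<open>Q 1 \<subset> Q 2\<close> Q(3) by auto
  qed
  have "f \<noteq> \<zero>" using fQ Q.zero_closed by auto
  have prodS: "s \<otimes> t \<in> carrier R \<and> s \<otimes> t \<notin> P"
    if "s \<in> carrier R" "s \<notin> P" "t \<in> carrier R" "t \<notin> P" for s t
    using that P.I_prime[of s t] by auto
  have one: "\<one> \<notin> P" using P.I_notcarr P.one_imp_carrier by auto
  \<comment> \<open>\<open>D n s\<close> is the colon ideal of (q) by f^n s. These ideals are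
    directed under multiplication of the parameters, so their union over all n and all s outside
    \<open>P\<close> is an ideal.\<close>
  define D where "D n s = {r \<in> carrier R. \<exists>w\<in>carrier R. (f [^] n \<otimes> s) \<otimes> r = w \<otimes> q}" for n :: nat and s
  have DI: "r \<in> D n s" if "r \<in> carrier R" "w \<in> carrier R" "(f [^] n \<otimes> s) \<otimes> r = w \<otimes> q" for r w n s
    using that by (auto simp: D_def)
  have DE: "\<exists>w. r \<in> carrier R \<and> w \<in> carrier R \<and> (f [^] n \<otimes> s) \<otimes> r = w \<otimes> q" if "r \<in> D n s" for r n s
    using that by (auto simp: D_def)
  have Dideal: "ideal (D n s) R" if s: "s \<in> carrier R" for n s
  proof (rule cring_idealI)
    show "D n s \<subseteq> carrier R" by (auto simp: D_def)
    show "\<zero> \<in> D n s" by (rule DI[of _ \<zero>]) (use s fc qc in auto)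
    show "x \<oplus> y \<in> D n s" if xy: "x \<in> D n s" "y \<in> D n s" for x y
    proof -
      obtain w where w: "x \<in> carrier R" "w \<in> carrier R" "(f [^] n \<otimes> s) \<otimes> x = w \<otimes> q" using DE[OF xy(1)] by auto
      obtain w' where w': "y \<in> carrier R" "w' \<in> carrier R" "(f [^] n \<otimes> s) \<otimes> y = w' \<otimes> q"
        using DE[OF xy(2)] by auto
      show ?thesis by (rule DI[of _ "w \<oplus> w'"]) (use w w' s fc qc in \<open>simp_all add: r_distr l_distr\<close>)
    qed
    show "x \<otimes> y \<in> D n s" if xy: "x \<in> carrier R" "y \<in> D n s" for x y
    proof -
      obtain w where w: "y \<in> carrier R" "w \<in> carrier R" "(f [^] n \<otimes> s) \<otimes> y = w \<otimes> q"
        using DE[OF xy(2)] by auto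
      have "(f [^] n \<otimes> s) \<otimes> (x \<otimes> y) = x \<otimes> ((f [^] n \<otimes> s) \<otimes> y)"
        using w(1) xy(1) s fc by (simp add: m_ac)
      also have "\<dots> = (x \<otimes> w) \<otimes> q" unfolding w(3) using w xy(1) qc by (simp add: m_assoc)
      finally show ?thesis using w xy(1) by (intro DI[of _ "x \<otimes> w"]) auto
    qed
  qed
  have Dmono: "r \<in> D (n + m) (s \<otimes> t)" if r: "r \<in> D n s" and st: "s \<in> carrier R" "t \<in> carrier R" for r n m s t
  proof -
    obtain w where w: "r \<in> carrier R" "w \<in> carrier R" "(f [^] n \<otimes> s) \<otimes> r = w \<otimes> q" using DE[OF r] by auto
    have "(f [^] (n + m) \<otimes> (s \<otimes> t)) \<otimes> r = (f [^] m \<otimes> t) \<otimes> ((f [^] n \<otimes> s) \<otimes> r)"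
      using w(1) st fc by (simp add: m_ac flip: nat_pow_mult)
    also have "\<dots> = (f [^] m \<otimes> t \<otimes> w) \<otimes> q" unfolding w(3) using w st fc qc by (simp add: m_assoc)
    finally show ?thesis using w st fc by (intro DI[of _ "f [^] m \<otimes> t \<otimes> w"]) auto
  qed
  define I where "I = {r. \<exists>n s. s \<in> carrier R \<and> s \<notin> P \<and> r \<in> D n s}"
  have IE: "r \<in> I \<longleftrightarrow> (\<exists>n s. s \<in> carrier R \<and> s \<notin> P \<and> r \<in> D n s)" for r by (simp add: I_def)
  have "ideal I R"
  proof (rule cring_idealI)
    show "I \<subseteq> carrier R" by (auto simp: IE D_def)
    show "\<zero> \<in> I" unfolding IE using one ideal.axioms(1)[OF Dideal] additive_subgroup.zero_closed by blast
    show "x \<otimes> y \<in> I" if "x \<in> carrier R" "y \<in> I" for x y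
      using that ideal.I_l_closed[OF Dideal] unfolding IE by metis
    show "x \<oplus> y \<in> I" if xy: "x \<in> I" "y \<in> I" for x y
    proof -
      obtain n s m t where s: "s \<in> carrier R" "s \<notin> P" "x \<in> D n s" "t \<in> carrier R" "t \<notin> P" "y \<in> D m t"
        using xy unfolding IE by auto
      have "x \<in> D (n + m) (s \<otimes> t)" "y \<in> D (n + m) (s \<otimes> t)"
        using Dmono[OF s(3,1,4), of m] Dmono[OF s(6,4,1), of n] s by (simp_all add: m_comm add.commute)
      then have "x \<oplus> y \<in> D (n + m) (s \<otimes> t)"
        using additive_subgroup.a_closed[OF ideal.axioms(1)[OF Dideal]] s by simp
      then show ?thesis unfolding IE using prodS s by metis
    qed
  qed
  from noetherianD[OF N this] obtain G where G: "G \<subseteq> I" "finite G"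
    "\<forall>J. ideal J R \<and> G \<subseteq> J \<longrightarrow> I \<subseteq> J" by (elim exE conjE)
  have "\<exists>n s. s \<in> carrier R \<and> s \<notin> P \<and> G \<subseteq> D n s" using G(2,1)
  proof (induction G rule: finite_induct)
    case empty
    show ?case using one by auto
  next
    case (insert x F)
    obtain n s where s: "s \<in> carrier R" "s \<notin> P" "F \<subseteq> D n s" using insert by auto
    obtain m t where t: "t \<in> carrier R" "t \<notin> P" "x \<in> D m t" using insert(4) IE by auto
    have "x \<in> D (n + m) (s \<otimes> t)" using Dmono[OF t(3,1) s(1), of n] s t by (simp add: m_comm add.commute)
    moreover have "y \<in> D (n + m) (s \<otimes> t)" if "y \<in> F" for y using Dmono[OF _ s(1) t(1)] s(3) that by auto
    ultimately have "insert x F \<subseteq> D (n + m) (s \<otimes> t)" by auto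
    then show ?case using prodS s t by metis
  qed
  then obtain N s where Ns: "s \<in> carrier R" "s \<notin> P" "G \<subseteq> D N s" by auto
  then have ID: "I \<subseteq> D N s" using G(3) Dideal by simp
  \<comment> \<open>c f lies in \<open>Q 1\<close> and f does not, so the cofactor c stays in
    \<open>Q 1\<close> and a further power of f can be split off.\<close>
  have desc: "\<exists>x s. x \<in> Q 1 \<and> s \<in> carrier R \<and> s \<notin> P \<and> s \<otimes> q = f [^] n \<otimes> x" for n :: nat
  proof (induction n)
    case 0
    show ?case using q one qc by (intro exI[of _ q] exI[of _ \<one>]) simp
  next
    case (Suc n)
    then obtain x s where x: "x \<in> Q 1" "s \<in> carrier R" "s \<notin> P" "s \<otimes> q = f [^] n \<otimes> x" by auto
    have xc: "x \<in> carrier R" using x Q.Icarr by simp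
    obtain t c where t: "t \<in> carrier R" "t \<notin> P" "c \<in> carrier R" "t \<otimes> x = c \<otimes> f"
      using gen[OF QP[OF x(1)]] by auto
    have "c \<otimes> f \<in> Q 1" using Q.I_l_closed[OF x(1) t(1)] t(4) by simp
    then have "c \<in> Q 1" using Q.I_prime[OF t(3) fc] fQ by simp
    moreover have "(t \<otimes> s) \<otimes> q = f [^] Suc n \<otimes> c"
    proof -
      have "(t \<otimes> s) \<otimes> q = t \<otimes> (s \<otimes> q)" using t x qc by (simp add: m_assoc)
      also have "\<dots> = f [^] n \<otimes> (t \<otimes> x)" unfolding x(4) using t(1) xc fc by (simp add: m_ac)
      also have "\<dots> = f [^] Suc n \<otimes> c" unfolding t(4) using t(3) fc by (simp add: m_ac)
      finally show ?thesis .
    qed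
    ultimately show ?case using prodS[OF t(1,2) x(2,3)] by metis
  qed
  obtain x t where x: "x \<in> Q 1" "t \<in> carrier R" "t \<notin> P" "t \<otimes> q = f [^] Suc N \<otimes> x" using desc by metis
  have xc: "x \<in> carrier R" using x Q.Icarr by simp
  \<comment> \<open>The equation t q = f^(N+1) x gives membership with exponent N+1; the uniform
    bound on the union lowers it to N, and the power of f gained is what lands in
    \<open>P\<close>.\<close>
  have "x \<in> D (Suc N) \<one>" using x xc fc by (intro DI[of _ t]) simp_all
  then have "x \<in> I" unfolding IE using one by auto
  then obtain w where w: "w \<in> carrier R" "(f [^] N \<otimes> s) \<otimes> x = w \<otimes> q" using ID DE[of x N s] by auto
  have "(f \<otimes> w) \<otimes> q = f \<otimes> ((f [^] N \<otimes> s) \<otimes> x)" unfolding w(2) using w fc qc by (simp add: m_assoc)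
  also have "\<dots> = s \<otimes> (f [^] Suc N \<otimes> x)" using fc Ns xc by (simp add: m_ac)
  also have "\<dots> = (s \<otimes> t) \<otimes> q" unfolding x(4)[symmetric] using Ns x qc by (simp add: m_assoc)
  finally have "f \<otimes> w = s \<otimes> t" 
    using m_rcancel[of q "f \<otimes> w" "s \<otimes> t"] q(2) qc w(1) fc Ns(1) x(2) by simp
  then have "s \<otimes> t \<in> P" using P.I_r_closed[OF f w(1)] by simp
  then show False using prodS[OF Ns(1,2) x(2,3)] by simp
qed

section \<open>Transfer of ideals between the algebra and its polynomial representatives\<close>

lemma gwp_class_eq_iff: "gwp_class a f = gwp_class a g \<longleftrightarrow> gwp_rel a dvd f - g"
  unfolding gwp_class_eq
proof
  assume "\<exists>h. f = h * gwp_rel a + g"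
  then show "gwp_rel a dvd f - g" by auto
next
  assume "gwp_rel a dvd f - g"
  then obtain h where "f - g = gwp_rel a * h" by (elim dvdE)
  then have "f = h * gwp_rel a + g" by (simp add: algebra_simps)
  then show "\<exists>h. f = h * gwp_rel a + g" by (intro exI)
qed

lemma gwp_class_zero: "gwp_class a f = \<zero>\<^bsub>gwp_algebra a\<^esub> \<longleftrightarrow> gwp_rel a dvd f"
  by (simp add: gwp_simps gwp_class_eq_iff)

lemma gwp_closed: "gwp_class a f \<in> carrier (gwp_algebra a)" by (simp add: gwp_simps)

lemma gwp_cases:
  assumes "u \<in> carrier (gwp_algebra a)" obtains f where "u = gwp_class a f"
  using assms by (auto simp: gwp_simps)

lemma gwp_cring: "cring (gwp_algebra a)"
  using gwp_algebra_is_algebra by (rule algebra.axioms(2))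

lemma gwp_domain: assumes "a \<noteq> 0" shows "domain (gwp_algebra a)"
proof -
  note pr = gwp_rel_prime[OF assms]
  show ?thesis
  proof (intro domain.intro domain_axioms.intro gwp_cring)
    show "\<one>\<^bsub>gwp_algebra a\<^esub> \<noteq> \<zero>\<^bsub>gwp_algebra a\<^esub>"
      unfolding gwp_simps(5) gwp_class_zero using pr by (simp add: prime_elem_def)
    fix u v assume uv: "u \<otimes>\<^bsub>gwp_algebra a\<^esub> v = \<zero>\<^bsub>gwp_algebra a\<^esub>" "u \<in> carrier (gwp_algebra a)" "v \<in> carrier (gwp_algebra a)"
    obtain f g where fg: "u = gwp_class a f" "v = gwp_class a g" using uv gwp_cases by metis
    have "gwp_rel a dvd f * g" using uv(1) unfolding fg gwp_simps(3) gwp_class_zero .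
    then show "u = \<zero>\<^bsub>gwp_algebra a\<^esub> \<or> v = \<zero>\<^bsub>gwp_algebra a\<^esub>"
      unfolding fg gwp_class_zero by (rule prime_elem_dvd_multD[OF pr])
  qed
qed

lemma gwp_noetherian: "noetherian_ring (gwp_algebra (a :: 'k::field_char_0 poly))"
proof -
  have "noetherian_ring (type_ring :: 'k poly poly poly ring)"
    by (intro hilbert_basis noetherian_field)
  then show ?thesis
    by (rule noetherian_image[where h = "gwp_class a"])
      (auto intro: type_cring gwp_cring simp: gwp_simps type_ring_simps)
qed

definition gwp_preimage :: "'k::field_char_0 poly \<Rightarrow> 'k poly poly poly set set \<Rightarrow> 'k poly poly poly set" where
  "gwp_preimage a P = {f. gwp_class a f \<in> P}"

lemma gwp_preimage_iff: "f \<in> gwp_preimage a P \<longleftrightarrow> gwp_class a f \<in> P"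
  by (simp add: gwp_preimage_def)

lemma gwp_preimage_prime:
  assumes "primeideal P (gwp_algebra a)"
  shows "primeideal (gwp_preimage a P) type_ring" "gwp_rel a \<in> gwp_preimage a P"
proof -
  interpret P: primeideal P "gwp_algebra a" by fact
  have one: "gwp_class a 1 \<notin> P" using P.I_notcarr P.one_imp_carrier by (auto simp: gwp_simps(5))
  show "primeideal (gwp_preimage a P) type_ring"
    unfolding type_primeideal_iff type_ideal_iff gwp_preimage_iff Ball_def
  proof (intro conjI allI impI)
    show "gwp_class a 0 \<in> P" using primeideal_zero_add(1)[OF assms] by (simp add: gwp_simps(4))
    show "gwp_class a (f + g) \<in> P" if "gwp_class a f \<in> P" "gwp_class a g \<in> P" for f g
      using primeideal_zero_add(2)[OF assms that] by (simp add: gwp_simps(2))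
    show "gwp_class a (f * g) \<in> P" if "gwp_class a g \<in> P" for f g
      using P.I_l_closed[OF that gwp_closed[of a f]] by (simp add: gwp_simps(3))
    show "gwp_class a f \<in> P \<or> gwp_class a g \<in> P" if "gwp_class a (f * g) \<in> P" for f g
      using P.I_prime[OF gwp_closed[of a f] gwp_closed[of a g]] that by (simp add: gwp_simps(3))
  qed (rule one)
  have "gwp_class a (gwp_rel a) = \<zero>\<^bsub>gwp_algebra a\<^esub>" by (simp add: gwp_class_zero)
  then show "gwp_rel a \<in> gwp_preimage a P" by (simp add: gwp_preimage_iff)
qed

lemma gwp_image_prime:
  assumes Q: "primeideal Q type_ring" "gwp_rel a \<in> Q"
  shows "primeideal (gwp_class a ` Q) (gwp_algebra a)" "gwp_class a f \<in> gwp_class a ` Q \<longleftrightarrow> f \<in> Q"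
proof -
  interpret M: cring "gwp_algebra a" by (rule gwp_cring)
  note Qd = type_idealD[OF type_primeidealD(1)[OF Q(1)]] and Qp = type_primeidealD(2,3)[OF Q(1)]
  show mem: "gwp_class a f \<in> gwp_class a ` Q \<longleftrightarrow> f \<in> Q" for f
  proof
    assume "gwp_class a f \<in> gwp_class a ` Q"
    then obtain g where g: "g \<in> Q" "gwp_class a f = gwp_class a g" by auto
    then obtain h where "f - g = gwp_rel a * h" unfolding gwp_class_eq_iff by (elim dvdE)
    then have "f - g \<in> Q" using Qd(4)[OF Q(2)] by simp
    then have "f - g + g \<in> Q" using g(1) Qd(2) by blast
    then show "f \<in> Q" by simp
  qed simp
  show "primeideal (gwp_class a ` Q) (gwp_algebra a)"
  proof (intro primeidealI M.is_cring M.cring_idealI)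
    show "gwp_class a ` Q \<subseteq> carrier (gwp_algebra a)" by (auto simp: gwp_closed)
    show "\<zero>\<^bsub>gwp_algebra a\<^esub> \<in> gwp_class a ` Q" unfolding gwp_simps(4) mem by (rule Qd(1))
    show "u \<oplus>\<^bsub>gwp_algebra a\<^esub> v \<in> gwp_class a ` Q" if "u \<in> gwp_class a ` Q" "v \<in> gwp_class a ` Q" for u v
      using that Qd(2) by (auto simp: gwp_simps(2) mem)
    show "u \<otimes>\<^bsub>gwp_algebra a\<^esub> v \<in> gwp_class a ` Q" if "u \<in> carrier (gwp_algebra a)" "v \<in> gwp_class a ` Q" for u v
      using that Qd(3) by (auto elim!: gwp_cases simp: gwp_simps(3) mem)
    show "carrier (gwp_algebra a) \<noteq> gwp_class a ` Q" using gwp_closed[of a 1] mem[of 1] Qp(1) by auto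
    show "u \<in> gwp_class a ` Q \<or> v \<in> gwp_class a ` Q"
      if uv: "u \<in> carrier (gwp_algebra a)" "v \<in> carrier (gwp_algebra a)" "u \<otimes>\<^bsub>gwp_algebra a\<^esub> v \<in> gwp_class a ` Q" for u v
    proof -
      obtain f g where fg: "u = gwp_class a f" "v = gwp_class a g"
        using gwp_cases[OF uv(1)] gwp_cases[OF uv(2)] by metis
      have "f * g \<in> Q" using uv(3) unfolding fg gwp_simps(3) mem .
      then show ?thesis unfolding fg mem by (rule Qp(2))
    qed
  qed
qed

lemma gwp_prime_cases:
  assumes a0: "a \<noteq> 0" and P: "primeideal P (gwp_algebra a)"
  obtains (zero) "P = {\<zero>\<^bsub>gwp_algebra a\<^esub>}"
  | (principal) "locally_principal a (gwp_preimage a P)"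
  | (maximal) "height_two_max a (gwp_preimage a P)"
      "coprime a (pderiv a) \<Longrightarrow> locally_two_generated a (gwp_preimage a P)"
proof -
  interpret P: primeideal P "gwp_algebra a" by fact
  have "P = {\<zero>\<^bsub>gwp_algebra a\<^esub>}" if e: "gwp_preimage a P = {u. gwp_rel a dvd u}"
  proof (intro equalityI subsetI)
    fix u assume u: "u \<in> P"
    then obtain f where f: "u = gwp_class a f" using P.Icarr gwp_cases by metis
    have "f \<in> gwp_preimage a P" using u f gwp_preimage_iff by metis
    then show "u \<in> {\<zero>\<^bsub>gwp_algebra a\<^esub>}" unfolding e f by (simp add: gwp_class_zero)
  qed simp
  then show ?thesis using prime_classification[OF a0 gwp_preimage_prime[OF P]] zero principal maximal by metis
qed

lemma gwp_no_chain_principal: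
  assumes a0: "a \<noteq> 0" and P: "primeideal P (gwp_algebra a)" and pr: "locally_principal a (gwp_preimage a P)"
  shows "\<not> prime_chain (gwp_algebra a) P 2"
proof -
  interpret A: domain "gwp_algebra a" by (rule gwp_domain[OF a0])
  interpret P: primeideal P "gwp_algebra a" by fact
  obtain f where f: "gwp_class a f \<in> P"
    and gen: "\<And>u. gwp_class a u \<in> P \<Longrightarrow> \<exists>s c. gwp_class a s \<notin> P \<and> gwp_rel a dvd s * u - c * f"
    using pr unfolding locally_principal_def Ball_def gwp_preimage_iff by auto
  show ?thesis
  proof (rule A.no_chain_below_locally_principal[OF gwp_noetherian P f])
    fix u assume u: "u \<in> P"
    then obtain g where g: "u = gwp_class a g" using P.Icarr gwp_cases by metis
    obtain s c where "gwp_class a s \<notin> P" "gwp_rel a dvd s * g - c * f" using gen[of g] u g by auto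
    then show "\<exists>s c. s \<in> carrier (gwp_algebra a) \<and> s \<notin> P \<and> c \<in> carrier (gwp_algebra a) \<and>
        s \<otimes>\<^bsub>gwp_algebra a\<^esub> u = c \<otimes>\<^bsub>gwp_algebra a\<^esub> gwp_class a f"
      by (intro exI[of _ "gwp_class a s"] exI[of _ "gwp_class a c"])
        (simp add: g gwp_closed gwp_simps(3) gwp_class_eq_iff)
  qed
qed

text \<open>In a chain of length 3 the prime \<open>Q 2\<close> is nonzero and has a chain of length
  2 below it, so it is not locally principal. By the classification it is then maximal, against its
  strict inclusion in \<open>Q 3\<close>.\<close>

lemma gwp_dim_le_2:
  assumes a0: "a \<noteq> 0" shows "\<not> prime_chain (gwp_algebra a) P 3"
proof
  assume "prime_chain (gwp_algebra a) P 3"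
  then obtain Q where Q: "\<forall>i\<le>3. primeideal (Q i) (gwp_algebra a)" "\<forall>i<3. Q i \<subset> Q (Suc i)"
    by (auto simp: prime_chain_def)
  have p: "primeideal (Q 0) (gwp_algebra a)" "primeideal (Q 1) (gwp_algebra a)"
    "primeideal (Q 2) (gwp_algebra a)" "primeideal (Q 3) (gwp_algebra a)"
    using Q(1) by simp_all
  have s: "Q 0 \<subset> Q 1" "Q 1 \<subset> Q 2" "Q 2 \<subset> Q 3"
    using Q(2)[rule_format, of 0] Q(2)[rule_format, of 1] Q(2)[rule_format, of 2]
    by (simp_all add: numeral_2_eq_2 numeral_3_eq_3)
  have c2: "prime_chain (gwp_algebra a) (Q 2) 2" unfolding prime_chain_def
    using Q by (intro exI[of _ Q] conjI) simp_all
  have z: "\<zero>\<^bsub>gwp_algebra a\<^esub> \<in> Q i" if "i \<le> 3" for i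
    using Q(1)[rule_format, OF that] by (rule primeideal_zero_add(1))
  from a0 p(3) show False
  proof (cases rule: gwp_prime_cases)
    case zero
    then show False using s(2) z[of 1] by auto
  next
    case principal
    then show False using gwp_no_chain_principal[OF a0 p(3)] c2 by simp
  next
    case maximal
    interpret Q3: primeideal "Q 3" "gwp_algebra a" by (rule p)
    obtain u where u: "u \<in> Q 3" "u \<notin> Q 2" using s(3) by auto
    obtain f where f: "u = gwp_class a f" using gwp_cases[OF Q3.Icarr[OF u(1)]] by auto
    obtain v where v: "gwp_class a (f * v - 1) \<in> Q 2"
      using maximal(1) u(2) f unfolding height_two_max_def gwp_preimage_iff by auto
    note Q3d = type_idealD[OF type_primeidealD(1)[OF gwp_preimage_prime(1)[OF p(4)]]]
    have "f * v - 1 \<in> gwp_preimage a (Q 3)" "f * v \<in> gwp_preimage a (Q 3)"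
      using v s(3) Q3d(4)[of f v] u(1) f by (auto simp: gwp_preimage_iff)
    then have "f * v - (f * v - 1) \<in> gwp_preimage a (Q 3)" using Q3d(6) by blast
    then show False using type_primeidealD(2)[OF gwp_preimage_prime(1)[OF p(4)]] by simp
  qed
qed

text \<open>The three kinds of primes come with 0, 1 and 2 local generators. The chains consisting
  of 0, of 0 and P, and of 0, Q and P show that the dimension is not smaller, and the chain bounds
  show that it is not larger.\<close>

lemma gwp_regular:
  assumes a0: "a \<noteq> 0" and cop: "coprime a (pderiv a)"
  shows "regular_ring (gwp_algebra a)"
  unfolding regular_ring_def
proof (intro conjI allI impI gwp_noetherian)
  let ?A = "gwp_algebra a"
  interpret A: domain ?A by (rule gwp_domain[OF a0])
  show "cring ?A" by (rule A.is_cring)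
  fix P assume P: "primeideal P ?A"
  interpret P: primeideal P ?A by fact
  interpret l: local_domain ?A "carrier ?A - P" P by (rule A.local_domainI[OF P])
  have chain0: "prime_chain ?A P 0" unfolding prime_chain_def using P by (intro exI[of _ "\<lambda>_. P"]) simp
  have zp: "primeideal {\<zero>\<^bsub>?A\<^esub>} ?A" by (rule A.zeroprimeideal)
  from a0 P show "regular_local_ring (localization ?A (carrier ?A - P))"
  proof (cases rule: gwp_prime_cases)
    case zero
    have "\<not> prime_chain ?A P 1"
    proof
      assume "prime_chain ?A P 1"
      then obtain Q where Q: "\<forall>i\<le>1. primeideal (Q i) ?A" "\<forall>i<1. Q i \<subset> Q (Suc i)" "Q 1 \<subseteq> P"
        by (auto simp: prime_chain_def)
      have "\<zero>\<^bsub>?A\<^esub> \<in> Q 0"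
        using Q(1) by (intro primeideal_zero_add(1)) simp
      then show False using Q zero by auto
    qed
    moreover have "\<exists>s\<in>carrier ?A - P. s \<otimes>\<^bsub>?A\<^esub> u \<in> Idl\<^bsub>?A\<^esub> (set [])" if "u \<in> P" for u
    proof (rule bexI[OF _ l.one_S])
      have "ideal (Idl\<^bsub>?A\<^esub> {}) ?A" by (rule A.genideal_ideal) simp
      then have "\<zero>\<^bsub>?A\<^esub> \<in> Idl\<^bsub>?A\<^esub> {}" by (meson additive_subgroup.zero_closed ideal.axioms(1))
      moreover have "u = \<zero>\<^bsub>?A\<^esub>" using that unfolding zero by (rule singletonD)
      moreover have "\<one>\<^bsub>?A\<^esub> \<otimes>\<^bsub>?A\<^esub> \<zero>\<^bsub>?A\<^esub> = \<zero>\<^bsub>?A\<^esub>" by (rule A.r_null[OF A.one_closed])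
      ultimately show "\<one>\<^bsub>?A\<^esub> \<otimes>\<^bsub>?A\<^esub> u \<in> Idl\<^bsub>?A\<^esub> (set [])" by (simp only: list.set)
    qed
    ultimately show ?thesis using chain0
      by (intro l.regular_localI[of "[]"] gwp_noetherian) (simp_all only: list.set list.size One_nat_def empty_subsetI simp_thms)
  next
    case principal
    obtain f where f: "gwp_class a f \<in> P" "\<not> gwp_rel a dvd f"
      and gen: "\<And>u. gwp_class a u \<in> P \<Longrightarrow> \<exists>s c. gwp_class a s \<notin> P \<and> gwp_rel a dvd s * u - c * f"
      using principal unfolding locally_principal_def Ball_def gwp_preimage_iff by auto
    let ?xs = "[gwp_class a f]"
    have fP: "set ?xs \<subseteq> P" using f(1) by simp
    have fc: "set ?xs \<subseteq> carrier ?A" by (simp add: gwp_closed)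
    interpret I: ideal "Idl\<^bsub>?A\<^esub> (set ?xs)" ?A by (rule A.genideal_ideal[OF fc])
    have fI: "gwp_class a f \<in> Idl\<^bsub>?A\<^esub> (set ?xs)" using A.genideal_self[OF fc] by simp
    have "\<exists>s\<in>carrier ?A - P. s \<otimes>\<^bsub>?A\<^esub> u \<in> Idl\<^bsub>?A\<^esub> (set ?xs)" if u: "u \<in> P" for u
    proof -
      obtain g where g: "u = gwp_class a g" using gwp_cases[OF P.Icarr[OF u]] by auto
      obtain s c where s: "gwp_class a s \<notin> P" "gwp_rel a dvd s * g - c * f" using gen[of g] u g by auto
      have "gwp_class a s \<otimes>\<^bsub>?A\<^esub> u = gwp_class a c \<otimes>\<^bsub>?A\<^esub> gwp_class a f"
        unfolding g gwp_simps(3) gwp_class_eq_iff by (rule s(2))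
      then have "gwp_class a s \<otimes>\<^bsub>?A\<^esub> u \<in> Idl\<^bsub>?A\<^esub> (set ?xs)" using I.I_l_closed[OF fI gwp_closed] by metis
      then show ?thesis using s(1) gwp_closed by (intro bexI[of _ "gwp_class a s"]) auto
    qed
    moreover have "prime_chain ?A P 1"
    proof -
      have "gwp_class a f \<noteq> \<zero>\<^bsub>?A\<^esub>" using f(2) by (simp add: gwp_class_zero)
      then have "{\<zero>\<^bsub>?A\<^esub>} \<subset> P" using f(1) primeideal_zero_add(1)[OF P]
        by (metis empty_subsetI insert_subset psubsetI singletonD)
      then show ?thesis unfolding prime_chain_def using P zp
        by (intro exI[of _ "\<lambda>i. if i = 0 then {\<zero>\<^bsub>?A\<^esub>} else P"]) auto
    qed
    ultimately show ?thesis
      using gwp_no_chain_principal[OF a0 P principal] fP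
      by (intro l.regular_localI[of ?xs] gwp_noetherian) (simp_all add: numeral_2_eq_2)
  next
    case maximal
    obtain f g where f: "gwp_class a f \<in> P" "gwp_class a g \<in> P"
      and gen: "\<And>u. gwp_class a u \<in> P \<Longrightarrow>
        \<exists>s c d. gwp_class a s \<notin> P \<and> gwp_rel a dvd s * u - (c * f + d * g)"
      using maximal(2)[OF cop] unfolding locally_two_generated_def Ball_def gwp_preimage_iff by auto
    let ?xs = "[gwp_class a f, gwp_class a g]"
    have fP: "set ?xs \<subseteq> P" using f by simp
    have fc: "set ?xs \<subseteq> carrier ?A" by (simp add: gwp_closed)
    interpret I: ideal "Idl\<^bsub>?A\<^esub> (set ?xs)" ?A by (rule A.genideal_ideal[OF fc])
    have fI: "gwp_class a f \<in> Idl\<^bsub>?A\<^esub> (set ?xs)" "gwp_class a g \<in> Idl\<^bsub>?A\<^esub> (set ?xs)"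
      using A.genideal_self[OF fc] by simp_all
    have "\<exists>s\<in>carrier ?A - P. s \<otimes>\<^bsub>?A\<^esub> u \<in> Idl\<^bsub>?A\<^esub> (set ?xs)" if u: "u \<in> P" for u
    proof -
      obtain h where h: "u = gwp_class a h" using gwp_cases[OF P.Icarr[OF u]] by auto
      obtain s c d where s: "gwp_class a s \<notin> P" "gwp_rel a dvd s * h - (c * f + d * g)" using gen[of h] u h by auto
      have "gwp_class a s \<otimes>\<^bsub>?A\<^esub> u =
          gwp_class a c \<otimes>\<^bsub>?A\<^esub> gwp_class a f \<oplus>\<^bsub>?A\<^esub> gwp_class a d \<otimes>\<^bsub>?A\<^esub> gwp_class a g"
        unfolding h gwp_simps(2,3) gwp_class_eq_iff by (rule s(2))
      then have "gwp_class a s \<otimes>\<^bsub>?A\<^esub> u \<in> Idl\<^bsub>?A\<^esub> (set ?xs)"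
        using I.a_closed[OF I.I_l_closed[OF fI(1) gwp_closed] I.I_l_closed[OF fI(2) gwp_closed]] by metis
      then show ?thesis using s(1) gwp_closed by (intro bexI[of _ "gwp_class a s"]) auto
    qed
    moreover have "prime_chain ?A P 2"
    proof -
      obtain Q w where Q: "primeideal Q type_ring" "gwp_rel a \<in> Q" "w \<in> Q" "\<not> gwp_rel a dvd w"
          "Q \<subset> gwp_preimage a P"
        using maximal(1) unfolding height_two_max_def by auto
      have "gwp_class a w \<noteq> \<zero>\<^bsub>?A\<^esub>" using Q(4) by (simp add: gwp_class_zero)
      then have "{\<zero>\<^bsub>?A\<^esub>} \<subset> gwp_class a ` Q"
        using Q(3) type_idealD(1)[OF type_primeidealD(1)[OF Q(1)]] unfolding gwp_simps(4)
        by (metis empty_subsetI image_eqI insert_subset psubsetI singletonD)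
      moreover have "gwp_class a ` Q \<subset> P"
      proof -
        obtain v where "v \<in> gwp_preimage a P" "v \<notin> Q" using Q(5) by auto
        then have "gwp_class a v \<in> P" "gwp_class a v \<notin> gwp_class a ` Q"
          unfolding gwp_image_prime(2)[OF Q(1,2)] gwp_preimage_iff by simp_all
        moreover have "gwp_class a ` Q \<subseteq> P" using Q(5) by (auto simp: gwp_preimage_iff)
        ultimately show ?thesis by auto
      qed
      ultimately show ?thesis unfolding prime_chain_def using P zp gwp_image_prime(1)[OF Q(1,2)]
        by (intro exI[of _ "\<lambda>i. if i = 0 then {\<zero>\<^bsub>?A\<^esub>} else if i = 1 then gwp_class a ` Q else P"])
          (auto simp: less_Suc_eq numeral_2_eq_2)
    qed
    ultimately show ?thesis
      using gwp_dim_le_2[OF a0, of P] fP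
      by (intro l.regular_localI[of ?xs] gwp_noetherian) (simp_all add: numeral_2_eq_2 numeral_3_eq_3)
  qed
qed

section \<open>Failure of regularity at a multiple factor\<close>

definition X_coeff :: "'k::field_char_0 poly poly poly \<Rightarrow> 'k poly" where
  "X_coeff f = Polynomial.coeff (Polynomial.coeff f 0) 1"
definition Y_coeff :: "'k::field_char_0 poly poly poly \<Rightarrow> 'k poly" where
  "Y_coeff f = Polynomial.coeff (Polynomial.coeff f 1) 0"

text \<open>\<open>X_coeff\<close> and \<open>Y_coeff\<close> are the partial derivatives by X and Y
  at X = Y = 0, hence the product rules.\<close>

lemma XY_coeff_simps:
  "X_coeff (f + g) = X_coeff f + X_coeff g" "Y_coeff (f + g) = Y_coeff f + Y_coeff g"
  "X_coeff (f - g) = X_coeff f - X_coeff g" "Y_coeff (f - g) = Y_coeff f - Y_coeff g"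
  "X_coeff (f * g) = X_coeff f * const_coeff g + const_coeff f * X_coeff g"
  "Y_coeff (f * g) = Y_coeff f * const_coeff g + const_coeff f * Y_coeff g"
  "X_coeff (polyH p) = 0" "Y_coeff (polyH p) = 0" "X_coeff varX = 1" "Y_coeff varX = 0"
  "X_coeff varY = 0" "Y_coeff varY = 1"
  by (simp_all add: X_coeff_def Y_coeff_def const_coeff_def polyH_def coeff_mult coeff_mult_0 algebra_simps)

lemma gwp_rel_coeffs:
  "const_coeff (gwp_rel a) = - a" "X_coeff (gwp_rel a) = 0" "Y_coeff (gwp_rel a) = 0"
  by (simp_all add: gwp_rel_pCons const_coeff_def X_coeff_def Y_coeff_def)

lemma prime_dvd_pderiv:
  fixes p :: "'a::field_char_0 poly"
  assumes "prime_elem p" shows "\<not> p dvd pderiv p"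
proof
  assume d: "p dvd pderiv p"
  have p0: "p \<noteq> 0" "\<not> is_unit p" using assms by (simp_all add: prime_elem_def)
  then have deg: "Polynomial.degree p \<noteq> 0" by (simp add: is_unit_iff_degree)
  then have "pderiv p \<noteq> 0" by (simp add: pderiv_eq_0_iff)
  then have "Polynomial.degree p \<le> Polynomial.degree (pderiv p)" using d by (rule dvd_imp_degree_le[rotated])
  then show False using deg by (simp add: degree_pderiv)
qed

text \<open>The determinant of a product of a 3-by-2 and a 2-by-3 matrix vanishes; the diagonal term is isolated
  because the other five contain an off-diagonal factor.\<close>

lemma det3_rank2:
  fixes x1 x2 y1 y2 z1 z2 :: "'a::comm_ring_1"
  assumes "r1 = c1 * x1 + d1 * x2" "r2 = c1 * y1 + d1 * y2" "r3 = c1 * z1 + d1 * z2"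
    and "s1 = c2 * x1 + d2 * x2" "s2 = c2 * y1 + d2 * y2" "s3 = c2 * z1 + d2 * z2"
    and "t1 = c3 * x1 + d3 * x2" "t2 = c3 * y1 + d3 * y2" "t3 = c3 * z1 + d3 * z2"
  shows "r1 * s2 * t3 = r1 * s3 * t2 + r2 * s1 * t3 - r2 * s3 * t1 - r3 * s1 * t2 + r3 * s2 * t1"
  unfolding assms by (simp add: algebra_simps)

lemma length_le_2_cases:
  "length xs \<le> 2 \<Longrightarrow> xs = [] \<or> (\<exists>x. xs = [x]) \<or> (\<exists>x y. xs = [x, y])"
  by (auto simp: le_Suc_eq numeral_2_eq_2 length_Suc_conv)

text \<open>If two elements generated P = (X, Y, p) locally, then p, X and Y would be combinations
  of two vectors in a three-dimensional cotangent space. Independence is tested by a 3-by-3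
  determinant modulo p, which avoids constructing that space.\<close>

lemma gwp_not_regular:
  fixes a :: "'k::field_char_0 poly"
  assumes a0: "a \<noteq> 0" and ncop: "\<not> coprime a (pderiv a)"
  shows "\<not> regular_ring (gwp_algebra a)"
proof
  let ?A = "gwp_algebra a"
  assume reg: "regular_ring ?A"
  interpret A: domain ?A by (rule gwp_domain[OF a0])
  obtain d where d: "d dvd a" "d dvd pderiv a" "\<not> is_unit d" using ncop by (rule not_coprimeE)
  have "d \<noteq> 0" using d(1) a0 by auto
  then obtain p where p: "prime_elem p" "p dvd d" using d(3) by (rule prime_divisor_exists_poly)
  have pa: "p dvd a" "p dvd pderiv a" using p(2) d(1,2) dvd_trans by blast+
  obtain c where c: "a = p * c" using pa(1) by (elim dvdE)
  \<comment> \<open>By the product rule p' c = a' - p c'. Since p does not divide p', it divides c,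
    so p^2 divides a.\<close>
  have "p dvd pderiv p * c"
  proof -
    have "pderiv p * c = pderiv a - p * pderiv c" unfolding c by (simp add: pderiv_mult algebra_simps)
    then show ?thesis using pa(2) by simp
  qed
  then have "p dvd c" using prime_elem_dvd_multD[OF p(1)] prime_dvd_pderiv[OF p(1)] by blast
  then obtain e where e: "a = p * (p * e)" unfolding c by (auto elim: dvdE)
  define Q where "Q = {f. p dvd const_coeff f}"
  have QE: "f \<in> Q \<longleftrightarrow> p dvd const_coeff f" for f by (simp add: Q_def)
  have Q: "primeideal Q type_ring" unfolding type_primeideal_iff type_ideal_iff QE const_coeff_simps Ball_def
    using p(1) by (auto simp: prime_elem_def)
  have relQ: "gwp_rel a \<in> Q" unfolding QE gwp_rel_coeffs using pa(1) by simp
  note Qd = type_idealD[OF type_primeidealD(1)[OF Q]]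
  let ?P = "gwp_class a ` Q"
  have P: "primeideal ?P ?A" and mem: "gwp_class a f \<in> ?P \<longleftrightarrow> f \<in> Q" for f
    by (rule gwp_image_prime[OF Q relQ])+
  interpret l: local_domain ?A "carrier ?A - ?P" ?P by (rule A.local_domainI[OF P])
  have rl: "regular_local_ring (localization ?A (carrier ?A - ?P))" using reg P unfolding regular_ring_def by simp
  have nc: "\<not> prime_chain ?A ?P (Suc 2)" using gwp_dim_le_2[OF a0] by (simp add: numeral_3_eq_3 numeral_2_eq_2)
  obtain xs where xs: "set xs \<subseteq> ?P" "length xs \<le> 2"
    and gen: "\<And>u. u \<in> ?P \<Longrightarrow> \<exists>s\<in>carrier ?A - ?P. s \<otimes>\<^bsub>?A\<^esub> u \<in> Idl\<^bsub>?A\<^esub> (set xs)"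
    using l.regular_localD[OF rl nc] by blast
  \<comment> \<open>A shorter list is padded by zeros or by repetition, so that exactly two
    generators can be assumed.\<close>
  have "\<exists>u1 u2. u1 \<in> Q \<and> u2 \<in> Q \<and> set xs \<subseteq> {gwp_class a u1, gwp_class a u2}"
  proof -
    consider "xs = []" | x where "xs = [x]" | x y where "xs = [x, y]"
      using length_le_2_cases[OF xs(2)] by blast
    then show ?thesis
    proof cases
      case 1
      show ?thesis by (rule exI[of _ 0], rule exI[of _ 0]) (simp add: 1 Qd(1))
    next
      case 2
      then have "x \<in> ?P" using xs(1) by simp
      then obtain u1 where "x = gwp_class a u1" "u1 \<in> Q" by (rule imageE)
      then show ?thesis by (intro exI[of _ u1]) (simp add: 2)
    next
      case 3
      then have x: "x \<in> ?P" and y: "y \<in> ?P" using xs(1) by simp_all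
      obtain u1 where "x = gwp_class a u1" "u1 \<in> Q" using x by (rule imageE)
      moreover obtain u2 where "y = gwp_class a u2" "u2 \<in> Q" using y by (rule imageE)
      ultimately show ?thesis by (intro exI[of _ u1] exI[of _ u2]) (simp add: 3)
    qed
  qed
  then obtain u1 u2 where u: "u1 \<in> Q" "u2 \<in> Q" "set xs \<subseteq> {gwp_class a u1, gwp_class a u2}" by blast
  define J where "J = {gwp_class a (c * u1 + d * u2) | c d. True}"
  have JI: "gwp_class a (c * u1 + d * u2) \<in> J" for c d by (auto simp: J_def)
  have JD: "\<exists>c d. x = gwp_class a (c * u1 + d * u2)" if "x \<in> J" for x using that by (auto simp: J_def)
  have Jid: "ideal J ?A"
  proof (rule A.cring_idealI)
    show "J \<subseteq> carrier ?A" by (auto simp: J_def gwp_closed)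
    show "\<zero>\<^bsub>?A\<^esub> \<in> J" using JI[of 0 0] by (simp add: gwp_simps(4))
    show "x \<oplus>\<^bsub>?A\<^esub> y \<in> J" if "x \<in> J" "y \<in> J" for x y
    proof -
      obtain c d c' d' where "x = gwp_class a (c * u1 + d * u2)" "y = gwp_class a (c' * u1 + d' * u2)"
        using JD \<open>x \<in> J\<close> \<open>y \<in> J\<close> by metis
      then have "x \<oplus>\<^bsub>?A\<^esub> y = gwp_class a ((c + c') * u1 + (d + d') * u2)"
        by (simp add: gwp_simps(2) algebra_simps)
      then show ?thesis using JI by metis
    qed
    show "x \<otimes>\<^bsub>?A\<^esub> y \<in> J" if "x \<in> carrier ?A" "y \<in> J" for x y
    proof -
      obtain c d where "y = gwp_class a (c * u1 + d * u2)" using JD \<open>y \<in> J\<close> by metis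
      moreover obtain f where "x = gwp_class a f" using \<open>x \<in> carrier ?A\<close> by (rule gwp_cases)
      ultimately have "x \<otimes>\<^bsub>?A\<^esub> y = gwp_class a ((f * c) * u1 + (f * d) * u2)"
        by (simp add: gwp_simps(3) algebra_simps)
      then show ?thesis using JI by metis
    qed
  qed
  have "gwp_class a u1 \<in> J" "gwp_class a u2 \<in> J" using JI[of 1 0] JI[of 0 1] by simp_all
  then have "set xs \<subseteq> J" using u(3) by blast
  then have IJ: "Idl\<^bsub>?A\<^esub> (set xs) \<subseteq> J" by (rule A.genideal_minimal[OF Jid])
  obtain k1 where k1: "const_coeff u1 = p * k1" using u(1) QE by (auto elim: dvdE)
  obtain k2 where k2: "const_coeff u2 = p * k2" using u(2) QE by (auto elim: dvdE)
  \<comment> \<open>The coordinates of an element of \<open>P\<close> are its constant coefficient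
    divided by p and its X and Y coefficients, all taken modulo p. A multiple of the relation
    contributes nothing: XY - a has no linear terms in X and Y, and its constant coefficient -p^2 e
    remains divisible by p after the division.\<close>
  have row: "\<exists>s c d. \<not> p dvd s \<and> p dvd c * k1 + d * k2 - s * k \<and>
      p dvd c * X_coeff u1 + d * X_coeff u2 - s * X_coeff f \<and>
      p dvd c * Y_coeff u1 + d * Y_coeff u2 - s * Y_coeff f"
    if f: "const_coeff f = p * k" for f k
  proof -
    have "gwp_class a f \<in> ?P" unfolding mem QE f by simp
    from gen[OF this] obtain S where S': "S \<in> carrier ?A - ?P"
      "S \<otimes>\<^bsub>?A\<^esub> gwp_class a f \<in> Idl\<^bsub>?A\<^esub> (set xs)" by (rule bexE)
    then have S: "S \<in> carrier ?A" "S \<notin> ?P" "S \<otimes>\<^bsub>?A\<^esub> gwp_class a f \<in> J"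
      using subsetD[OF IJ] by simp_all
    obtain s where s: "S = gwp_class a s" using S(1) by (rule gwp_cases)
    obtain c d where "gwp_class a (s * f) = gwp_class a (c * u1 + d * u2)"
      using JD[OF S(3)] unfolding s gwp_simps(3) by (elim exE)
    then obtain h where h: "s * f - (c * u1 + d * u2) = gwp_rel a * h" unfolding gwp_class_eq_iff by (elim dvdE)
    let ?s = "const_coeff s" and ?c = "const_coeff c" and ?d = "const_coeff d"
    have "\<not> p dvd ?s" using S(2) unfolding s mem QE .
    moreover have "p dvd ?c * k1 + ?d * k2 - ?s * k"
    proof -
      have "const_coeff (s * f - (c * u1 + d * u2)) = const_coeff (gwp_rel a * h)" by (simp only: h)
      then have "p * (?c * k1 + ?d * k2 - ?s * k) = p * (p * (e * const_coeff h))"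
        unfolding const_coeff_simps gwp_rel_coeffs f k1 k2 e by (simp add: algebra_simps)
      then have "?c * k1 + ?d * k2 - ?s * k = p * (e * const_coeff h)"
        using p(1) by (simp add: prime_elem_def)
      then show ?thesis by (rule dvdI)
    qed
    moreover have "p dvd ?c * X_coeff u1 + ?d * X_coeff u2 - ?s * X_coeff f"
    proof -
      have "X_coeff (s * f - (c * u1 + d * u2)) = X_coeff (gwp_rel a * h)" by (simp only: h)
      then have "?c * X_coeff u1 + ?d * X_coeff u2 - ?s * X_coeff f =
          p * (X_coeff s * k - X_coeff c * k1 - X_coeff d * k2 + p * e * X_coeff h)"
        unfolding XY_coeff_simps gwp_rel_coeffs f k1 k2 e by (simp add: algebra_simps)
      then show ?thesis by (rule dvdI)
    qed
    moreover have "p dvd ?c * Y_coeff u1 + ?d * Y_coeff u2 - ?s * Y_coeff f"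
    proof -
      have "Y_coeff (s * f - (c * u1 + d * u2)) = Y_coeff (gwp_rel a * h)" by (simp only: h)
      then have "?c * Y_coeff u1 + ?d * Y_coeff u2 - ?s * Y_coeff f =
          p * (Y_coeff s * k - Y_coeff c * k1 - Y_coeff d * k2 + p * e * Y_coeff h)"
        unfolding XY_coeff_simps gwp_rel_coeffs f k1 k2 e by (simp add: algebra_simps)
      then show ?thesis by (rule dvdI)
    qed
    ultimately show ?thesis by (intro exI conjI)
  qed
  \<comment> \<open>p, X and Y have the coordinates (1,0,0), (0,1,0) and (0,0,1), so the three rows
    form diag(r, s, t) modulo p, with no diagonal entry divisible by p.\<close>
  obtain r c1 d1 where R: "\<not> p dvd r" "p dvd c1 * k1 + d1 * k2 - r * 1"
      "p dvd c1 * X_coeff u1 + d1 * X_coeff u2 - r * 0" "p dvd c1 * Y_coeff u1 + d1 * Y_coeff u2 - r * 0"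
    using row[of "polyH p" 1] unfolding XY_coeff_simps const_coeff_simps by auto
  obtain s c2 d2 where S: "\<not> p dvd s" "p dvd c2 * k1 + d2 * k2 - s * 0"
      "p dvd c2 * X_coeff u1 + d2 * X_coeff u2 - s * 1" "p dvd c2 * Y_coeff u1 + d2 * Y_coeff u2 - s * 0"
    using row[of varX 0] unfolding XY_coeff_simps const_coeff_simps by auto
  obtain t c3 d3 where T: "\<not> p dvd t" "p dvd c3 * k1 + d3 * k2 - t * 0"
      "p dvd c3 * X_coeff u1 + d3 * X_coeff u2 - t * 0" "p dvd c3 * Y_coeff u1 + d3 * Y_coeff u2 - t * 1"
    using row[of varY 0] unfolding XY_coeff_simps const_coeff_simps by auto
  define r1 r2 r3 where r: "r1 = c1 * k1 + d1 * k2" "r2 = c1 * X_coeff u1 + d1 * X_coeff u2"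
    "r3 = c1 * Y_coeff u1 + d1 * Y_coeff u2"
  define s1 s2 s3 where s: "s1 = c2 * k1 + d2 * k2" "s2 = c2 * X_coeff u1 + d2 * X_coeff u2"
    "s3 = c2 * Y_coeff u1 + d2 * Y_coeff u2"
  define t1 t2 t3 where t: "t1 = c3 * k1 + d3 * k2" "t2 = c3 * X_coeff u1 + d3 * X_coeff u2"
    "t3 = c3 * Y_coeff u1 + d3 * Y_coeff u2"
  have off: "p dvd r2" "p dvd r3" "p dvd s1" "p dvd s3" "p dvd t1" "p dvd t2"
    using R(3,4) S(2,4) T(2,3) by (simp_all only: r s t mult_zero_right diff_zero)
  have "p dvd r1 * s3 * t2 + r2 * s1 * t3 - r2 * s3 * t1 - r3 * s1 * t2 + r3 * s2 * t1"
    using off by (intro dvd_add dvd_diff) (simp_all only: dvd_mult dvd_mult2)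
  then have "p dvd r1 * s2 * t3" unfolding det3_rank2[OF r s t] .
  moreover have nd: "\<not> p dvd x" if xy: "\<not> p dvd y" "p dvd x - y" for x y
  proof
    assume "p dvd x"
    then have "p dvd x - (x - y)" using xy(2) by (rule dvd_diff)
    then show False using xy(1) by simp
  qed
  have "\<not> p dvd r1" by (rule nd[OF R(1)]) (use R(2) in \<open>simp only: r mult_1_right\<close>)
  moreover have "\<not> p dvd s2" by (rule nd[OF S(1)]) (use S(3) in \<open>simp only: s mult_1_right\<close>)
  moreover have "\<not> p dvd t3" by (rule nd[OF T(1)]) (use T(4) in \<open>simp only: t mult_1_right\<close>)
  ultimately show False using prime_elem_dvd_multD[OF p(1)] by blast
qed

lemma Idl_pair_iff:
  fixes a b :: "'a::field poly"
  shows "Idl\<^bsub>type_ring\<^esub> {a, b} = carrier type_ring \<longleftrightarrow> coprime a b"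
proof -
  interpret R: cring "type_ring :: 'a poly ring" by (rule type_cring)
  have sub: "{a, b} \<subseteq> carrier type_ring" by (simp add: type_ring_simps)
  note I = type_idealD[OF R.genideal_ideal[OF sub]]
  have ab: "a \<in> Idl\<^bsub>type_ring\<^esub> {a, b}" "b \<in> Idl\<^bsub>type_ring\<^esub> {a, b}"
    using R.genideal_self[OF sub] by auto
  show ?thesis
  proof
    assume e: "Idl\<^bsub>type_ring\<^esub> {a, b} = carrier type_ring"
    obtain g c d where g: "g dvd a" "g dvd b" "g = c * a + d * b" by (rule poly_bezout)
    have "ideal {x. g dvd x} type_ring" unfolding type_ideal_iff by auto
    then have "Idl\<^bsub>type_ring\<^esub> {a, b} \<subseteq> {x. g dvd x}" using g(1,2) by (intro R.genideal_minimal) auto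
    then have "1 \<in> {x. g dvd x}" unfolding e by (auto simp: type_ring_simps)
    then obtain h where "1 = g * h" by (auto elim: dvdE)
    then have "(h * c) * a + (h * d) * b = 1" unfolding g(3) by (simp add: algebra_simps)
    then show "coprime a b" unfolding coprime_poly_iff by (intro exI)
  next
    assume "coprime a b"
    then obtain c d where "c * a + d * b = 1" unfolding coprime_poly_iff by blast
    then have "1 \<in> Idl\<^bsub>type_ring\<^esub> {a, b}" using I(2)[OF I(3)[OF ab(1), of c] I(3)[OF ab(2), of d]] by simp
    then have "x \<in> Idl\<^bsub>type_ring\<^esub> {a, b}" for x using I(3)[of 1 x] by simp
    then show "Idl\<^bsub>type_ring\<^esub> {a, b} = carrier type_ring" by (auto simp: type_ring_simps)
  qed
qed

section \<open>Derivations\<close>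

context algebra begin

lemma derivationsD:
  assumes "D \<in> derivations R M"
  shows "D \<in> extensional (carrier M)" "u \<in> carrier M \<Longrightarrow> D u \<in> carrier M"
    "\<lbrakk>u \<in> carrier M; v \<in> carrier M\<rbrakk> \<Longrightarrow> D (u \<oplus>\<^bsub>M\<^esub> v) = D u \<oplus>\<^bsub>M\<^esub> D v"
    "\<lbrakk>k \<in> carrier R; u \<in> carrier M\<rbrakk> \<Longrightarrow> D (k \<odot>\<^bsub>M\<^esub> u) = k \<odot>\<^bsub>M\<^esub> D u"
    "\<lbrakk>u \<in> carrier M; v \<in> carrier M\<rbrakk> \<Longrightarrow> D (u \<otimes>\<^bsub>M\<^esub> v) = D u \<otimes>\<^bsub>M\<^esub> v \<oplus>\<^bsub>M\<^esub> u \<otimes>\<^bsub>M\<^esub> D v"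
  using assms by (auto simp: derivations_def PiE_def)

lemma derivationsI:
  assumes "\<And>u. u \<in> carrier M \<Longrightarrow> D u \<in> carrier M"
    "\<And>u v. \<lbrakk>u \<in> carrier M; v \<in> carrier M\<rbrakk> \<Longrightarrow> D (u \<oplus>\<^bsub>M\<^esub> v) = D u \<oplus>\<^bsub>M\<^esub> D v"
    "\<And>k u. \<lbrakk>k \<in> carrier R; u \<in> carrier M\<rbrakk> \<Longrightarrow> D (k \<odot>\<^bsub>M\<^esub> u) = k \<odot>\<^bsub>M\<^esub> D u"
    "\<And>u v. \<lbrakk>u \<in> carrier M; v \<in> carrier M\<rbrakk> \<Longrightarrow> D (u \<otimes>\<^bsub>M\<^esub> v) = D u \<otimes>\<^bsub>M\<^esub> v \<oplus>\<^bsub>M\<^esub> u \<otimes>\<^bsub>M\<^esub> D v"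
  shows "(\<lambda>v\<in>carrier M. D v) \<in> derivations R M"
  using assms unfolding derivations_def by (auto simp: restrict_def)

lemma derivation_zero: "(\<lambda>v\<in>carrier M. \<zero>\<^bsub>M\<^esub>) \<in> derivations R M"
  by (rule derivationsI) simp_all

lemma derivation_add:
  assumes "D \<in> derivations R M" "E \<in> derivations R M"
  shows "(\<lambda>v\<in>carrier M. D v \<oplus>\<^bsub>M\<^esub> E v) \<in> derivations R M"
proof (rule derivationsI)
  note D = derivationsD[OF assms(1)] and E = derivationsD[OF assms(2)]
  show "D u \<oplus>\<^bsub>M\<^esub> E u \<in> carrier M" if "u \<in> carrier M" for u using that D E by simp
  show "D (u \<oplus>\<^bsub>M\<^esub> v) \<oplus>\<^bsub>M\<^esub> E (u \<oplus>\<^bsub>M\<^esub> v) = D u \<oplus>\<^bsub>M\<^esub> E u \<oplus>\<^bsub>M\<^esub> (D v \<oplus>\<^bsub>M\<^esub> E v)"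
    if "u \<in> carrier M" "v \<in> carrier M" for u v
    using that by (simp add: D(2,3) E(2,3) M.a_ac)
  show "D (k \<odot>\<^bsub>M\<^esub> u) \<oplus>\<^bsub>M\<^esub> E (k \<odot>\<^bsub>M\<^esub> u) = k \<odot>\<^bsub>M\<^esub> (D u \<oplus>\<^bsub>M\<^esub> E u)"
    if "k \<in> carrier R" "u \<in> carrier M" for k u
    using that by (simp add: D(2,4) E(2,4) smult_r_distr)
  show "D (u \<otimes>\<^bsub>M\<^esub> v) \<oplus>\<^bsub>M\<^esub> E (u \<otimes>\<^bsub>M\<^esub> v) =
      (D u \<oplus>\<^bsub>M\<^esub> E u) \<otimes>\<^bsub>M\<^esub> v \<oplus>\<^bsub>M\<^esub> u \<otimes>\<^bsub>M\<^esub> (D v \<oplus>\<^bsub>M\<^esub> E v)"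
    if "u \<in> carrier M" "v \<in> carrier M" for u v
    using that by (simp add: D(2,5) E(2,5) l_distr r_distr M.a_ac)
qed

lemma derivation_smult:
  assumes w: "w \<in> carrier M" and "D \<in> derivations R M"
  shows "(\<lambda>v\<in>carrier M. w \<otimes>\<^bsub>M\<^esub> D v) \<in> derivations R M"
proof (rule derivationsI)
  note D = derivationsD[OF assms(2)]
  show "w \<otimes>\<^bsub>M\<^esub> D u \<in> carrier M" if "u \<in> carrier M" for u using that w D by simp
  show "w \<otimes>\<^bsub>M\<^esub> D (u \<oplus>\<^bsub>M\<^esub> v) = w \<otimes>\<^bsub>M\<^esub> D u \<oplus>\<^bsub>M\<^esub> w \<otimes>\<^bsub>M\<^esub> D v"
    if "u \<in> carrier M" "v \<in> carrier M" for u v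
    using that w by (simp add: D(2,3) r_distr)
  show "w \<otimes>\<^bsub>M\<^esub> D (k \<odot>\<^bsub>M\<^esub> u) = k \<odot>\<^bsub>M\<^esub> (w \<otimes>\<^bsub>M\<^esub> D u)"
    if "k \<in> carrier R" "u \<in> carrier M" for k u
    using that w smult_assoc2[of k "D u" w] by (simp add: D(2,4) m_comm[of w])
  show "w \<otimes>\<^bsub>M\<^esub> D (u \<otimes>\<^bsub>M\<^esub> v) = (w \<otimes>\<^bsub>M\<^esub> D u) \<otimes>\<^bsub>M\<^esub> v \<oplus>\<^bsub>M\<^esub> u \<otimes>\<^bsub>M\<^esub> (w \<otimes>\<^bsub>M\<^esub> D v)"
    if "u \<in> carrier M" "v \<in> carrier M" for u v
    using that w by (simp add: D(2,5) r_distr m_ac)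
qed

text \<open>Negation is multiplication by -1, so closure under sums and scalars already gives an
  additive subgroup. Identifying the inverse requires the group structure on the derivations, which
  is therefore established inside the proof.\<close>

lemma der_submoduleI:
  assumes T: "T \<subseteq> derivations R M" and zero: "(\<lambda>v\<in>carrier M. \<zero>\<^bsub>M\<^esub>) \<in> T"
    and add: "\<And>D E. \<lbrakk>D \<in> T; E \<in> T\<rbrakk> \<Longrightarrow> (\<lambda>v\<in>carrier M. D v \<oplus>\<^bsub>M\<^esub> E v) \<in> T"
    and smult: "\<And>w D. \<lbrakk>w \<in> carrier M; D \<in> T\<rbrakk> \<Longrightarrow> (\<lambda>v\<in>carrier M. w \<otimes>\<^bsub>M\<^esub> D v) \<in> T"
  shows "submodule T M (Der R M)"
proof -
  let ?G = "add_monoid (Der R M)"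
  have G: "carrier ?G = derivations R M" "\<one>\<^bsub>?G\<^esub> = (\<lambda>v\<in>carrier M. \<zero>\<^bsub>M\<^esub>)"
    "D \<otimes>\<^bsub>?G\<^esub> E = (\<lambda>v\<in>carrier M. D v \<oplus>\<^bsub>M\<^esub> E v)" for D E
    by (simp_all add: Der_def)
  have neg: "(\<lambda>v\<in>carrier M. (\<lambda>v\<in>carrier M. \<ominus>\<^bsub>M\<^esub> \<one>\<^bsub>M\<^esub> \<otimes>\<^bsub>M\<^esub> D v) v \<oplus>\<^bsub>M\<^esub> D v) = (\<lambda>v\<in>carrier M. \<zero>\<^bsub>M\<^esub>)"
    if "D \<in> derivations R M" for D
    using derivationsD(2)[OF that] by (intro restrict_ext) (simp add: l_minus M.l_neg)
  have grp: "group ?G"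
  proof (rule groupI, unfold G)
    show "\<exists>E\<in>derivations R M. (\<lambda>v\<in>carrier M. E v \<oplus>\<^bsub>M\<^esub> D v) = (\<lambda>v\<in>carrier M. \<zero>\<^bsub>M\<^esub>)"
      if "D \<in> derivations R M" for D
      using neg[OF that] derivation_smult[OF _ that, of "\<ominus>\<^bsub>M\<^esub> \<one>\<^bsub>M\<^esub>"]
      by (intro bexI[of _ "\<lambda>v\<in>carrier M. \<ominus>\<^bsub>M\<^esub> \<one>\<^bsub>M\<^esub> \<otimes>\<^bsub>M\<^esub> D v"]) auto
    show "(\<lambda>v\<in>carrier M. (\<lambda>v\<in>carrier M. \<zero>\<^bsub>M\<^esub>) v \<oplus>\<^bsub>M\<^esub> D v) = D" if "D \<in> derivations R M" for D
      using derivationsD(1,2)[OF that] by (intro extensionalityI[of _ "carrier M"]) auto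
    show "(\<lambda>v\<in>carrier M. (\<lambda>v\<in>carrier M. D v \<oplus>\<^bsub>M\<^esub> E v) v \<oplus>\<^bsub>M\<^esub> F v) =
        (\<lambda>v\<in>carrier M. D v \<oplus>\<^bsub>M\<^esub> (\<lambda>v\<in>carrier M. E v \<oplus>\<^bsub>M\<^esub> F v) v)"
      if "D \<in> derivations R M" "E \<in> derivations R M" "F \<in> derivations R M" for D E F
      using derivationsD(2)[OF that(1)] derivationsD(2)[OF that(2)] derivationsD(2)[OF that(3)]
      by (intro restrict_ext) (simp add: M.a_assoc)
  qed (auto intro: derivation_zero derivation_add)
  then interpret G: group ?G .
  have "inv\<^bsub>?G\<^esub> D \<in> T" if D: "D \<in> T" for D
  proof -
    have d: "D \<in> derivations R M" using T D by auto
    have "inv\<^bsub>?G\<^esub> D = (\<lambda>v\<in>carrier M. \<ominus>\<^bsub>M\<^esub> \<one>\<^bsub>M\<^esub> \<otimes>\<^bsub>M\<^esub> D v)"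
      using neg[OF d] d derivation_smult[OF _ d, of "\<ominus>\<^bsub>M\<^esub> \<one>\<^bsub>M\<^esub>"]
      by (intro G.inv_equality) (simp_all only: G a_inv_closed one_closed)
    then show ?thesis using smult[OF _ D, of "\<ominus>\<^bsub>M\<^esub> \<one>\<^bsub>M\<^esub>"] by simp
  qed
  then have "subgroup T ?G"
  proof (intro G.subgroupI)
    show "T \<subseteq> carrier ?G" unfolding G by (rule T)
    show "T \<noteq> {}" using zero by blast
    show "D \<otimes>\<^bsub>?G\<^esub> E \<in> T" if "D \<in> T" "E \<in> T" for D E unfolding G using that by (rule add)
  qed
  then show ?thesis
    using smult by (intro submodule.intro submodule_axioms.intro) (simp_all add: Der_def)
qed

lemma hamiltonian_span_subset:
  assumes "submodule T M (Der R M)" "hamiltonian_derivations M br \<subseteq> T"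
  shows "hamiltonian_span R M br \<subseteq> T"
  unfolding hamiltonian_span_def using assms by (rule hull_minimal[rotated])

end

lemma (in poisson_algebra) hamiltonian_derivation:
  assumes "u \<in> carrier A" shows "(\<lambda>v\<in>carrier A. br u v) \<in> derivations K A"
  using assms by (intro derivationsI) (auto intro: br_closed br_add br_smult br_leibniz)

lemma gwp_of_H_induct [case_names const H X Y add mult]:
  fixes f :: "'k::field_char_0 poly poly poly"
  assumes "\<And>c. P (polyH [:c:])" "P (polyH [:0, 1:])" "P varX" "P varY"
    "\<And>f g. P f \<Longrightarrow> P g \<Longrightarrow> P (f + g)" "\<And>f g. P f \<Longrightarrow> P g \<Longrightarrow> P (f * g)"
  shows "P f"
proof (induction f rule: poly3_induct)
  case (const p)
  show ?case
  proof (induction p)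
    case 0
    show ?case using assms(1)[of 0] by (simp add: polyH_def)
  next
    case (pCons c p)
    have "polyH (pCons c p) = polyH [:c:] + polyH [:0, 1:] * polyH p" by (simp add: polyH_def)
    then show ?case using assms(1,2,5,6) pCons by metis
  qed
qed (use assms in blast)+

context
  fixes a :: "'k::field_char_0 poly"
begin

interpretation M: algebra "type_ring :: 'k ring" "gwp_algebra a" by (rule gwp_algebra_is_algebra)

text \<open>The product rule at 1 times 1 gives D(1) = D(1) + D(1), so D(1) = 0, and K-linearity
  does the rest.\<close>

lemma gwp_derivation_const:
  assumes "D \<in> derivations (type_ring :: 'k ring) (gwp_algebra a)"
  shows "D (gwp_class a (polyH [:c:])) = gwp_class a 0"
proof -
  note D = M.derivationsD[OF assms]
  obtain e where e: "D (gwp_class a 1) = gwp_class a e" using gwp_cases[OF D(2)[OF gwp_closed]] by metis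
  have "gwp_class a e = gwp_class a (e + e)"
    using D(5)[OF gwp_closed gwp_closed, of 1 1] by (simp add: e gwp_simps(2,3))
  then have "gwp_rel a dvd - e" unfolding gwp_class_eq_iff by simp
  then have z: "gwp_class a e = gwp_class a 0" unfolding gwp_class_eq_iff by simp
  have "D (c \<odot>\<^bsub>gwp_algebra a\<^esub> gwp_class a 1) = c \<odot>\<^bsub>gwp_algebra a\<^esub> gwp_class a e"
    unfolding e[symmetric] by (rule D(4)) (simp_all add: type_ring_simps gwp_closed)
  then show ?thesis unfolding z gwp_simps(6) by simp
qed

text \<open>The elements sent into an ideal by a derivation are closed under sums and products, so
  generators suffice. The zero ideal yields uniqueness of derivations, the ideal bA the divisibility
  of all brackets by b.\<close>

lemma gwp_derivation_values:
  assumes D: "D \<in> derivations (type_ring :: 'k ring) (gwp_algebra a)" and I: "ideal I (gwp_algebra a)"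
    and gen: "D (gwp_H a) \<in> I" "D (gwp_X a) \<in> I" "D (gwp_Y a) \<in> I"
  shows "D (gwp_class a f) \<in> I"
proof -
  interpret I: ideal I "gwp_algebra a" by (rule I)
  note D' = M.derivationsD[OF D]
  show ?thesis
  proof (induction f rule: gwp_of_H_induct)
    case (const c)
    show ?case unfolding gwp_derivation_const[OF D] using additive_subgroup.zero_closed[OF ideal.axioms(1)[OF I]]
      by (simp add: gwp_simps(4))
  next
    case (add f g)
    then show ?case using additive_subgroup.a_closed[OF ideal.axioms(1)[OF I] add]
        D'(3)[OF gwp_closed gwp_closed, of f g] by (simp add: gwp_simps(2))
  next
    case (mult f g)
    have "D (gwp_class a f) \<otimes>\<^bsub>gwp_algebra a\<^esub> gwp_class a g \<oplus>\<^bsub>gwp_algebra a\<^esub>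
        gwp_class a f \<otimes>\<^bsub>gwp_algebra a\<^esub> D (gwp_class a g) \<in> I"
      by (rule additive_subgroup.a_closed[OF ideal.axioms(1)[OF I] I.I_r_closed[OF mult(1) gwp_closed]
          I.I_l_closed[OF mult(2) gwp_closed]])
    then show ?case using D'(5)[OF gwp_closed gwp_closed, of f g] by (simp add: gwp_simps(3))
  qed (use gen in \<open>simp_all only: gwp_H_def gwp_X_def gwp_Y_def gwp_of_def\<close>)
qed

lemma gwp_derivation_eqI:
  assumes D: "D \<in> derivations (type_ring :: 'k ring) (gwp_algebra a)"
    and E: "E \<in> derivations (type_ring :: 'k ring) (gwp_algebra a)"
    and gen: "D (gwp_H a) = E (gwp_H a)" "D (gwp_X a) = E (gwp_X a)" "D (gwp_Y a) = E (gwp_Y a)"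
  shows "D = E"
proof -
  let ?A = "gwp_algebra a"
  let ?n = "\<lambda>v\<in>carrier ?A. \<ominus>\<^bsub>?A\<^esub> \<one>\<^bsub>?A\<^esub> \<otimes>\<^bsub>?A\<^esub> E v"
  let ?F = "\<lambda>v\<in>carrier ?A. D v \<oplus>\<^bsub>?A\<^esub> ?n v"
  note D' = M.derivationsD[OF D] and E' = M.derivationsD[OF E]
  have F: "?F \<in> derivations (type_ring :: 'k ring) ?A"
    by (intro M.derivation_add M.derivation_smult D E) simp
  have Fv: "?F v = D v \<ominus>\<^bsub>?A\<^esub> E v" if "v \<in> carrier ?A" for v
    using that D'(2)[OF that] E'(2)[OF that] by (simp add: M.l_minus M.minus_eq)
  have c: "gwp_H a \<in> carrier ?A" "gwp_X a \<in> carrier ?A" "gwp_Y a \<in> carrier ?A"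
    by (simp_all add: gwp_H_def gwp_X_def gwp_Y_def gwp_of_def gwp_closed)
  have Fz: "?F (gwp_class a f) \<in> {\<zero>\<^bsub>?A\<^esub>}" for f
    by (rule gwp_derivation_values[OF F M.zeroideal])
      (simp_all only: Fv c gen M.minus_eq M.r_neg E'(2) singleton_iff)
  then have "D v = E v" if v: "v \<in> carrier ?A" for v
  proof -
    obtain f where f: "v = gwp_class a f" using v by (rule gwp_cases)
    have "D v \<ominus>\<^bsub>?A\<^esub> E v = \<zero>\<^bsub>?A\<^esub>"
      using Fz[of f] unfolding f[symmetric] Fv[OF that] by (rule singletonD)
    then show ?thesis using M.r_right_minus_eq[OF D'(2)[OF that] E'(2)[OF that]] by (rule iffD1[rotated])
  qed
  then show ?thesis using D'(1) E'(1) by (intro extensionalityI[of _ "carrier ?A"])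
qed

end

definition gwp_multiples :: "'k::field_char_0 poly \<Rightarrow> 'k poly \<Rightarrow> 'k poly poly poly set set" where
  "gwp_multiples a b = {gwp_class a (polyH b * k) | k. True}"

lemma gwp_multiples_iff: "x \<in> gwp_multiples a b \<longleftrightarrow> (\<exists>k. x = gwp_class a (polyH b * k))"
  by (simp add: gwp_multiples_def)

lemma gwp_multiples_ideal: "ideal (gwp_multiples a b) (gwp_algebra a)"
proof -
  let ?A = "gwp_algebra a"
  interpret A: cring ?A by (rule gwp_cring)
  note I = gwp_multiples_iff
  show ?thesis
  proof (rule A.cring_idealI)
    show "gwp_multiples a b \<subseteq> carrier ?A" using gwp_closed unfolding gwp_multiples_def by blast
    show "\<zero>\<^bsub>?A\<^esub> \<in> gwp_multiples a b" unfolding I gwp_simps(4)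
      by (rule exI[of _ 0]) (simp only: mult_zero_right)
    show "x \<oplus>\<^bsub>?A\<^esub> y \<in> gwp_multiples a b" if xy: "x \<in> gwp_multiples a b" "y \<in> gwp_multiples a b" for x y
    proof -
      obtain k l where "x = gwp_class a (polyH b * k)" "y = gwp_class a (polyH b * l)"
        using xy unfolding I by (elim exE)
      then have "x \<oplus>\<^bsub>?A\<^esub> y = gwp_class a (polyH b * (k + l))" by (simp only: gwp_simps(2) distrib_left)
      then show ?thesis unfolding I by (rule exI)
    qed
    show "x \<otimes>\<^bsub>?A\<^esub> y \<in> gwp_multiples a b" if x: "x \<in> carrier ?A" and y: "y \<in> gwp_multiples a b" for x y
    proof -
      obtain f where "x = gwp_class a f" using x by (rule gwp_cases)
      moreover obtain l where "y = gwp_class a (polyH b * l)" using y unfolding I by (elim exE)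
      ultimately have "x \<otimes>\<^bsub>?A\<^esub> y = gwp_class a (polyH b * (f * l))"
        by (simp only: gwp_simps(3) mult.left_commute)
      then show ?thesis unfolding I by (rule exI)
    qed
  qed
qed

text \<open>For \<open>(x, y, h)\<close> the values of a derivation at \<open>X, Y, H\<close>, the coefficients come from splitting
  \<open>h = (la \<cdot> a + ma \<cdot> a') h\<close> with \<open>a = XY\<close> and \<open>a' h = xY + Xy\<close>.\<close>

lemma bezout_combination:
  fixes U V :: "'a::comm_ring_1"
  assumes iB: "i * B = 1" and bez: "la * aa + ma * ad = 1" and r: "r = U * V - aa"
    and w: "x * V + U * y - ad * h = r * w"
    and \<alpha>: "\<alpha> = - (i * (ma * y))" and \<beta>: "\<beta> = i * (ma * x + la * U * h)" and \<gamma>: "\<gamma> = - (i * (la * U * y))"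
  shows "h - (\<alpha> * - (B * U) + \<beta> * (B * V) + \<gamma> * 0) = r * (- (ma * w) - la * h)"
    and "x - (\<alpha> * 0 + \<beta> * (B * ad) + \<gamma> * (B * U)) = r * (la * U * w - la * x)"
    and "y - (\<alpha> * - (B * ad) + \<beta> * 0 + \<gamma> * - (B * V)) = r * (- (la * y))"
proof -
  have XY: "U * V = r + aa" using r by simp
  have w1: "x * V + U * y = r * w + ad * h" using w by (simp add: diff_eq_eq)
  have w2: "ad * h - U * y = x * V - r * w" using w1 by (simp add: algebra_simps)
  have "h - (\<alpha> * - (B * U) + \<beta> * (B * V) + \<gamma> * 0) = h - (i * B) * (ma * (x * V + U * y) + la * (U * V) * h)"
    unfolding \<alpha> \<beta> \<gamma> by (simp add: algebra_simps)
  also have "\<dots> = (1 - (la * aa + ma * ad)) * h + r * (- (ma * w) - la * h)"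
    unfolding iB w1 XY by (simp add: algebra_simps)
  finally show "h - (\<alpha> * - (B * U) + \<beta> * (B * V) + \<gamma> * 0) = r * (- (ma * w) - la * h)"
    unfolding bez by simp
  have "x - (\<alpha> * 0 + \<beta> * (B * ad) + \<gamma> * (B * U)) = x - (i * B) * (ma * ad * x + la * U * (ad * h - U * y))"
    unfolding \<alpha> \<beta> \<gamma> by (simp add: algebra_simps)
  also have "\<dots> = x - (ma * ad * x + la * x * (U * V) - la * U * r * w)"
    unfolding iB w2 by (simp add: algebra_simps)
  also have "\<dots> = (1 - (la * aa + ma * ad)) * x + r * (la * U * w - la * x)"
    unfolding XY by (simp add: algebra_simps)
  finally show "x - (\<alpha> * 0 + \<beta> * (B * ad) + \<gamma> * (B * U)) = r * (la * U * w - la * x)"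
    unfolding bez by simp
  have "y - (\<alpha> * - (B * ad) + \<beta> * 0 + \<gamma> * - (B * V)) = y - (i * B) * (ma * ad * y + la * (U * V) * y)"
    unfolding \<alpha> \<beta> \<gamma> by (simp add: algebra_simps)
  also have "\<dots> = (1 - (la * aa + ma * ad)) * y + r * (- (la * y))"
    unfolding iB XY by (simp add: algebra_simps)
  finally show "y - (\<alpha> * - (B * ad) + \<beta> * 0 + \<gamma> * - (B * V)) = r * (- (la * y))"
    unfolding bez by simp
qed

section \<open>Hamiltonian derivations and their span\<close>

locale gwp_poisson =
  fixes a b :: "'k::field_char_0 poly"
    and br :: "'k poly poly poly set \<Rightarrow> 'k poly poly poly set \<Rightarrow> 'k poly poly poly set"
  assumes a0: "a \<noteq> 0" and brk: "gwp_bracket a (\<lambda>p. b * pderiv p) br"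
begin

abbreviation "K \<equiv> (type_ring :: 'k ring)"
abbreviation "A \<equiv> gwp_algebra a"
abbreviation "cl \<equiv> gwp_class a"

sublocale P: poisson_algebra K A br
  using brk by (simp add: gwp_bracket_def Let_def)

lemma gen_class:
  "gwp_H a = cl (polyH [:0, 1:])" "gwp_X a = cl varX" "gwp_Y a = cl varY" "gwp_of a p = cl (polyH p)"
  by (simp_all add: gwp_H_def gwp_X_def gwp_Y_def gwp_of_def)

lemma br_gen:
  "br (cl varX) (cl varX) = cl 0" "br (cl varY) (cl varY) = cl 0"
  "br (cl (polyH [:0, 1:])) (cl (polyH [:0, 1:])) = cl 0"
  "br (cl varY) (cl varX) = cl (polyH (b * pderiv a))"
  "br (cl varX) (cl varY) = cl (- polyH (b * pderiv a))"
  "br (cl varY) (cl (polyH [:0, 1:])) = cl (polyH b * varY)"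
  "br (cl (polyH [:0, 1:])) (cl varY) = cl (- (polyH b * varY))"
  "br (cl varX) (cl (polyH [:0, 1:])) = cl (- (polyH b * varX))"
  "br (cl (polyH [:0, 1:])) (cl varX) = cl (polyH b * varX)"
proof -
  note B = brk[unfolded gwp_bracket_def Let_def gen_class]
  show z: "br (cl varX) (cl varX) = cl 0" "br (cl varY) (cl varY) = cl 0"
    "br (cl (polyH [:0, 1:])) (cl (polyH [:0, 1:])) = cl 0"
    unfolding gwp_simps(4)[symmetric] by (rule P.br_self[OF gwp_closed])+
  show yx: "br (cl varY) (cl varX) = cl (polyH (b * pderiv a))" using B by simp
  have p: "pderiv [:0, 1 :: 'k:] = 1" by (simp add: pderiv_pCons one_pCons)
  have "br (cl varY) (cl (polyH [:0, 1:])) = cl (polyH (b * pderiv [:0, 1:])) \<otimes>\<^bsub>A\<^esub> cl varY"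
    using B by simp
  then show yh: "br (cl varY) (cl (polyH [:0, 1:])) = cl (polyH b * varY)"
    by (simp only: p mult_1_right gwp_simps(3))
  have "br (cl varX) (cl (polyH [:0, 1:])) = \<ominus>\<^bsub>A\<^esub> (cl (polyH (b * pderiv [:0, 1:])) \<otimes>\<^bsub>A\<^esub> cl varX)"
    using B by simp
  then show xh: "br (cl varX) (cl (polyH [:0, 1:])) = cl (- (polyH b * varX))"
    by (simp only: p mult_1_right gwp_simps(3) gwp_uminus)
  have anti: "br (cl f) (cl g) = \<ominus>\<^bsub>A\<^esub> br (cl g) (cl f)" for f g
    by (rule P.br_anti[OF gwp_closed gwp_closed])
  show "br (cl varX) (cl varY) = cl (- polyH (b * pderiv a))"
    unfolding anti[of varX] yx gwp_uminus ..
  show "br (cl (polyH [:0, 1:])) (cl varY) = cl (- (polyH b * varY))"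
    unfolding anti[of "polyH [:0, 1:]"] yh gwp_uminus ..
  show "br (cl (polyH [:0, 1:])) (cl varX) = cl (polyH b * varX)"
    unfolding anti[of "polyH [:0, 1:]"] xh gwp_uminus by simp
qed

abbreviation "ham u \<equiv> (\<lambda>v\<in>carrier A. br u v)"

lemma ham_der: "ham (cl f) \<in> derivations K A"
  by (rule P.hamiltonian_derivation[OF gwp_closed])

lemma ham_cl: "ham (cl f) (cl g) = br (cl f) (cl g)" by (simp add: gwp_closed)

lemma hamiltonian_derivations_eq: "hamiltonian_derivations A br = range (\<lambda>f. ham (cl f))"
  unfolding hamiltonian_derivations_def gwp_simps(1) by (auto simp only:)

lemma span_subset_der: "hamiltonian_span K A br \<subseteq> derivations K A"
proof (rule P.hamiltonian_span_subset)
  show "submodule (derivations K A) A (Der K A)"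
    by (rule P.der_submoduleI) (auto intro: P.derivation_zero P.derivation_add P.derivation_smult)
  show "hamiltonian_derivations A br \<subseteq> derivations K A"
    unfolding hamiltonian_derivations_eq using ham_der by blast
qed

text \<open>The values on generators are extended in one argument at a time: the Hamiltonian
  derivation of a generator takes values in bA, antisymmetry exchanges the arguments, and then the
  Hamiltonian derivation of any element takes values in bA.\<close>

lemma br_in_multiples: "br (cl f) (cl g) \<in> gwp_multiples a b"
proof -
  note id = gwp_multiples_ideal[of a b]
  have I: "cl (polyH b * k) \<in> gwp_multiples a b" for k unfolding gwp_multiples_iff by (rule exI, rule refl)
  have I0: "cl 0 \<in> gwp_multiples a b" using I[of 0] by (simp only: mult_zero_right)
  have In: "cl (- (polyH b * k)) \<in> gwp_multiples a b" for k using I[of "- k"] by (simp only: mult_minus_right)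
  have Ip: "cl (polyH (b * p)) \<in> gwp_multiples a b" "cl (- polyH (b * p)) \<in> gwp_multiples a b" for p
    using I[of "polyH p"] In[of "polyH p"] by (simp_all only: polyH_ring)
  have H: "br (cl h) (cl g) \<in> gwp_multiples a b" if "h \<in> {polyH [:0, 1:], varX, varY}" for h g
  proof -
    have "ham (cl h) (cl g) \<in> gwp_multiples a b"
    proof (rule gwp_derivation_values[OF ham_der id])
      show "ham (cl h) (gwp_H a) \<in> gwp_multiples a b" "ham (cl h) (gwp_X a) \<in> gwp_multiples a b"
        "ham (cl h) (gwp_Y a) \<in> gwp_multiples a b"
        unfolding gen_class ham_cl using that
        by (elim insertE emptyE; simp only: br_gen I I0 In Ip)+
    qed
    then show ?thesis by (simp only: ham_cl)
  qed
  have flip: "br (cl f) (cl h) \<in> gwp_multiples a b" if h: "h \<in> {polyH [:0, 1:], varX, varY}" for h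
  proof -
    obtain k where k: "br (cl h) (cl f) = cl (polyH b * k)"
      using H[OF h, of f] unfolding gwp_multiples_iff by (elim exE)
    have "br (cl f) (cl h) = \<ominus>\<^bsub>A\<^esub> br (cl h) (cl f)" by (rule P.br_anti[OF gwp_closed gwp_closed])
    then have "br (cl f) (cl h) = cl (- (polyH b * k))" by (simp only: k gwp_uminus)
    then show ?thesis using In by (simp only:)
  qed
  have "ham (cl f) (cl g) \<in> gwp_multiples a b"
  proof (rule gwp_derivation_values[OF ham_der id])
    show "ham (cl f) (gwp_H a) \<in> gwp_multiples a b" "ham (cl f) (gwp_X a) \<in> gwp_multiples a b"
      "ham (cl f) (gwp_Y a) \<in> gwp_multiples a b"
      unfolding gen_class ham_cl by (rule flip, simp)+
  qed
  then show ?thesis by (simp only: ham_cl)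
qed

lemma b_unit_if_span:
  assumes "derivations K A = hamiltonian_span K A br" shows "\<exists>c. c \<noteq> 0 \<and> b = [:c:]"
proof -
  note id = gwp_multiples_ideal[of a b]
  note sg = ideal.axioms(1)[OF id]
  \<comment> \<open>The derivations with values in bA form a submodule that contains the Hamiltonian
    ones, hence their span, hence by assumption all derivations.\<close>
  define T where "T = {D \<in> derivations K A. \<forall>v\<in>carrier A. D v \<in> gwp_multiples a b}"
  have T: "D \<in> T \<longleftrightarrow> D \<in> derivations K A \<and> (\<forall>v\<in>carrier A. D v \<in> gwp_multiples a b)" for D
    by (simp only: T_def mem_Collect_eq)
  have "submodule T A (Der K A)"
  proof (rule P.der_submoduleI)
    show "T \<subseteq> derivations K A" using T by blast
    show "(\<lambda>v\<in>carrier A. \<zero>\<^bsub>A\<^esub>) \<in> T" unfolding T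
    proof (intro conjI ballI P.derivation_zero)
      show "(\<lambda>v\<in>carrier A. \<zero>\<^bsub>A\<^esub>) v \<in> gwp_multiples a b" if "v \<in> carrier A" for v
        using additive_subgroup.zero_closed[OF sg] that by (simp only: restrict_apply')
    qed
    show "(\<lambda>v\<in>carrier A. D v \<oplus>\<^bsub>A\<^esub> E v) \<in> T" if DE: "D \<in> T" "E \<in> T" for D E unfolding T
    proof (intro conjI ballI P.derivation_add)
      show "D \<in> derivations K A" "E \<in> derivations K A" using DE unfolding T by simp_all
      show "(\<lambda>v\<in>carrier A. D v \<oplus>\<^bsub>A\<^esub> E v) v \<in> gwp_multiples a b" if v: "v \<in> carrier A" for v
        using additive_subgroup.a_closed[OF sg] DE v unfolding T by (simp only: restrict_apply')
    qed
    show "(\<lambda>v\<in>carrier A. w \<otimes>\<^bsub>A\<^esub> D v) \<in> T" if w: "w \<in> carrier A" and D: "D \<in> T" for w D unfolding T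
    proof (intro conjI ballI P.derivation_smult w)
      show "D \<in> derivations K A" using D unfolding T by simp
      show "(\<lambda>v\<in>carrier A. w \<otimes>\<^bsub>A\<^esub> D v) v \<in> gwp_multiples a b" if v: "v \<in> carrier A" for v
        using ideal.I_l_closed[OF id] D v w unfolding T by (simp only: restrict_apply')
    qed
  qed
  moreover have "ham (cl f) \<in> T" for f
    unfolding T
  proof (intro conjI ballI ham_der)
    fix v assume "v \<in> carrier A"
    then obtain g where "v = cl g" by (rule gwp_cases)
    then show "ham (cl f) v \<in> gwp_multiples a b" using br_in_multiples[of f g] by (simp only: ham_cl)
  qed
  then have "hamiltonian_derivations A br \<subseteq> T" unfolding hamiltonian_derivations_eq by blast
  ultimately have "hamiltonian_span K A br \<subseteq> T" by (rule P.hamiltonian_span_subset)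
  then have sub: "derivations K A \<subseteq> T" unfolding assms .
  obtain br1 where br1: "gwp_bracket a (\<lambda>p. 1 * pderiv p) br1" using gwp_bracket_exists by blast
  interpret one: gwp_poisson a 1 br1 using a0 br1 by unfold_locales
  have "one.ham (cl (polyH [:0, 1:])) \<in> T" using sub one.ham_der by blast
  then have "one.ham (cl (polyH [:0, 1:])) (cl varX) \<in> gwp_multiples a b"
    unfolding T using gwp_closed by blast
  then have "cl varX \<in> gwp_multiples a b" unfolding one.ham_cl one.br_gen polyH_ring mult_1 .
  then obtain k where "cl varX = cl (polyH b * k)" unfolding gwp_multiples_iff by (elim exE)
  then obtain h where h: "varX - polyH b * k = gwp_rel a * h" unfolding gwp_class_eq_iff by (elim dvdE)
  \<comment> \<open>The substitution Y = a, X = 1 kills XY - a and therefore makes sense on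
    \<open>A\<close>. Applied to X = b k it exhibits 1 as a multiple of b in K[H].\<close>
  have "poly (poly (gwp_rel a) [:a:]) 1 = 0" by (simp add: gwp_rel_pCons)
  then have "poly (poly (varX - polyH b * k) [:a:]) 1 = 0" unfolding h by simp
  then have "1 = b * poly (poly k [:a:]) 1" by (simp add: polyH_def)
  then have "is_unit b" by (rule dvdI)
  then show ?thesis by (auto simp: is_unit_poly_iff)
qed

text \<open>The chain rule D(p(H)) = p'(H) D(H), by induction along p = c + H q with D(c) =
  0.\<close>

lemma derivation_polyH:
  assumes D: "D \<in> derivations K A" and h: "D (cl (polyH [:0, 1:])) = cl h"
  shows "D (cl (polyH p)) = cl (polyH (pderiv p) * h)"
proof (induction p)
  case 0
  show ?case using gwp_derivation_const[OF D, of 0] by (simp add: polyH_def)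
next
  case (pCons c p)
  note D' = P.derivationsD[OF D]
  have D_add: "D (cl (f + g)) = D (cl f) \<oplus>\<^bsub>A\<^esub> D (cl g)" for f g
    unfolding gwp_simps(2)[symmetric] by (rule D'(3)[OF gwp_closed gwp_closed])
  have D_mult: "D (cl (f * g)) = D (cl f) \<otimes>\<^bsub>A\<^esub> cl g \<oplus>\<^bsub>A\<^esub> cl f \<otimes>\<^bsub>A\<^esub> D (cl g)" for f g
    unfolding gwp_simps(3)[symmetric] by (rule D'(5)[OF gwp_closed gwp_closed])
  have e: "polyH (pCons c p) = polyH [:c:] + polyH [:0, 1:] * polyH p" by (simp add: polyH_def)
  have e2: "polyH (pderiv (pCons c p)) = polyH p + polyH [:0, 1:] * polyH (pderiv p)"
    by (simp add: pderiv_pCons polyH_def)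
  have "D (cl (polyH (pCons c p))) = D (cl (polyH [:c:])) \<oplus>\<^bsub>A\<^esub>
      (D (cl (polyH [:0, 1:])) \<otimes>\<^bsub>A\<^esub> cl (polyH p) \<oplus>\<^bsub>A\<^esub> cl (polyH [:0, 1:]) \<otimes>\<^bsub>A\<^esub> D (cl (polyH p)))"
    unfolding e D_add D_mult ..
  also have "\<dots> = cl (polyH (pderiv (pCons c p)) * h)"
    unfolding gwp_derivation_const[OF D] h pCons gwp_simps(2,3)
    by (simp only: e2 algebra_simps add_0_left)
  finally show ?case .
qed

lemma span_if_b_unit:
  assumes cop: "coprime a (pderiv a)" and b: "b = [:c:]" "c \<noteq> 0"
  shows "derivations K A \<subseteq> hamiltonian_span K A br"
proof
  fix D assume D: "D \<in> derivations K A"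
  note D' = P.derivationsD[OF D]
  obtain l m where lm: "l * a + m * pderiv a = 1" using cop unfolding coprime_poly_iff by (elim exE)
  obtain h where h: "D (cl (polyH [:0, 1:])) = cl h" by (rule gwp_cases[OF D'(2)[OF gwp_closed]])
  obtain x where x: "D (cl varX) = cl x" by (rule gwp_cases[OF D'(2)[OF gwp_closed]])
  obtain y where y: "D (cl varY) = cl y" by (rule gwp_cases[OF D'(2)[OF gwp_closed]])
  define la ma aa ad :: "'k poly poly poly" where "la = polyH l" "ma = polyH m" "aa = polyH a" "ad = polyH (pderiv a)"
  note df = this
  have bez: "la * aa + ma * ad = 1" unfolding df unfolding polyH_ring(1,2)[symmetric] lm unfolding polyH_ring ..
  have rel: "gwp_rel a = varX * varY - aa" unfolding df gwp_rel_def ..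
  have XY: "cl (varX * varY) = cl aa" unfolding gwp_class_eq_iff rel by simp
  \<comment> \<open>Applying D to XY = a gives x Y + X y = a' h in \<open>A\<close>;
    \<open>w\<close> is the cofactor of XY - a in the corresponding identity of polynomials.\<close>
  have "D (cl varX \<otimes>\<^bsub>A\<^esub> cl varY) = cl (x * varY + varX * y)"
    using D'(5)[OF gwp_closed gwp_closed] by (simp only: x y gwp_simps(2,3))
  then have "cl (x * varY + varX * y) = cl (ad * h)"
    unfolding gwp_simps(3) XY using derivation_polyH[OF D h, of a] by (simp only: df)
  then obtain w where w: "x * varY + varX * y - ad * h = gwp_rel a * w" unfolding gwp_class_eq_iff by (elim dvdE)
  define i B :: "'k poly poly poly" where "i = polyH [:inverse c:]" "B = polyH b"
  have iB: "i * B = 1" using b(2) by (simp add: i_B_def b(1) polyH_def one_pCons)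
  define \<alpha> \<beta> \<gamma> where "\<alpha> = - (i * (ma * y))" "\<beta> = i * (ma * x + la * varX * h)" "\<gamma> = - (i * (la * varX * y))"
  note abg = this
  let ?sm = "\<lambda>w D. \<lambda>v\<in>carrier A. w \<otimes>\<^bsub>A\<^esub> D v" and ?ad = "\<lambda>D E. \<lambda>v\<in>carrier A. D v \<oplus>\<^bsub>A\<^esub> E v"
  define E where "E = ?ad (?ad (?sm (cl \<alpha>) (ham (cl varX))) (?sm (cl \<beta>) (ham (cl varY))))
    (?sm (cl \<gamma>) (ham (cl (polyH [:0, 1:]))))"
  have Eder: "E \<in> derivations K A" unfolding E_def
    by (intro P.derivation_add P.derivation_smult ham_der gwp_closed)
  have Ecl: "E (cl f) = cl \<alpha> \<otimes>\<^bsub>A\<^esub> br (cl varX) (cl f) \<oplus>\<^bsub>A\<^esub> cl \<beta> \<otimes>\<^bsub>A\<^esub> br (cl varY) (cl f) \<oplus>\<^bsub>A\<^esub>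
      cl \<gamma> \<otimes>\<^bsub>A\<^esub> br (cl (polyH [:0, 1:])) (cl f)" for f
    unfolding E_def by (simp only: restrict_apply' gwp_closed)
  \<comment> \<open>Both sides are derivations, so it suffices to compare them at H, X and Y, where
    the three differences are explicit multiples of the relation.\<close>
  have "D = E"
  proof (rule gwp_derivation_eqI[OF D Eder], unfold gen_class h x y Ecl br_gen gwp_simps(2,3) gwp_class_eq_iff)
    have B: "polyH b = B" "polyH (b * pderiv a) = B * ad" by (simp_all only: i_B_def df polyH_ring)
    note id = bezout_combination[OF iB bez rel w abg]
    show "gwp_rel a dvd h - (\<alpha> * - (polyH b * varX) + \<beta> * (polyH b * varY) + \<gamma> * 0)"
      "gwp_rel a dvd x - (\<alpha> * 0 + \<beta> * polyH (b * pderiv a) + \<gamma> * (polyH b * varX))"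
      "gwp_rel a dvd y - (\<alpha> * - polyH (b * pderiv a) + \<beta> * 0 + \<gamma> * - (polyH b * varY))"
      unfolding B id by (rule dvd_triv_left)+
  qed
  moreover have "E \<in> hamiltonian_span K A br"
    unfolding hamiltonian_span_def hull_def
  proof (rule InterI, elim CollectE conjE)
    fix t assume t: "submodule t A (Der K A)" "hamiltonian_derivations A br \<subseteq> t"
    have hm: "ham (cl f) \<in> t" for f using t(2) unfolding hamiltonian_derivations_eq by blast
    have sm: "?sm w F \<in> t" if "w \<in> carrier A" "F \<in> t" for w F
      using submodule.smult_closed[OF t(1) that] by (simp add: Der_def)
    have ad: "?ad F G \<in> t" if "F \<in> t" "G \<in> t" for F G
      using subgroup.m_closed[OF submodule.axioms(1)[OF t(1)] that] by (simp add: Der_def)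
    show "E \<in> t" unfolding E_def by (intro ad sm hm gwp_closed)
  qed
  ultimately show "D \<in> hamiltonian_span K A br" by simp
qed

lemma der_span_iff:
  assumes "coprime a (pderiv a)"
  shows "carrier (Der K A) = hamiltonian_span K A br \<longleftrightarrow> (\<exists>c. c \<noteq> 0 \<and> b = [:c:])"
proof -
  have "carrier (Der K A) = derivations K A" by (simp add: Der_def)
  then show ?thesis using b_unit_if_span span_if_b_unit[OF assms] span_subset_der by blast
qed

end

section \<open>The rank of the bracket matrix\<close>

text \<open>For u = X, v = Y and d = a' this says, row by row, that (Y, X, -a') is in the kernel of
  the bracket matrix; the bracketing is that of a sum over the columns 0, 1, 2.\<close>

lemma skew_kernel:
  fixes u v b d :: "'a::comm_ring_1"
  shows "v * 0 + (u * - (b * d) + - d * - (b * u)) = 0" "v * (b * d) + (u * 0 + - d * (b * v)) = 0"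
    "v * (b * u) + (u * - (b * v) + - d * 0) = 0"
  by (simp_all add: algebra_simps)

context gwp_poisson begin

lemma gwp_matrix_eq:
  "gwp_matrix a br = mat_of_rows_list 3
    [[cl 0, cl (- polyH (b * pderiv a)), cl (- (polyH b * varX))],
     [cl (polyH (b * pderiv a)), cl 0, cl (polyH b * varY)],
     [cl (polyH b * varX), cl (- (polyH b * varY)), cl 0]]"
  unfolding gwp_matrix_def Let_def gen_class br_gen ..

interpretation AD: domain A by (rule gwp_domain[OF a0])

interpretation F: domain_localization A "carrier A - {\<zero>\<^bsub>A\<^esub>}"
proof
  show "s \<otimes>\<^bsub>A\<^esub> t \<in> carrier A - {\<zero>\<^bsub>A\<^esub>}"
    if "s \<in> carrier A - {\<zero>\<^bsub>A\<^esub>}" "t \<in> carrier A - {\<zero>\<^bsub>A\<^esub>}" for s t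
    using that AD.integral[of s t] by auto
qed auto

abbreviation "Q \<equiv> fraction_field A"
abbreviation "\<iota> f \<equiv> to_fraction_field A (cl f)"

lemma iota_closed: "\<iota> f \<in> carrier Q"
  unfolding fraction_field_def to_fraction_field_def by (rule F.fr_closed[OF gwp_closed F.one_S])

lemma iota_mult: "\<iota> f \<otimes>\<^bsub>Q\<^esub> \<iota> g = \<iota> (f * g)"
  unfolding fraction_field_def to_fraction_field_def
  by (subst F.fr_mult[OF gwp_closed F.one_S gwp_closed F.one_S]) (simp only: gwp_simps(3) P.l_one P.one_closed)

lemma iota_add: "\<iota> f \<oplus>\<^bsub>Q\<^esub> \<iota> g = \<iota> (f + g)"
  unfolding fraction_field_def to_fraction_field_def
  by (subst F.fr_add[OF gwp_closed F.one_S gwp_closed F.one_S])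
    (simp only: gwp_simps(2) P.l_one P.one_closed gwp_closed)

lemma iota_zero: "\<iota> f = \<zero>\<^bsub>Q\<^esub> \<longleftrightarrow> gwp_rel a dvd f"
  unfolding fraction_field_def to_fraction_field_def F.fr_eq_zero[OF gwp_closed F.one_S] gwp_class_zero ..

lemma Q_domain: "domain Q" unfolding fraction_field_def by (rule F.L_domain)

definition "Mx = map_mat (to_fraction_field A) (gwp_matrix a br)"

lemma Mx_dim: "dim_row Mx = 3" "dim_col Mx = 3"
  by (simp_all add: Mx_def gwp_matrix_eq mat_of_rows_list_def)

lemma Mx_entries:
  "Mx $$ (0, 0) = \<iota> 0" "Mx $$ (0, 1) = \<iota> (- polyH (b * pderiv a))" "Mx $$ (0, 2) = \<iota> (- (polyH b * varX))"
  "Mx $$ (1, 0) = \<iota> (polyH (b * pderiv a))" "Mx $$ (1, 1) = \<iota> 0" "Mx $$ (1, 2) = \<iota> (polyH b * varY)"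
  "Mx $$ (2, 0) = \<iota> (polyH b * varX)" "Mx $$ (2, 1) = \<iota> (- (polyH b * varY))" "Mx $$ (2, 2) = \<iota> 0"
  unfolding Mx_def gwp_matrix_eq mat_of_rows_list_def by (simp_all add: numeral_2_eq_2)

lemma Mx_closed: "i < 3 \<Longrightarrow> j < 3 \<Longrightarrow> Mx $$ (i, j) \<in> carrier Q"
proof -
  assume "i < 3" "j < 3"
  then have "i = 0 \<or> i = 1 \<or> i = 2" "j = 0 \<or> j = 1 \<or> j = 2" by linarith+
  then show ?thesis by (elim disjE; simp only: Mx_entries iota_closed)
qed

text \<open>All entries vanish, so on a nonempty set of columns the constant coefficients 1 form a
  nontrivial relation.\<close>

lemma rank_zero: assumes "b = 0" shows "mat_rank Q Mx = 0"
proof -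
  interpret Q: domain Q by (rule Q_domain)
  have z: "Mx $$ (i, j) = \<zero>\<^bsub>Q\<^esub>" if "i < 3" "j < 3" for i j
  proof -
    have "i = 0 \<or> i = 1 \<or> i = 2" "j = 0 \<or> j = 1 \<or> j = 2" using that by linarith+
    then have "Mx $$ (i, j) = \<iota> 0"
      by (elim disjE; simp only: Mx_entries assms polyH_ring mult_zero_left minus_zero)
    then show ?thesis using iota_zero[of 0] by simp
  qed
  have J0: "J = {}" if J: "J \<subseteq> {..<dim_col Mx}" "cols_lin_indep Q Mx J" for J
  proof (rule ccontr)
    assume "J \<noteq> {}"
    have "(\<Oplus>\<^bsub>Q\<^esub>j\<in>J. \<one>\<^bsub>Q\<^esub> \<otimes>\<^bsub>Q\<^esub> Mx $$ (i, j)) = \<zero>\<^bsub>Q\<^esub>" if "i < dim_row Mx" for i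
    proof -
      have "(\<Oplus>\<^bsub>Q\<^esub>j\<in>J. \<one>\<^bsub>Q\<^esub> \<otimes>\<^bsub>Q\<^esub> Mx $$ (i, j)) = (\<Oplus>\<^bsub>Q\<^esub>j\<in>J. \<zero>\<^bsub>Q\<^esub>)"
        using that J(1) by (intro Q.finsum_cong') (auto simp: z Mx_dim)
      then show ?thesis by simp
    qed
    then have "\<forall>j\<in>J. \<one>\<^bsub>Q\<^esub> = \<zero>\<^bsub>Q\<^esub>"
      using J(2)[unfolded cols_lin_indep_def, rule_format, of "\<lambda>_. \<one>\<^bsub>Q\<^esub>"] by auto
    then show False using \<open>J \<noteq> {}\<close> Q.one_not_zero by blast
  qed
  have emp: "card J = 0" if "J \<subseteq> {..<dim_col Mx}" "cols_lin_indep Q Mx J" for J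
    by (simp add: J0[OF that])
  have "cols_lin_indep Q Mx {}" by (simp add: cols_lin_indep_def)
  then have "0 \<in> {card J | J. J \<subseteq> {..<dim_col Mx} \<and> cols_lin_indep Q Mx J}"
    by (intro CollectI exI[of _ "{}"]) simp
  moreover have "finite {card J | J. J \<subseteq> {..<dim_col Mx} \<and> cols_lin_indep Q Mx J}"
    by (rule finite_subset[of _ "card ` Pow {..<dim_col Mx}"]) auto
  ultimately show ?thesis unfolding mat_rank_def
    using emp by (intro Max_eqI) auto
qed

lemma not_rel_dvd: "\<not> gwp_rel a dvd varX" "b \<noteq> 0 \<Longrightarrow> \<not> gwp_rel a dvd polyH b * varX"
  "\<not> gwp_rel a dvd varY"
proof -
  show X: "\<not> gwp_rel a dvd varX" unfolding gwp_rel_dvd_const by simp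
  show "\<not> gwp_rel a dvd polyH b * varX" if "b \<noteq> 0"
  proof
    assume "gwp_rel a dvd polyH b * varX"
    then have "gwp_rel a dvd polyH b \<or> gwp_rel a dvd varX"
      by (rule prime_elem_dvd_multD[OF gwp_rel_prime[OF a0]])
    then have "gwp_rel a dvd polyH b" using X by meson
    then show False unfolding polyH_def gwp_rel_dvd_const using that by simp
  qed
  show "\<not> gwp_rel a dvd varY"
  proof
    assume "gwp_rel a dvd varY"
    then obtain h where h: "varY = gwp_rel a * h" by (elim dvdE)
    \<comment> \<open>The substitution Y = a, X = 1 kills the relation but sends Y to a, which is
      nonzero.\<close>
    have "poly (poly (gwp_rel a) [:a:]) 1 = 0" by (simp add: gwp_rel_pCons)
    then have "poly (poly varY [:a:]) 1 = 0" unfolding h by simp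
    then show False using a0 by simp
  qed
qed

text \<open>Columns 0 and 2 are independent because bX is nonzero in the domain \<open>A\<close>;
  all three columns are dependent through the kernel vector (Y, X, -a').\<close>

lemma rank_two: assumes b: "b \<noteq> 0" shows "mat_rank Q Mx = 2"
proof -
  interpret Q: domain Q by (rule Q_domain)
  have z0: "\<iota> 0 = \<zero>\<^bsub>Q\<^esub>" unfolding iota_zero by simp
  have nz: "\<iota> (polyH b * varX) \<noteq> \<zero>\<^bsub>Q\<^esub>" "\<iota> (- (polyH b * varX)) \<noteq> \<zero>\<^bsub>Q\<^esub>"
    unfolding iota_zero dvd_minus_iff using not_rel_dvd(2)[OF b] by simp_all
  have ind: "cols_lin_indep Q Mx {0, 2}" unfolding cols_lin_indep_def
  proof (intro ballI impI)
    fix c j assume c: "c \<in> {0, 2} \<rightarrow> carrier Q" and j: "j \<in> {0, 2::nat}"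
      and s: "\<forall>i<dim_row Mx. (\<Oplus>\<^bsub>Q\<^esub>j\<in>{0, 2}. c j \<otimes>\<^bsub>Q\<^esub> Mx $$ (i, j)) = \<zero>\<^bsub>Q\<^esub>"
    have cc: "c 0 \<in> carrier Q" "c 2 \<in> carrier Q" using c by auto
    have sum: "c 0 \<otimes>\<^bsub>Q\<^esub> Mx $$ (i, 0) \<oplus>\<^bsub>Q\<^esub> c 2 \<otimes>\<^bsub>Q\<^esub> Mx $$ (i, 2) = \<zero>\<^bsub>Q\<^esub>" if i: "i < 3" for i
    proof -
      have "(\<Oplus>\<^bsub>Q\<^esub>j\<in>{0, 2}. c j \<otimes>\<^bsub>Q\<^esub> Mx $$ (i, j)) =
          c 0 \<otimes>\<^bsub>Q\<^esub> Mx $$ (i, 0) \<oplus>\<^bsub>Q\<^esub> c 2 \<otimes>\<^bsub>Q\<^esub> Mx $$ (i, 2)"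
        using cc Mx_closed[OF i, of 0] Mx_closed[OF i, of 2] by simp
      then show ?thesis using s i by (simp add: Mx_dim)
    qed
    \<comment> \<open>Row 0 vanishes in column 0 and row 2 in column 2, so these rows isolate one
      coefficient each, multiplied by -bX and bX.\<close>
    have "c 2 \<otimes>\<^bsub>Q\<^esub> \<iota> (- (polyH b * varX)) = \<zero>\<^bsub>Q\<^esub>"
      using sum[of 0] cc iota_closed[of "- (polyH b * varX)"] by (simp add: Mx_entries z0)
    then have "c 2 = \<zero>\<^bsub>Q\<^esub>" using Q.integral[OF _ cc(2) iota_closed] nz(2) by blast
    moreover have "c 0 \<otimes>\<^bsub>Q\<^esub> \<iota> (polyH b * varX) = \<zero>\<^bsub>Q\<^esub>"
      using sum[of 2] cc iota_closed[of "polyH b * varX"] by (simp add: Mx_entries z0)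
    then have "c 0 = \<zero>\<^bsub>Q\<^esub>" using Q.integral[OF _ cc(1) iota_closed] nz(1) by blast
    ultimately show "c j = \<zero>\<^bsub>Q\<^esub>" using j by auto
  qed
  have dep: "\<not> cols_lin_indep Q Mx {0, 1, 2}"
  proof
    assume ci: "cols_lin_indep Q Mx {0, 1, 2}"
    \<comment> \<open>The kernel vector is nontrivial because its first entry Y is nonzero in
      \<open>A\<close>.\<close>
    define v :: "nat \<Rightarrow> 'k poly poly poly" where
      "v = (\<lambda>j. if j = 0 then varY else if j = 1 then varX else - polyH (pderiv a))"
    have v: "v 0 = varY" "v 1 = varX" "v 2 = - polyH (pderiv a)" by (simp_all add: v_def)
    have "(\<Oplus>\<^bsub>Q\<^esub>j\<in>{0, 1, 2}. \<iota> (v j) \<otimes>\<^bsub>Q\<^esub> Mx $$ (i, j)) = \<zero>\<^bsub>Q\<^esub>" if i: "i < dim_row Mx" for i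
    proof -
      have i3: "i < 3" using i by (simp add: Mx_dim)
      have "(\<Oplus>\<^bsub>Q\<^esub>j\<in>{0, 1, 2}. \<iota> (v j) \<otimes>\<^bsub>Q\<^esub> Mx $$ (i, j)) =
          \<iota> (v 0) \<otimes>\<^bsub>Q\<^esub> Mx $$ (i, 0) \<oplus>\<^bsub>Q\<^esub> (\<iota> (v 1) \<otimes>\<^bsub>Q\<^esub> Mx $$ (i, 1) \<oplus>\<^bsub>Q\<^esub> \<iota> (v 2) \<otimes>\<^bsub>Q\<^esub> Mx $$ (i, 2))"
        (is "_ = ?g 0 \<oplus>\<^bsub>Q\<^esub> (?g 1 \<oplus>\<^bsub>Q\<^esub> ?g 2)")
      proof -
        have "?g j \<in> carrier Q" if "j < 3" for j
          by (intro Q.m_closed iota_closed Mx_closed i3 that)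
        then have "?g 0 \<in> carrier Q" "?g 1 \<in> carrier Q" "?g 2 \<in> carrier Q" by simp_all
        then show ?thesis by simp
      qed
      also have "\<dots> = \<iota> 0"
      proof -
        consider "i = 0" | "i = 1" | "i = 2" using i3 by linarith
        then show ?thesis
          by cases (simp_all only: Mx_entries v iota_mult iota_add polyH_ring skew_kernel)
      qed
      finally show ?thesis using z0 by simp
    qed
    then have sums: "\<forall>i<dim_row Mx. (\<Oplus>\<^bsub>Q\<^esub>j\<in>{0, 1, 2}. \<iota> (v j) \<otimes>\<^bsub>Q\<^esub> Mx $$ (i, j)) = \<zero>\<^bsub>Q\<^esub>"
      by (intro allI impI)
    have "(\<lambda>j. \<iota> (v j)) \<in> {0, 1, 2} \<rightarrow> carrier Q" by (intro Pi_I iota_closed)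
    from ci[unfolded cols_lin_indep_def, THEN bspec, OF this] sums
    have "\<forall>j\<in>{0, 1, 2}. \<iota> (v j) = \<zero>\<^bsub>Q\<^esub>" by (rule mp)
    then have "\<iota> (v 0) = \<zero>\<^bsub>Q\<^esub>" by (rule bspec) simp
    then show False unfolding iota_zero v using not_rel_dvd(3) by meson
  qed
  have "card J \<le> 2" if J: "J \<subseteq> {..<dim_col Mx}" "cols_lin_indep Q Mx J" for J
  proof (rule ccontr)
    assume c: "\<not> card J \<le> 2"
    have J3: "J \<subseteq> {0, 1, 2}" using J(1) by (auto simp: Mx_dim)
    have "card {0, 1, 2::nat} \<le> card J" using c by simp
    then have "J = {0, 1, 2}" using J3 by (intro card_seteq) auto
    then show False using J(2) dep by simp
  qed
  moreover have "finite {card J | J. J \<subseteq> {..<dim_col Mx} \<and> cols_lin_indep Q Mx J}"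
    by (rule finite_subset[of _ "card ` Pow {..<dim_col Mx}"]) auto
  moreover have "2 \<in> {card J | J. J \<subseteq> {..<dim_col Mx} \<and> cols_lin_indep Q Mx J}"
    using ind by (intro CollectI exI[of _ "{0, 2::nat}"]) (auto simp: Mx_dim)
  ultimately show ?thesis unfolding mat_rank_def by (intro Max_eqI) auto
qed

lemma rank_eq: "mat_rank Q Mx = (if b \<noteq> 0 then 2 else 0)"
  using rank_zero rank_two by simp

end

theorem lemma5p4:
  fixes a b :: "'k::field_char_0 poly"
    and br :: "'k poly poly poly set \<Rightarrow> 'k poly poly poly set \<Rightarrow> 'k poly poly poly set"
  assumes "a \<noteq> 0"
    and "gwp_bracket a (\<lambda>p. b * pderiv p) br"
  shows "let K = (type_ring :: 'k ring);
             KH = (type_ring :: 'k poly ring);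
             A = gwp_algebra a;
             x = gwp_X a; y = gwp_Y a;
             a' = gwp_of a (pderiv a); b' = gwp_of a b in
     domain A \<and>
     (regular_ring A \<longleftrightarrow> Idl\<^bsub>KH\<^esub> {a, pderiv a} = carrier KH) \<and>
     (Idl\<^bsub>KH\<^esub> {a, pderiv a} = carrier KH \<longleftrightarrow> coprime a (pderiv a)) \<and>
     (regular_ring A \<longrightarrow>
        (carrier (Der K A) = hamiltonian_span K A br \<longleftrightarrow> (\<exists>c. c \<noteq> 0 \<and> b = [:c:])) \<and>
        gwp_matrix a br = mat_of_rows_list 3
          [[\<zero>\<^bsub>A\<^esub>, \<ominus>\<^bsub>A\<^esub> (b' \<otimes>\<^bsub>A\<^esub> a'), \<ominus>\<^bsub>A\<^esub> (b' \<otimes>\<^bsub>A\<^esub> x)],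
           [b' \<otimes>\<^bsub>A\<^esub> a', \<zero>\<^bsub>A\<^esub>, b' \<otimes>\<^bsub>A\<^esub> y],
           [b' \<otimes>\<^bsub>A\<^esub> x, \<ominus>\<^bsub>A\<^esub> (b' \<otimes>\<^bsub>A\<^esub> y), \<zero>\<^bsub>A\<^esub>]] \<and>
        mat_rank (fraction_field A) (map_mat (to_fraction_field A) (gwp_matrix a br)) =
          (if b \<noteq> 0 then 2 else 0))"
proof -
  interpret P: gwp_poisson a b br using assms by unfold_locales
  have reg: "regular_ring (gwp_algebra a) \<longleftrightarrow> coprime a (pderiv a)"
    using gwp_regular[OF assms(1)] gwp_not_regular[OF assms(1)] by blast
  have mat: "gwp_matrix a br = mat_of_rows_list 3
      [[\<zero>\<^bsub>gwp_algebra a\<^esub>, \<ominus>\<^bsub>gwp_algebra a\<^esub> (gwp_of a b \<otimes>\<^bsub>gwp_algebra a\<^esub> gwp_of a (pderiv a)),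
        \<ominus>\<^bsub>gwp_algebra a\<^esub> (gwp_of a b \<otimes>\<^bsub>gwp_algebra a\<^esub> gwp_X a)],
       [gwp_of a b \<otimes>\<^bsub>gwp_algebra a\<^esub> gwp_of a (pderiv a), \<zero>\<^bsub>gwp_algebra a\<^esub>,
        gwp_of a b \<otimes>\<^bsub>gwp_algebra a\<^esub> gwp_Y a],
       [gwp_of a b \<otimes>\<^bsub>gwp_algebra a\<^esub> gwp_X a, \<ominus>\<^bsub>gwp_algebra a\<^esub> (gwp_of a b \<otimes>\<^bsub>gwp_algebra a\<^esub> gwp_Y a),
        \<zero>\<^bsub>gwp_algebra a\<^esub>]]"
    unfolding P.gwp_matrix_eq P.gen_class gwp_simps(3,4) gwp_uminus polyH_ring ..
  show ?thesis unfolding Let_def reg Idl_pair_iff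
    by (intro conjI impI refl gwp_domain[OF assms(1)] P.der_span_iff mat P.rank_eq[unfolded P.Mx_def])
qed

end
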